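(* Let $\gamma>1$, $0\le\mu\le 2$, $R>0$, let $\rho_0,u_0\in C_0^\infty(\mathbb{R})$ be supported in $\{|x|\le R\}$, and let $\varepsilon>0$ be sufficiently small. Consider the Cauchy problem $$ \begin{cases} \partial_t \rho+\partial_x(\rho u)=0,\\ \partial_t(\rho u)+\partial_x(\rho u^2)+\partial_x p(\rho)=-\dfrac{\mu}{1+t}\,\rho u,\\ \rho|_{t=0}=1+\varepsilon\rho_0(x),\quad u|_{t=0}=\varepsilon u_0(x), \end{cases} $$ with $p(\rho)=\frac1\gamma\rho^\gamma$, and define $$ q^0(r)=\int_r^\infty (x-r)^2\rho_0(x)\,dx,\qquad q^1(r)=2\int_r^\infty (x-r)(\rho_0u_0)(x)\,dx . $$ Suppose that for some $0<R_0<R$, $$ q^0(r)>0,\qquad q^1(r)\ge 0\qquad\text{for } R_0<r<R. $$ Then the lifespan $T_\varepsilon$ of $C^1$ solutions of the Cauchy problem is finite.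
   Context: This is the one-dimensional ($x\in\mathbb{R}$, $t\ge0$) isentropic compressible Euler system for a polytropic gas with time-decaying damping; $\rho$ is the density, $u$ the fluid velocity, $p(\rho)=\frac1\gamma\rho^\gamma$ the pressure, and $\mu$ describes the scale of the damping. The functions $\rho_0$ and $u_0$ are the profiles of the initial perturbation of the constant state $(\rho,u)=(1,0)$, and $(\rho_0u_0)(x)=\rho_0(x)u_0(x)$. The lifespan $T_\varepsilon$ is the largest existence time of $C^1$ solutions of the Cauchy problem. *)

theory Defs
  imports "HOL-Analysis.Analysis"
begin

definition smooth :: "(real \<Rightarrow> real) \<Rightarrow> bool" where
  "smooth f \<longleftrightarrow> (\<forall>n x. (deriv ^^ n) f differentiable (at x))"

definition supp :: "(real \<Rightarrow> real) \<Rightarrow> real set" where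
  "supp f = closure (support_on UNIV f)"

definition test_function :: "(real \<Rightarrow> real) \<Rightarrow> bool" where
  "test_function f \<longleftrightarrow> smooth f \<and> compact (supp f)"

text \<open>Functions of time and space are written \<open>f t x\<close> and considered on the strip
  \<open>0 \<le> t < T\<close>, \<open>x\<close> real. The time derivative at \<open>t = 0\<close> is one-sided, hence the
  derivative within \<open>{0..<T}\<close>.\<close>

definition dt :: "real \<Rightarrow> (real \<Rightarrow> real \<Rightarrow> real) \<Rightarrow> real \<Rightarrow> real \<Rightarrow> real" where
  "dt T f t x = vector_derivative (\<lambda>s. f s x) (at t within {0..<T})"

definition dx :: "(real \<Rightarrow> real \<Rightarrow> real) \<Rightarrow> real \<Rightarrow> real \<Rightarrow> real" where
  "dx f t x = deriv (\<lambda>y. f t y) x"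

definition C1_strip :: "real \<Rightarrow> (real \<Rightarrow> real \<Rightarrow> real) \<Rightarrow> bool" where
  "C1_strip T f \<longleftrightarrow>
     (\<forall>t\<in>{0..<T}. \<forall>x. (\<lambda>s. f s x) differentiable (at t within {0..<T})
                     \<and> (\<lambda>y. f t y) differentiable (at x)) \<and>
     continuous_on ({0..<T} \<times> UNIV) (\<lambda>(t, x). f t x) \<and>
     continuous_on ({0..<T} \<times> UNIV) (\<lambda>(t, x). dt T f t x) \<and>
     continuous_on ({0..<T} \<times> UNIV) (\<lambda>(t, x). dx f t x)"

definition pressure :: "real \<Rightarrow> real \<Rightarrow> real" where
  "pressure \<gamma> r = (1 / \<gamma>) * r powr \<gamma>"

text \<open>The density is required to be positive: a physical requirement, and \<open>powr\<close> is the
  intended power only for a positive base.\<close>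

definition C1_solution ::
  "real \<Rightarrow> real \<Rightarrow> real \<Rightarrow> (real \<Rightarrow> real) \<Rightarrow> (real \<Rightarrow> real) \<Rightarrow> real
    \<Rightarrow> (real \<Rightarrow> real \<Rightarrow> real) \<Rightarrow> (real \<Rightarrow> real \<Rightarrow> real) \<Rightarrow> bool" where
  "C1_solution \<gamma> \<mu> \<epsilon> \<rho>\<^sub>0 u\<^sub>0 T \<rho> u \<longleftrightarrow>
     C1_strip T \<rho> \<and> C1_strip T u \<and>
     (\<forall>t\<in>{0..<T}. \<forall>x. \<rho> t x > 0) \<and>
     (\<forall>t\<in>{0..<T}. \<forall>x. dt T \<rho> t x + dx (\<lambda>t x. \<rho> t x * u t x) t x = 0) \<and>
     (\<forall>t\<in>{0..<T}. \<forall>x.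
        dt T (\<lambda>t x. \<rho> t x * u t x) t x + dx (\<lambda>t x. \<rho> t x * (u t x)\<^sup>2) t x
          + dx (\<lambda>t x. pressure \<gamma> (\<rho> t x)) t x
        = - (\<mu> / (1 + t)) * (\<rho> t x * u t x)) \<and>
     (\<forall>x. \<rho> 0 x = 1 + \<epsilon> * \<rho>\<^sub>0 x) \<and>
     (\<forall>x. u 0 x = \<epsilon> * u\<^sub>0 x)"

text \<open>The supremum of all existence times, with value \<open>\<infinity>\<close> if there are \<open>C\<^sup>1\<close> solutions on
  arbitrarily long time intervals.\<close>

definition lifespan ::
  "real \<Rightarrow> real \<Rightarrow> real \<Rightarrow> (real \<Rightarrow> real) \<Rightarrow> (real \<Rightarrow> real) \<Rightarrow> ennreal" where
  "lifespan \<gamma> \<mu> \<epsilon> \<rho>\<^sub>0 u\<^sub>0 =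
     (SUP T\<in>{T. 0 < T \<and> (\<exists>\<rho> u. C1_solution \<gamma> \<mu> \<epsilon> \<rho>\<^sub>0 u\<^sub>0 T \<rho> u)}. ennreal T)"

definition q0 :: "(real \<Rightarrow> real) \<Rightarrow> real \<Rightarrow> real" where
  "q0 \<rho>\<^sub>0 r = (LBINT x:{r..}. (x - r)\<^sup>2 * \<rho>\<^sub>0 x)"

definition q1 :: "(real \<Rightarrow> real) \<Rightarrow> (real \<Rightarrow> real) \<Rightarrow> real \<Rightarrow> real" where
  "q1 \<rho>\<^sub>0 u\<^sub>0 r = 2 * (LBINT x:{r..}. (x - r) * (\<rho>\<^sub>0 x * u\<^sub>0 x))"

end

theory Submission
  imports Defs
begin

text \<open>Small global solutions are trivial. In Riemann invariants \<open>f\<close>, \<open>g\<close> the system is a pair of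
  transport equations with damping \<open>- a (f + g) / (1 + t)\<close>, \<open>a = \<mu> / 2\<close>. A maximum principle on
  backward cones gives finite speed of propagation, preservation of smallness and uniqueness forward and
  backward in time. A weighted version of \<open>f\<^sub>x\<close> satisfies a Riccati inequality along characteristics, so
  on a global solution \<open>f\<^sub>x\<close> and, by reflection, \<open>g\<^sub>x\<close> are bounded below by about
  \<open>- a / (1 + t)\<close> times the oscillation of the relative density. Since the support at time \<open>t\<close> has length
  about \<open>2 (1 + t)\<close>, comparing this with the total variation of the density gives the contradiction if \<open>a < 1\<close>.
  If \<open>a = 1\<close>, the energy bound turns the slope bound into decay; then the Riccati variable is
  nonnegative and nonincreasing, and it starts at zero outside the support of the data, which makes
  the solution vanish in finite time and, by backward uniqueness, initially.\<close>

text \<open>The threshold \<open>a = 1\<close> is a count. The slope bounds allow \<open>r\<close> a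
  variation over the support of about \<open>2 a\<close> times its oscillation; but \<open>r\<close>
  vanishes at both ends and passes its maximum and its minimum, which takes a variation of twice the
  oscillation. Every approximation in this count costs a factor \<open>1 + e\<close>: for
  \<open>a < 1\<close> a small \<open>e\<close> absorbs them all, for \<open>a = 1\<close> no room
  is left and the argument has to change. Two gaps between hypotheses and this picture shape the
  rest. A \<open>C1_solution\<close> has first derivatives only, so the equation for the slope of
  \<open>f\<close> along a characteristic cannot come from differentiating the system; it is a
  uniform limit over difference quotients. And an infinite lifespan gives solutions on arbitrarily
  long intervals, not one global solution; uniqueness glues them together. The positivity of
  \<open>q0\<close> enters at the end: trivial Riemann invariants force
  \<open>\<rho>\<^sub>0 = 0\<close>, hence \<open>q0 = 0\<close>.\<close>

section \<open>Maximum principle for transport equations\<close>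

text \<open>The total derivative at an interior point: partial derivatives alone would not give the
  chain rule along characteristics.\<close>

definition has_partials :: "(real \<Rightarrow> real \<Rightarrow> real) \<Rightarrow> real \<Rightarrow> real \<Rightarrow> real \<Rightarrow> real \<Rightarrow> bool" where
  "has_partials f p q t x \<longleftrightarrow>
     ((\<lambda>(t, x). f t x) has_derivative (\<lambda>(h, k). h * p + k * q)) (at (t, x))"

lemma has_partials_curve:
  assumes "has_partials f p q (S t) (X t)"
    and "(S has_real_derivative w) (at t within A)" and "(X has_real_derivative v) (at t within A)"
  shows "((\<lambda>s. f (S s) (X s)) has_real_derivative w * p + v * q) (at t within A)"
proof -
  have "((\<lambda>s. (S s, X s)) has_derivative (\<lambda>h. (h * w, h * v))) (at t within A)"
    using assms(2,3) by (intro has_derivative_Pair)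
      (simp_all add: has_field_derivative_def mult_commute_abs)
  from has_derivative_compose[OF this, of "\<lambda>(t, x). f t x" "\<lambda>(h, k). h * p + k * q"]
  have "((\<lambda>s. f (S s) (X s)) has_derivative (\<lambda>h. h * w * p + h * v * q)) (at t within A)"
    using assms(1) by (simp add: has_partials_def)
  moreover have "(\<lambda>h. h * w * p + h * v * q) = (*) (w * p + v * q)"
    by (auto simp: algebra_simps)
  ultimately show ?thesis
    by (simp add: has_field_derivative_def)
qed

lemma has_partials_dx: "has_partials f p q t x \<Longrightarrow> ((\<lambda>y. f t y) has_real_derivative q) (at x)"
  using has_partials_curve[of f p q "\<lambda>_. t" x "\<lambda>y. y" 0 UNIV 1] by simp

lemma has_partials_dt: "has_partials f p q t x \<Longrightarrow> ((\<lambda>s. f s x) has_real_derivative p) (at t)"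
  using has_partials_curve[of f p q "\<lambda>s. s" t "\<lambda>_. x" 1 UNIV 0] by simp

lemma has_partials_transform:
  assumes "has_partials f p q t x" and "open U" "(t, x) \<in> U"
    and "\<And>s y. (s, y) \<in> U \<Longrightarrow> f s y = g s y"
  shows "has_partials g p q t x"
  unfolding has_partials_def
  by (rule has_derivative_transform_within_open[OF assms(1)[unfolded has_partials_def] assms(2,3)])
     (use assms(4) in auto)

lemma has_partials_chain2:
  assumes "has_partials f p q t x" "has_partials g p' q' t x"
    and "(F has_derivative (\<lambda>(h, k). h * A + k * B)) (at (f t x, g t x))"
  shows "has_partials (\<lambda>t x. F (f t x, g t x)) (p * A + p' * B) (q * A + q' * B) t x"
proof -
  have "((\<lambda>z. ((\<lambda>(t, x). f t x) z, (\<lambda>(t, x). g t x) z)) has_derivative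
      (\<lambda>z. ((\<lambda>(h, k). h * p + k * q) z, (\<lambda>(h, k). h * p' + k * q') z))) (at (t, x))"
    using assms(1,2) unfolding has_partials_def by (rule has_derivative_Pair)
  from has_derivative_compose[OF this, of F "\<lambda>(h, k). h * A + k * B"] assms(3)
  show ?thesis
    unfolding has_partials_def by (simp add: case_prod_unfold algebra_simps)
qed

text \<open>The two instances that matter are the reflection in space (\<open>\<beta> = - 1\<close>,
  \<open>k = - 1\<close>) and the reversal of time (\<open>\<alpha> = - 1\<close>).\<close>

lemma has_partials_affine:
  assumes "has_partials f p q (b + \<alpha> * t) (c + \<beta> * x)"
  shows "has_partials (\<lambda>t x. k * f (b + \<alpha> * t) (c + \<beta> * x)) (k * \<alpha> * p) (k * \<beta> * q) t x"
proof -
  have "((\<lambda>z. (b + \<alpha> * fst z, c + \<beta> * snd z)) has_derivative (\<lambda>z. (\<alpha> * fst z, \<beta> * snd z))) (at (t, x))"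
    by (auto intro!: derivative_eq_intros simp: algebra_simps)
  from has_derivative_compose[OF this, of "\<lambda>(t, x). f t x" "\<lambda>(h, k). h * p + k * q"] assms
  have "((\<lambda>z. f (b + \<alpha> * fst z) (c + \<beta> * snd z)) has_derivative
     (\<lambda>z. \<alpha> * fst z * p + \<beta> * snd z * q)) (at (t, x))"
    by (simp add: has_partials_def)
  then have "((\<lambda>z. k * f (b + \<alpha> * fst z) (c + \<beta> * snd z)) has_derivative
     (\<lambda>z. k * (\<alpha> * fst z * p + \<beta> * snd z * q))) (at (t, x))"
    by (rule has_derivative_mult_right)
  then show ?thesis
    by (simp add: has_partials_def case_prod_unfold algebra_simps)
qed

lemma has_partials_diff:
  assumes "has_partials f p q t x" "has_partials g p' q' t x"
  shows "has_partials (\<lambda>t x. f t x - g t x) (p - p') (q - q') t x"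
  using has_derivative_diff[OF assms[unfolded has_partials_def]]
  by (simp add: has_partials_def case_prod_unfold algebra_simps)

text \<open>Total differentiability follows once one of the two partial derivatives is continuous;
  here it is the one in space, so for the time derivative existence at the point is enough.\<close>

lemma has_partialsI:
  assumes ft: "((\<lambda>s. f s x) has_real_derivative p) (at t)"
    and fx: "\<And>s y. s \<in> {0<..<T} \<Longrightarrow> ((\<lambda>y. f s y) has_real_derivative q s y) (at y)"
    and cont: "continuous_on ({0<..<T} \<times> UNIV) (\<lambda>(s, y). q s y)" and t: "t \<in> {0<..<T}"
  shows "has_partials f p (q t x) t x"
proof -
  have at: "at (t, x) within {0<..<T} \<times> UNIV = at (t, x)"
    using t by (intro at_within_open open_Times) auto
  have "continuous_on ({0<..<T} \<times> UNIV) (\<lambda>z. blinfun_mult_right (case z of (s, y) \<Rightarrow> q s y))"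
    by (intro continuous_intros cont)
  then have "continuous (at (t, x) within {0<..<T} \<times> UNIV)
      (\<lambda>(s, y). blinfun_mult_right (q s y))"
    using t by (auto simp: continuous_on_eq_continuous_within case_prod_unfold)
  then have "((\<lambda>(s, y). f s y) has_derivative (\<lambda>(h, k). p * h + blinfun_apply (blinfun_mult_right (q t x)) k))
      (at (t, x) within {0<..<T} \<times> UNIV)"
    using ft fx t
    by (intro has_derivative_partialsI)
       (simp_all add: has_field_derivative_def has_derivative_at_withinI)
  then have "((\<lambda>(s, y). f s y) has_derivative (\<lambda>(h, k). p * h + q t x * k)) (at (t, x))"
    by (simp add: at)
  then show ?thesis
    by (simp add: has_partials_def mult.commute case_prod_unfold)
qed

text \<open>Along some direction of speed at most \<open>\<sigma>\<close> the function
  \<open>\<phi>\<close> grows at rate at most \<open>K\<close>. This is demanded only where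
  \<open>\<phi>\<close> dominates \<open>\<psi>\<close>, because there a coupling term with
  \<open>\<psi>\<close> can be absorbed into \<open>\<phi>\<close>, and because a maximum of the
  larger of the two is always such a point.\<close>

definition damped_transport ::
  "real \<Rightarrow> real \<Rightarrow> (real \<Rightarrow> real \<Rightarrow> real) \<Rightarrow> (real \<Rightarrow> real \<Rightarrow> real) \<Rightarrow> real \<Rightarrow> real \<Rightarrow> bool" where
  "damped_transport \<sigma> K \<phi> \<psi> t x \<longleftrightarrow>
     (\<exists>v d. \<bar>v\<bar> \<le> \<sigma> \<and> ((\<lambda>s. \<phi> (t + s) (x + v * s)) has_real_derivative d) (at 0) \<and>
        (\<bar>\<psi> t x\<bar> \<le> \<bar>\<phi> t x\<bar> \<longrightarrow> \<phi> t x * d \<le> K * (\<phi> t x)\<^sup>2))"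

lemma damped_transportI:
  assumes "has_partials \<phi> p q t x" "\<bar>v\<bar> \<le> \<sigma>"
    and "\<bar>\<psi> t x\<bar> \<le> \<bar>\<phi> t x\<bar> \<Longrightarrow> \<phi> t x * (p + v * q) \<le> K * (\<phi> t x)\<^sup>2"
  shows "damped_transport \<sigma> K \<phi> \<psi> t x"
proof -
  have "((\<lambda>s. \<phi> (t + s) (x + v * s)) has_real_derivative 1 * p + v * q) (at 0)"
    by (rule has_partials_curve) (use assms(1) in \<open>auto intro!: derivative_eq_intros\<close>)
  then show ?thesis
    unfolding damped_transport_def using assms(2,3) by (intro exI[of _ v] exI[of _ "p + v * q"]) auto
qed

section \<open>Comparison on backward cones\<close>

definition backward_cone :: "real \<Rightarrow> real \<Rightarrow> real \<Rightarrow> real \<Rightarrow> (real \<times> real) set" where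
  "backward_cone \<sigma> t0 t1 x1 = {(t, x). t0 \<le> t \<and> t \<le> t1 \<and> \<bar>x - x1\<bar> \<le> \<sigma> * (t1 - t)}"

lemma compact_backward_cone: 
  assumes "\<sigma> \<ge> 0" shows "compact (backward_cone \<sigma> t0 t1 x1)"
proof -
  have "backward_cone \<sigma> t0 t1 x1 \<subseteq> {t0..t1} \<times> {x1 - \<sigma> * (t1 - t0) .. x1 + \<sigma> * (t1 - t0)}"
  proof (clarsimp simp: backward_cone_def)
    fix t x assume "t0 \<le> t" "t \<le> t1" and *: "\<bar>x - x1\<bar> \<le> \<sigma> * (t1 - t)"
    have "\<sigma> * (t1 - t) \<le> \<sigma> * (t1 - t0)"
      using assms \<open>t0 \<le> t\<close> by (intro mult_left_mono) auto
    with * show "x1 - \<sigma> * (t1 - t0) \<le> x \<and> x \<le> x1 + \<sigma> * (t1 - t0)" by linarith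
  qed
  then have "bounded (backward_cone \<sigma> t0 t1 x1)"
    by (rule bounded_subset[rotated]) (intro bounded_Times bounded_closed_interval)
  moreover have "closed {z. t0 \<le> fst z \<and> fst z \<le> t1 \<and> \<bar>snd z - x1\<bar> \<le> \<sigma> * (t1 - fst z)}"
    by (intro closed_Collect_conj closed_Collect_le continuous_intros)
  then have "closed (backward_cone \<sigma> t0 t1 x1)"
    by (simp add: backward_cone_def case_prod_unfold)
  ultimately show ?thesis by (simp add: compact_eq_bounded_closed)
qed

text \<open>Along the transport direction the weighted square has a strictly negative derivative,
  thanks to \<open>\<kappa>\<close>. A small step back in time therefore finds a larger value, and
  \<open>\<bar>v\<bar> \<le> \<sigma>\<close> keeps the step inside the cone.\<close>

lemma cone_max_contradiction:
  assumes dt: "damped_transport \<sigma> K \<phi> \<psi> t x" and "\<bar>\<psi> t x\<bar> \<le> \<bar>\<phi> t x\<bar>" "\<phi> t x \<noteq> 0" "\<kappa> > 0"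
    and P: "(t, x) \<in> backward_cone \<sigma> t0 t1 x1" "t0 < t"
    and max: "\<And>s y. (s, y) \<in> backward_cone \<sigma> t0 t1 x1 \<Longrightarrow>
       exp (- 2 * (K + \<kappa>) * s) * (\<phi> s y)\<^sup>2 \<le> exp (- 2 * (K + \<kappa>) * t) * (\<phi> t x)\<^sup>2"
  shows False
proof -
  obtain v d where v: "\<bar>v\<bar> \<le> \<sigma>" and d: "((\<lambda>s. \<phi> (t + s) (x + v * s)) has_real_derivative d) (at 0)"
    and le: "\<phi> t x * d \<le> K * (\<phi> t x)\<^sup>2"
    using dt assms(2) unfolding damped_transport_def by blast
  define G where "G s = exp (- 2 * (K + \<kappa>) * (t + s)) * (\<phi> (t + s) (x + v * s))\<^sup>2" for s
  define e where "e = exp (- 2 * (K + \<kappa>) * t)"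
  have "(G has_real_derivative e * (- 2 * (K + \<kappa>) * (\<phi> t x)\<^sup>2 + 2 * \<phi> t x * d)) (at 0)"
  proof -
    have "((\<lambda>s. exp (- 2 * (K + \<kappa>) * (t + s))) has_real_derivative - 2 * (K + \<kappa>) * e) (at 0)"
      unfolding e_def by (auto intro!: derivative_eq_intros)
    from DERIV_mult[OF this DERIV_power[OF d, of 2]]
    have "((\<lambda>s. G s) has_real_derivative
        - 2 * (K + \<kappa>) * e * (\<phi> t x)\<^sup>2 + 2 * (d * \<phi> t x) * e) (at 0)"
      by (simp add: G_def e_def)
    then show ?thesis
      by (simp add: algebra_simps)
  qed
  moreover have "- 2 * (K + \<kappa>) * (\<phi> t x)\<^sup>2 + 2 * \<phi> t x * d \<le> - 2 * \<kappa> * (\<phi> t x)\<^sup>2"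
    using le by (simp add: algebra_simps)
  moreover have "- 2 * \<kappa> * (\<phi> t x)\<^sup>2 < 0"
    using assms(3,4) by simp
  ultimately have "e * (- 2 * (K + \<kappa>) * (\<phi> t x)\<^sup>2 + 2 * \<phi> t x * d) < 0"
      "(G has_real_derivative e * (- 2 * (K + \<kappa>) * (\<phi> t x)\<^sup>2 + 2 * \<phi> t x * d)) (at 0)"
    by (auto intro!: mult_pos_neg simp: e_def)
  then obtain \<eta> where \<eta>: "\<eta> > 0" "\<And>h. 0 < h \<Longrightarrow> h < \<eta> \<Longrightarrow> G 0 < G (0 - h)"
    using DERIV_neg_dec_left by blast
  define h where "h = min (\<eta> / 2) (t - t0)"
  have h: "0 < h" "h < \<eta>" "h \<le> t - t0"
    using \<eta>(1) P(2) by (auto simp: h_def)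
  have "\<bar>v * h\<bar> \<le> \<sigma> * h"
    using v h(1) by (simp add: abs_mult mult_right_mono)
  moreover have "\<bar>x - x1\<bar> \<le> \<sigma> * (t1 - t)" using P(1) by (simp add: backward_cone_def)
  moreover have "\<sigma> * (t1 - (t - h)) = \<sigma> * (t1 - t) + \<sigma> * h" by (simp add: algebra_simps)
  ultimately have "\<bar>x - v * h - x1\<bar> \<le> \<sigma> * (t1 - (t - h))" by linarith
  then have "(t - h, x - v * h) \<in> backward_cone \<sigma> t0 t1 x1"
    using P(1) h by (auto simp: backward_cone_def)
  from max[OF this] \<eta>(2)[OF h(1,2)] show False
    by (simp add: G_def)
qed

text \<open>The larger of the two weighted squares attains its maximum on the compact cone, and
  \<open>cone_max_contradiction\<close> leaves only the base \<open>t = t0\<close> for it. The extra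
  rate \<open>\<kappa>\<close> that makes the decrease strict is sent to 0 at the end.\<close>

theorem cone_maximum_principle:
  assumes t: "t0 \<le> t1" and \<sigma>: "\<sigma> \<ge> 0"
    and cont: "continuous_on (backward_cone \<sigma> t0 t1 x1) (\<lambda>(t, x). \<phi> t x)"
              "continuous_on (backward_cone \<sigma> t0 t1 x1) (\<lambda>(t, x). \<psi> t x)"
    and dt: "\<And>t x. (t, x) \<in> backward_cone \<sigma> t0 t1 x1 \<Longrightarrow> t0 < t \<Longrightarrow> damped_transport \<sigma> K \<phi> \<psi> t x"
            "\<And>t x. (t, x) \<in> backward_cone \<sigma> t0 t1 x1 \<Longrightarrow> t0 < t \<Longrightarrow> damped_transport \<sigma> K \<psi> \<phi> t x"
    and init: "\<And>x. \<bar>x - x1\<bar> \<le> \<sigma> * (t1 - t0) \<Longrightarrow> \<bar>\<phi> t0 x\<bar> \<le> N \<and> \<bar>\<psi> t0 x\<bar> \<le> N"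
  shows "\<bar>\<phi> t1 x1\<bar> \<le> exp (K * (t1 - t0)) * N \<and> \<bar>\<psi> t1 x1\<bar> \<le> exp (K * (t1 - t0)) * N"
proof -
  define m where "m t x = max \<bar>\<phi> t x\<bar> \<bar>\<psi> t x\<bar>" for t x
  have N0: "N \<ge> 0" using init[of x1] t \<sigma> by (smt (verit) mult_nonneg_nonneg)
  have "m t1 x1 \<le> exp ((K + \<kappa>) * (t1 - t0)) * N" if "\<kappa> > 0" for \<kappa>
  proof (rule ccontr)
    assume contra: "\<not> ?thesis"
    define M where "M z = exp (- 2 * (K + \<kappa>) * fst z) * (m (fst z) (snd z))\<^sup>2" for z
    have "continuous_on (backward_cone \<sigma> t0 t1 x1) M"
      unfolding M_def m_def using cont by (intro continuous_intros) (auto simp: case_prod_unfold)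
    moreover have apex: "(t1, x1) \<in> backward_cone \<sigma> t0 t1 x1" using t by (auto simp: backward_cone_def)
    ultimately obtain p where p: "p \<in> backward_cone \<sigma> t0 t1 x1" "\<And>z. z \<in> backward_cone \<sigma> t0 t1 x1 \<Longrightarrow> M z \<le> M p"
      using continuous_attains_sup[OF compact_backward_cone[OF \<sigma>]] by (metis empty_iff)
    obtain t x where px: "p = (t, x)" by (cases p)
    have Mdom: "exp (- 2 * (K + \<kappa>) * s) * (\<phi> s y)\<^sup>2 \<le> M (s, y)"
               "exp (- 2 * (K + \<kappa>) * s) * (\<psi> s y)\<^sup>2 \<le> M (s, y)" for s y
      by (auto simp: M_def m_def abs_le_square_iff[symmetric])
    have "exp ((K + \<kappa>) * (t1 - t0)) * N < m t1 x1" using contra by simp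
    then have "(exp ((K + \<kappa>) * (t1 - t0)) * N)\<^sup>2 < (m t1 x1)\<^sup>2"
      using N0 by (intro power_strict_mono) auto
    then have "exp (- 2 * (K + \<kappa>) * t1) * (exp ((K + \<kappa>) * (t1 - t0)) * N)\<^sup>2 < M (t1, x1)"
      by (simp add: M_def)
    moreover have "exp (- 2 * (K + \<kappa>) * t1) * (exp ((K + \<kappa>) * (t1 - t0)) * N)\<^sup>2
        = exp (- 2 * (K + \<kappa>) * t0) * N\<^sup>2"
      by (simp add: power_mult_distrib exp_of_nat_mult[symmetric] mult_exp_exp mult.assoc[symmetric])
         (simp add: algebra_simps)
    ultimately have big: "exp (- 2 * (K + \<kappa>) * t0) * N\<^sup>2 < M (t, x)"
      using p(2)[OF apex] px by simp
    have t0t: "t0 < t"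
    proof (rule ccontr)
      assume "\<not> t0 < t"
      then have "t = t0" using p(1) px by (auto simp: backward_cone_def)
      then have "m t x \<le> N" using init[of x] p(1) px by (auto simp: backward_cone_def m_def)
      then have "(m t x)\<^sup>2 \<le> N\<^sup>2" by (intro power_mono) (auto simp: m_def)
      with big \<open>t = t0\<close> show False by (simp add: M_def)
    qed
    have "M (t, x) > 0" using big by (smt (verit) exp_ge_zero mult_nonneg_nonneg zero_le_power2)
    then have mpos: "m t x \<noteq> 0" by (auto simp: M_def)
    show False
    proof (cases "\<bar>\<psi> t x\<bar> \<le> \<bar>\<phi> t x\<bar>")
      case True
      then have "M (t, x) = exp (- 2 * (K + \<kappa>) * t) * (\<phi> t x)\<^sup>2"
        by (simp add: M_def m_def max_def)
      then show False
        using cone_max_contradiction[OF dt(1)[of t x] True _ that, of t0 t1 x1] p px t0t mpos True Mdom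
        by (metis (no_types, opaque_lifting) abs_le_zero_iff abs_zero m_def max.absorb1 order_trans)
    next
      case False
      then have "M (t, x) = exp (- 2 * (K + \<kappa>) * t) * (\<psi> t x)\<^sup>2"
        by (simp add: M_def m_def max_def)
      then show False
        using cone_max_contradiction[OF dt(2)[of t x] _ _ that, of t0 t1 x1] p px t0t mpos False Mdom
        by (metis (no_types, opaque_lifting) abs_le_zero_iff abs_zero m_def max.absorb2 nle_le order_trans)
    qed
  qed
  then have "\<forall>\<^sub>F \<kappa> in at_right 0. m t1 x1 \<le> exp ((K + \<kappa>) * (t1 - t0)) * N"
    by (auto simp: eventually_at_right_less eventually_at_filter)
  moreover have "((\<lambda>\<kappa>. exp ((K + \<kappa>) * (t1 - t0)) * N) \<longlongrightarrow> exp ((K + 0) * (t1 - t0)) * N) (at_right 0)"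
    by (intro tendsto_intros)
  ultimately have "m t1 x1 \<le> exp ((K + 0) * (t1 - t0)) * N"
    by (intro tendsto_lowerbound[of "\<lambda>\<kappa>. exp ((K + \<kappa>) * (t1 - t0)) * N" _ "at_right 0"]) auto
  then show ?thesis by (simp add: m_def)
qed

section \<open>The system for the Riemann invariants\<close>

text \<open>With \<open>c = \<rho> powr \<theta>\<close>, \<open>\<theta> = (\<gamma> - 1) / 2\<close> and \<open>r = (c - 1) / \<theta>\<close>, the Riemann invariants are
  \<open>f = u + r\<close> and \<open>g = u - r\<close>. Then \<open>c = 1 + \<theta> * (f - g) / 2\<close>, and the two characteristic speeds
  \<open>u + c\<close> and \<open>u - c\<close> are \<open>speed \<theta> f g\<close> and \<open>- speed \<theta> (- g) (- f)\<close>. The reflection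
  \<open>x \<mapsto> - x\<close> replaces \<open>(f, g)\<close> by \<open>(- g, - f)\<close>.\<close>

definition speed :: "real \<Rightarrow> real \<Rightarrow> real \<Rightarrow> real" where
  "speed \<theta> p q = 1 + (p + q) / 2 + \<theta> * (p - q) / 2"

text \<open>The equations are solved for the time derivatives and placed inside
  \<open>has_partials\<close>, so they carry total differentiability with them. They are imposed at
  positive times; the data at \<open>t = 0\<close> are linked to them by continuity.\<close>

definition riemann_system ::
  "real \<Rightarrow> real \<Rightarrow> real \<Rightarrow> (real \<Rightarrow> real \<Rightarrow> real) \<Rightarrow> (real \<Rightarrow> real \<Rightarrow> real) \<Rightarrow> bool" where
  "riemann_system \<theta> a T f g \<longleftrightarrow>
     continuous_on ({0..<T} \<times> UNIV) (\<lambda>(t, x). f t x) \<and>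
     continuous_on ({0..<T} \<times> UNIV) (\<lambda>(t, x). g t x) \<and>
     continuous_on ({0..<T} \<times> UNIV) (\<lambda>(t, x). deriv (f t) x) \<and>
     continuous_on ({0..<T} \<times> UNIV) (\<lambda>(t, x). deriv (g t) x) \<and>
     (\<forall>t x. 0 < t \<and> t < T \<longrightarrow>
        has_partials f (- (a / (1 + t)) * (f t x + g t x) - speed \<theta> (f t x) (g t x) * deriv (f t) x)
          (deriv (f t) x) t x \<and>
        has_partials g (- (a / (1 + t)) * (f t x + g t x) + speed \<theta> (- g t x) (- f t x) * deriv (g t) x)
          (deriv (g t) x) t x)"

lemma riemann_systemD:
  assumes "riemann_system \<theta> a T f g"
  shows "continuous_on ({0..<T} \<times> UNIV) (\<lambda>(t, x). f t x)"
    and "continuous_on ({0..<T} \<times> UNIV) (\<lambda>(t, x). g t x)"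
    and "continuous_on ({0..<T} \<times> UNIV) (\<lambda>(t, x). deriv (f t) x)"
    and "continuous_on ({0..<T} \<times> UNIV) (\<lambda>(t, x). deriv (g t) x)"
    and "0 < t \<Longrightarrow> t < T \<Longrightarrow> has_partials f
      (- (a / (1 + t)) * (f t x + g t x) - speed \<theta> (f t x) (g t x) * deriv (f t) x) (deriv (f t) x) t x"
    and "0 < t \<Longrightarrow> t < T \<Longrightarrow> has_partials g
      (- (a / (1 + t)) * (f t x + g t x) + speed \<theta> (- g t x) (- f t x) * deriv (g t) x) (deriv (g t) x) t x"
  using assms unfolding riemann_system_def by auto

text \<open>No differentiability is assumed: both sides choose from the same set of derivatives, so
  they agree even where that set is empty.\<close>

lemma deriv_reflect: 
  fixes h :: "real \<Rightarrow> real"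
  shows "deriv (\<lambda>x. - h (- x)) x = deriv h (- x)"
proof -
  have "((\<lambda>x. - h (- x)) has_real_derivative D) (at x) \<longleftrightarrow> (h has_real_derivative D) (at (- x))" for D
    using DERIV_mirror[where f = h and x = x and y = D] DERIV_minus[of "\<lambda>x. h (- x)" "- D" x UNIV]
      DERIV_minus[of "\<lambda>x. - h (- x)" D x UNIV] by auto
  then show ?thesis
    by (simp add: deriv_def)
qed

lemma riemann_system_reflect:
  assumes "riemann_system \<theta> a T f g"
  shows "riemann_system \<theta> a T (\<lambda>t x. - g t (- x)) (\<lambda>t x. - f t (- x))"
proof -
  have c: "continuous_on ({0..<T} \<times> UNIV) (\<lambda>(t, x). k t (- x))"
    if "continuous_on ({0..<T} \<times> UNIV) (\<lambda>(t, x). k t x)" for k :: "real \<Rightarrow> real \<Rightarrow> real"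
  proof -
    have "continuous_on ({0..<T} \<times> UNIV) (\<lambda>z::real \<times> real. (fst z, - snd z))"
      by (intro continuous_intros)
    then show ?thesis
      using continuous_on_compose2[OF that, of "{0..<T} \<times> UNIV" "\<lambda>z. (fst z, - snd z)"]
      by (simp add: case_prod_unfold mem_Times_iff image_subset_iff)
  qed
  have p: "has_partials (\<lambda>t x. - k t (- x)) (- p) q t x" if "has_partials k p q t (- x)" for k p q t x
    using has_partials_affine[of k p q 0 1 t 0 "- 1" x "- 1"] that by simp
  note D = riemann_systemD[OF assms]
  show ?thesis
    unfolding riemann_system_def deriv_reflect
  proof (intro conjI allI impI)
    fix t x :: real assume t: "0 < t \<and> t < T"
    show "has_partials (\<lambda>t x. - g t (- x)) (- (a / (1 + t)) * (- g t (- x) + - f t (- x)) -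
         speed \<theta> (- g t (- x)) (- f t (- x)) * deriv (g t) (- x)) (deriv (g t) (- x)) t x"
      using p[OF D(6)[of t "- x"]] t by (simp add: algebra_simps)
    show "has_partials (\<lambda>t x. - f t (- x)) (- (a / (1 + t)) * (- g t (- x) + - f t (- x)) +
         speed \<theta> (- (- f t (- x))) (- (- g t (- x))) * deriv (f t) (- x)) (deriv (f t) (- x)) t x"
      using p[OF D(5)[of t "- x"]] t by (simp add: algebra_simps)
  qed (use c[OF D(3)] c[OF D(4)] continuous_on_minus[OF c[OF D(1)]] continuous_on_minus[OF c[OF D(2)]]
      in \<open>simp_all add: case_prod_unfold\<close>)
qed

lemma riemann_system_mono: "riemann_system \<theta> a T f g \<Longrightarrow> S \<le> T \<Longrightarrow> riemann_system \<theta> a S f g"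
  unfolding riemann_system_def by (auto elim!: continuous_on_subset)

lemma abs_speed_le:
  assumes "\<theta> > 0" "\<bar>p\<bar> \<le> b" "\<bar>q\<bar> \<le> b"
  shows "\<bar>speed \<theta> p q - 1\<bar> \<le> (1 + \<theta>) * b"
proof -
  have "\<bar>\<theta> * (p - q)\<bar> \<le> \<theta> * (2 * b)"
    unfolding abs_mult using assms by (intro mult_mono) auto
  then have "\<bar>\<theta> * (p - q) / 2\<bar> \<le> \<theta> * b" by simp
  moreover have "\<bar>(p + q) / 2\<bar> \<le> b" using assms(2,3) by (simp add: abs_le_iff)
  ultimately show ?thesis
    unfolding speed_def distrib_right mult_1 by linarith
qed

text \<open>The rate is \<open>K = 0\<close>: if \<open>\<bar>q\<bar> \<le> \<bar>p\<bar>\<close>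
  then \<open>p * (p + q) \<ge> 0\<close>, so the damping never increases the larger of the two
  invariants.\<close>

lemma riemann_system_damped_transport:
  assumes sys: "riemann_system \<theta> a T f g" and a: "0 \<le> a" and t: "0 < t" "t < T"
    and "\<bar>speed \<theta> (f t x) (g t x)\<bar> \<le> \<sigma>" "\<bar>speed \<theta> (- g t x) (- f t x)\<bar> \<le> \<sigma>"
  shows "damped_transport \<sigma> 0 f g t x" and "damped_transport \<sigma> 0 g f t x"
proof -
  have *: "p * (- (a / (1 + t)) * (p + q)) \<le> 0 * p\<^sup>2" if "\<bar>q\<bar> \<le> \<bar>p\<bar>" for p q
  proof -
    have "\<bar>p * q\<bar> \<le> \<bar>p\<bar> * \<bar>p\<bar>" unfolding abs_mult by (intro mult_left_mono that) auto
    then have "p * (p + q) \<ge> 0" by (simp add: algebra_simps)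
    then have "a / (1 + t) * (p * (p + q)) \<ge> 0" using a t by simp
    moreover have "p * (- (a / (1 + t)) * (p + q)) = - (a / (1 + t) * (p * (p + q)))" by simp
    ultimately show ?thesis by linarith
  qed
  show "damped_transport \<sigma> 0 f g t x"
    by (rule damped_transportI[OF riemann_systemD(5)[OF sys t] assms(5)]) (use *[of "g t x" "f t x"] in simp)
  show "damped_transport \<sigma> 0 g f t x"
    by (rule damped_transportI[OF riemann_systemD(6)[OF sys t], of "- speed \<theta> (- g t x) (- f t x)"])
       (use assms(6) *[of "f t x" "g t x"] in \<open>simp_all add: add.commute\<close>)
qed

section \<open>Finite speed of propagation\<close>

lemma backward_cone_subset:
  assumes "(t, x) \<in> backward_cone \<sigma> t0 t1 x1" "\<sigma> \<ge> 0"
  shows "backward_cone \<sigma> t0 t x \<subseteq> backward_cone \<sigma> t0 t1 x1"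
  using assms by (auto simp: backward_cone_def algebra_simps abs_le_iff)

lemma continuous_on_backward_cone:
  assumes "continuous_on ({0..<T} \<times> UNIV) h" "0 \<le> t0" "t1 < T"
  shows "continuous_on (backward_cone \<sigma> t0 t1 x1) h"
  using assms(1) by (rule continuous_on_subset) (use assms(2,3) in \<open>auto simp: backward_cone_def\<close>)

text \<open>At rest the speed is 1, so a cone of slope \<open>1 + \<delta>\<close> contains the
  characteristics as long as the solution is small on it, which is not known beforehand. A first
  point at which the size \<open>\<eta>\<close> is reached settles this: on its own backward cone
  the solution is still small enough for the maximum principle, which makes it zero there.\<close>

lemma riemann_system_local_zero:
  assumes sys: "riemann_system \<theta> a T f g" and par: "\<theta> > 0" "0 \<le> a" and t1: "0 \<le> t1" "t1 < T" and "\<delta> > 0"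
    and init: "\<And>x. \<bar>x - x1\<bar> \<le> (1 + \<delta>) * t1 \<Longrightarrow> f 0 x = 0 \<and> g 0 x = 0"
  shows "f t1 x1 = 0 \<and> g t1 x1 = 0"
proof -
  define C where "C = backward_cone (1 + \<delta>) 0 t1 x1"
  \<comment> \<open>The size up to which \<open>abs_speed_le\<close> keeps both speeds below
    \<open>1 + \<delta>\<close>.\<close>
  define \<eta> where "\<eta> = \<delta> / (1 + \<theta>)"
  define m where "m z = max \<bar>f (fst z) (snd z)\<bar> \<bar>g (fst z) (snd z)\<bar>" for z
  have \<eta>: "\<eta> > 0" "(1 + \<theta>) * \<eta> = \<delta>" using par \<open>\<delta> > 0\<close> by (auto simp: \<eta>_def)
  have cm: "continuous_on ({0..<T} \<times> UNIV) m"
    unfolding m_def using riemann_systemD(1,2)[OF sys]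
    by (intro continuous_intros) (auto simp: case_prod_unfold)
  have zero: "f t x = 0 \<and> g t x = 0"
    if P: "(t, x) \<in> C" and small: "\<And>z. z \<in> backward_cone (1 + \<delta>) 0 t x \<Longrightarrow> m z \<le> \<eta>" for t x
  proof -
    have t: "0 \<le> t" "t \<le> t1" using P by (auto simp: C_def backward_cone_def)
    have sp: "\<bar>speed \<theta> (f s y) (g s y)\<bar> \<le> 1 + \<delta>" "\<bar>speed \<theta> (- g s y) (- f s y)\<bar> \<le> 1 + \<delta>"
      if "(s, y) \<in> backward_cone (1 + \<delta>) 0 t x" for s y
      using abs_speed_le[of \<theta> "f s y" \<eta> "g s y"] abs_speed_le[of \<theta> "- g s y" \<eta> "- f s y"]
        small[OF that] par \<eta> by (auto simp: m_def)
    have "\<bar>f t x\<bar> \<le> exp (0 * (t - 0)) * 0 \<and> \<bar>g t x\<bar> \<le> exp (0 * (t - 0)) * 0"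
    proof (rule cone_maximum_principle[where \<sigma> = "1 + \<delta>" and \<phi> = f and \<psi> = g])
      fix s y assume s: "(s, y) \<in> backward_cone (1 + \<delta>) 0 t x" "0 < s"
      have "s < T" using s t t1 by (auto simp: backward_cone_def)
      note * = riemann_system_damped_transport[OF sys par(2) s(2) this sp[OF s(1)]]
      show "damped_transport (1 + \<delta>) 0 f g s y" by (rule *)
      show "damped_transport (1 + \<delta>) 0 g f s y" by (rule *)
    next
      fix y assume "\<bar>y - x\<bar> \<le> (1 + \<delta>) * (t - 0)"
      moreover have "\<bar>x - x1\<bar> \<le> (1 + \<delta>) * (t1 - t)"
        using P by (auto simp: C_def backward_cone_def)
      ultimately have "\<bar>y - x1\<bar> \<le> (1 + \<delta>) * (t - 0) + (1 + \<delta>) * (t1 - t)" by linarith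
      then show "\<bar>f 0 y\<bar> \<le> 0 \<and> \<bar>g 0 y\<bar> \<le> 0"
        using init[of y] by (simp add: algebra_simps)
    qed (use t t1 \<open>\<delta> > 0\<close> riemann_systemD(1,2)[OF sys] in \<open>auto intro: continuous_on_backward_cone\<close>)
    then show ?thesis by simp
  qed
  have apex: "(t1, x1) \<in> C" using t1 by (auto simp: C_def backward_cone_def)
  show ?thesis
  proof (cases "\<forall>z\<in>C. m z < \<eta>")
    case True
    then show ?thesis using zero[OF apex] by (auto simp: C_def less_imp_le)
  next
    case False
    have cmC: "continuous_on C m"
      unfolding C_def using cm t1 by (intro continuous_on_backward_cone) auto
    have "compact {z\<in>C. \<eta> \<le> m z}"
    proof -
      have "compact C" unfolding C_def using \<open>\<delta> > 0\<close> by (intro compact_backward_cone) auto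
      moreover from this have "closed {z\<in>C. \<eta> \<le> m z}"
        using continuous_closed_preimage[OF cmC, of "{\<eta>..}"] compact_imp_closed
        by (auto simp: vimage_def Int_def)
      ultimately show ?thesis
        by (metis (no_types, lifting) compact_Int_closed inf.absorb_iff2 mem_Collect_eq subsetI)
    qed
    moreover have "{z\<in>C. \<eta> \<le> m z} \<noteq> {}" using False by (auto simp: not_less)
    ultimately obtain p where p: "p \<in> C" "\<eta> \<le> m p"
      "\<And>z. z \<in> C \<Longrightarrow> \<eta> \<le> m z \<Longrightarrow> fst p \<le> fst z"
      using continuous_attains_inf[of "{z\<in>C. \<eta> \<le> m z}" fst, OF _ _ continuous_on_fst[OF continuous_on_id]]
      by blast
    obtain ts xs where px: "p = (ts, xs)" by (cases p)
    have sub: "backward_cone (1 + \<delta>) 0 ts xs \<subseteq> C"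
      unfolding C_def using p(1) px \<open>\<delta> > 0\<close> by (intro backward_cone_subset) (auto simp: C_def)
    have below: "m z < \<eta>" if "z \<in> C" "fst z < ts" for z
      using p(3)[OF that(1)] that(2) px by (auto simp: not_le[symmetric])
    have ts: "0 < ts" "ts \<le> t1"
    proof -
      have "ts \<noteq> 0"
        using init[of xs] p(1,2) px \<eta>(1) by (auto simp: C_def backward_cone_def m_def)
      then show "0 < ts" "ts \<le> t1" using p(1) px by (auto simp: C_def backward_cone_def)
    qed
    \<comment> \<open>Smallness is known strictly before \<open>ts\<close>; continuity along the
      vertical segment carries it to the apex.\<close>
    have "m (ts, xs) \<le> \<eta>"
    proof (rule continuous_le_on_closure[of "{0..<ts}" "\<lambda>s. m (s, xs)"])
      show "continuous_on (closure {0..<ts}) (\<lambda>s. m (s, xs))"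
        using ts t1 by (intro continuous_on_compose2[OF cm]) (auto intro!: continuous_intros)
      fix s assume s: "s \<in> {0..<ts}"
      then have "(s, xs) \<in> backward_cone (1 + \<delta>) 0 ts xs"
        using \<open>\<delta> > 0\<close> by (auto simp: backward_cone_def)
      then show "m (s, xs) \<le> \<eta>" using below[of "(s, xs)"] sub s by auto
    qed (use ts in auto)
    then have "m z \<le> \<eta>" if z: "z \<in> backward_cone (1 + \<delta>) 0 ts xs" for z
    proof (cases "fst z < ts")
      case True
      then show ?thesis using below[of z] subsetD[OF sub z] by simp
    next
      case False
      with z have "z = (ts, xs)" by (auto simp: backward_cone_def)
      with \<open>m (ts, xs) \<le> \<eta>\<close> show ?thesis by simp
    qed
    from zero[OF _ this] p(1,2) px \<eta>(1) show ?thesis by (auto simp: m_def)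
  qed
qed

lemma riemann_system_support:
  assumes sys: "riemann_system \<theta> a T f g" and par: "\<theta> > 0" "0 \<le> a" and t: "0 \<le> t" "t < T"
    and init: "\<And>x. \<bar>x\<bar> > R \<Longrightarrow> f 0 x = 0 \<and> g 0 x = 0" and x: "\<bar>x\<bar> > R + t"
  shows "f t x = 0 \<and> g t x = 0"
proof (rule riemann_system_local_zero[OF sys par t])
  \<comment> \<open>The distance by which \<open>x\<close> lies beyond the expected support. A cone
    with excess slope \<open>d / (t + 1)\<close> widens during time \<open>t\<close> by less than
    \<open>d\<close> beyond \<open>t\<close>, so its base avoids the initial support.\<close>
  define d where "d = \<bar>x\<bar> - R - t"
  have d: "d > 0" using x by (simp add: d_def)
  show "d / (t + 1) > 0" using d t by simp
  fix y assume "\<bar>y - x\<bar> \<le> (1 + d / (t + 1)) * t"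
  moreover have "(1 + d / (t + 1)) * t < t + d"
    using d t by (simp add: field_simps)
  ultimately show "f 0 y = 0 \<and> g 0 y = 0" by (intro init) (auto simp: d_def)
qed
lemma riemann_system_support_deriv:
  assumes sys: "riemann_system \<theta> a T f g" and par: "\<theta> > 0" "0 \<le> a" and t: "0 \<le> t" "t < T"
    and init: "\<And>x. \<bar>x\<bar> > R \<Longrightarrow> f 0 x = 0 \<and> g 0 x = 0" and x: "\<bar>x\<bar> > R + t"
  shows "deriv (f t) x = 0 \<and> deriv (g t) x = 0"
proof -
  have z: "deriv h x = 0" if "\<And>y. \<bar>y\<bar> > R + t \<Longrightarrow> h y = 0" for h :: "real \<Rightarrow> real"
  proof -
    have o: "open {y. \<bar>y\<bar> > R + t}" by (intro open_Collect_less continuous_intros)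
    have "((\<lambda>_. 0) has_real_derivative 0) (at x)" by simp
    then have "(h has_real_derivative 0) (at x)"
      by (rule has_field_derivative_transform_within_open[OF _ o]) (use x that in auto)
    then show ?thesis by (rule DERIV_imp_deriv)
  qed
  show ?thesis
    using z[of "f t"] z[of "g t"] riemann_system_support[OF sys par t init] x by simp
qed

section \<open>Bounds on finite time intervals; uniqueness in both time directions\<close>

lemma riemann_system_bounded:
  assumes sys: "riemann_system \<theta> a T f g" and par: "\<theta> > 0" "0 \<le> a" and t1: "0 \<le> t1" "t1 < T"
    and init: "\<And>x. \<bar>x\<bar> > R \<Longrightarrow> f 0 x = 0 \<and> g 0 x = 0"
  obtains B where "B \<ge> 0" "\<And>t x. 0 \<le> t \<Longrightarrow> t \<le> t1 \<Longrightarrow>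
    \<bar>f t x\<bar> \<le> B \<and> \<bar>g t x\<bar> \<le> B \<and> \<bar>deriv (f t) x\<bar> \<le> B \<and> \<bar>deriv (g t) x\<bar> \<le> B"
proof -
  define Q where "Q = {0..t1} \<times> {- (R + t1) .. R + t1}"
  have "compact Q" by (auto simp: Q_def intro: compact_Times)
  have bd: "\<exists>B. \<forall>t x. 0 \<le> t \<and> t \<le> t1 \<longrightarrow> \<bar>h t x\<bar> \<le> B"
    if c: "continuous_on ({0..<T} \<times> UNIV) (\<lambda>(t, x). h t x)"
      and out: "\<And>t x. 0 \<le> t \<Longrightarrow> t \<le> t1 \<Longrightarrow> \<bar>x\<bar> > R + t \<Longrightarrow> h t x = 0" for h :: "real \<Rightarrow> real \<Rightarrow> real"
  proof -
    have "continuous_on Q (\<lambda>(t, x). h t x)"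
      using c by (rule continuous_on_subset) (use t1 in \<open>auto simp: Q_def\<close>)
    from compact_imp_bounded[OF compact_continuous_image[OF this \<open>compact Q\<close>]]
    obtain B where B: "\<And>z. z \<in> Q \<Longrightarrow> \<bar>case z of (t, x) \<Rightarrow> h t x\<bar> \<le> B"
      unfolding bounded_iff by (auto simp: Ball_def)
    have "\<bar>h t x\<bar> \<le> max B 0" if "0 \<le> t" "t \<le> t1" for t x
    proof (cases "\<bar>x\<bar> > R + t")
      case True
      with out that show ?thesis by simp
    next
      case False
      then have "(t, x) \<in> Q" using that by (auto simp: Q_def)
      from B[OF this] show ?thesis by simp
    qed
    then show ?thesis by blast
  qed
  have tT: "t < T" if "t \<le> t1" for t using that t1 by simp
  note sup = riemann_system_support[OF sys par _ _ init] riemann_system_support_deriv[OF sys par _ _ init]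
  have "\<exists>B. \<forall>t x. 0 \<le> t \<and> t \<le> t1 \<longrightarrow> \<bar>f t x\<bar> \<le> B"
       "\<exists>B. \<forall>t x. 0 \<le> t \<and> t \<le> t1 \<longrightarrow> \<bar>g t x\<bar> \<le> B"
       "\<exists>B. \<forall>t x. 0 \<le> t \<and> t \<le> t1 \<longrightarrow> \<bar>deriv (f t) x\<bar> \<le> B"
       "\<exists>B. \<forall>t x. 0 \<le> t \<and> t \<le> t1 \<longrightarrow> \<bar>deriv (g t) x\<bar> \<le> B"
    using sup tT by (intro bd riemann_systemD[OF sys]; blast)+
  then obtain B1 B2 B3 B4 where
    "\<forall>t x. 0 \<le> t \<and> t \<le> t1 \<longrightarrow> \<bar>f t x\<bar> \<le> B1" "\<forall>t x. 0 \<le> t \<and> t \<le> t1 \<longrightarrow> \<bar>g t x\<bar> \<le> B2"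
    "\<forall>t x. 0 \<le> t \<and> t \<le> t1 \<longrightarrow> \<bar>deriv (f t) x\<bar> \<le> B3" "\<forall>t x. 0 \<le> t \<and> t \<le> t1 \<longrightarrow> \<bar>deriv (g t) x\<bar> \<le> B4"
    by blast
  then show ?thesis
    by (intro that[of "max 0 (max (max B1 B2) (max B3 B4))"]) (auto simp: le_max_iff_disj)
qed

lemma riemann_system_speed_bounded:
  assumes sys: "riemann_system \<theta> a T f g" and par: "\<theta> > 0" "0 \<le> a" and t1: "0 \<le> t1" "t1 < T"
    and init: "\<And>x. \<bar>x\<bar> > R \<Longrightarrow> f 0 x = 0 \<and> g 0 x = 0"
  obtains \<sigma> where "\<sigma> \<ge> 0" "\<And>t x. 0 \<le> t \<Longrightarrow> t \<le> t1 \<Longrightarrow>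
    \<bar>speed \<theta> (f t x) (g t x)\<bar> \<le> \<sigma> \<and> \<bar>speed \<theta> (- g t x) (- f t x)\<bar> \<le> \<sigma>"
proof -
  obtain B where B: "B \<ge> 0" "\<And>t x. 0 \<le> t \<Longrightarrow> t \<le> t1 \<Longrightarrow> \<bar>f t x\<bar> \<le> B \<and> \<bar>g t x\<bar> \<le> B"
    using riemann_system_bounded[OF sys par t1 init] by metis
  show ?thesis
  proof (rule that[of "1 + (1 + \<theta>) * B"])
    fix t x :: real assume "0 \<le> t" "t \<le> t1"
    from B(2)[OF this, of x] show "\<bar>speed \<theta> (f t x) (g t x)\<bar> \<le> 1 + (1 + \<theta>) * B \<and>
        \<bar>speed \<theta> (- g t x) (- f t x)\<bar> \<le> 1 + (1 + \<theta>) * B"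
      using abs_speed_le[of \<theta> "f t x" B "g t x"] abs_speed_le[of \<theta> "- g t x" B "- f t x"] par by auto
  qed (use B par in auto)
qed

text \<open>The speed bound \<open>\<sigma>\<close> may depend on \<open>t1\<close>, but with rate
  \<open>K = 0\<close> it does not enter the estimate. This is how smallness of the data lasts for
  all time.\<close>

lemma riemann_system_sup_bound:
  assumes sys: "riemann_system \<theta> a T f g" and par: "\<theta> > 0" "0 \<le> a" and t1: "0 \<le> t0" "t0 \<le> t1" "t1 < T"
    and init: "\<And>x. \<bar>x\<bar> > R \<Longrightarrow> f 0 x = 0 \<and> g 0 x = 0"
    and N: "\<And>x. \<bar>f t0 x\<bar> \<le> N \<and> \<bar>g t0 x\<bar> \<le> N"
  shows "\<bar>f t1 x\<bar> \<le> N \<and> \<bar>g t1 x\<bar> \<le> N"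
proof -
  have "0 \<le> t1" using t1 by simp
  from riemann_system_speed_bounded[OF sys par this t1(3) init]
  obtain \<sigma> where \<sigma>: "\<sigma> \<ge> 0" "\<And>t x. 0 \<le> t \<Longrightarrow> t \<le> t1 \<Longrightarrow>
    \<bar>speed \<theta> (f t x) (g t x)\<bar> \<le> \<sigma> \<and> \<bar>speed \<theta> (- g t x) (- f t x)\<bar> \<le> \<sigma>" by metis
  have "\<bar>f t1 x\<bar> \<le> exp (0 * (t1 - t0)) * N \<and> \<bar>g t1 x\<bar> \<le> exp (0 * (t1 - t0)) * N"
  proof (rule cone_maximum_principle[where \<sigma> = \<sigma> and \<phi> = f and \<psi> = g])
    fix s y assume s: "(s, y) \<in> backward_cone \<sigma> t0 t1 x" "t0 < s"
    then have s': "0 < s" "s < T" "0 \<le> s" "s \<le> t1" using t1 by (auto simp: backward_cone_def)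
    note * = riemann_system_damped_transport[OF sys par(2) s'(1,2), of y \<sigma>]
    show "damped_transport \<sigma> 0 f g s y" by (rule *) (use \<sigma>(2)[OF s'(3,4)] in auto)
    show "damped_transport \<sigma> 0 g f s y" by (rule *) (use \<sigma>(2)[OF s'(3,4)] in auto)
  qed (use t1 \<sigma> N riemann_systemD(1,2)[OF sys] in \<open>auto intro: continuous_on_backward_cone\<close>)
  then show ?thesis by simp
qed

text \<open>Under time reversal the damping turns into growth, but at rate at most
  \<open>2 * a\<close>, because \<open>p * (p + q) \<le> 2 * p\<^sup>2\<close> for a dominating
  \<open>p\<close>. An exponential factor does no harm to a bound that starts from zero.\<close>

lemma riemann_system_backward_zero:
  assumes sys: "riemann_system \<theta> a T f g" and par: "\<theta> > 0" "0 \<le> a" and t1: "0 < t1" "t1 < T"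
    and init: "\<And>x. \<bar>x\<bar> > R \<Longrightarrow> f 0 x = 0 \<and> g 0 x = 0"
    and zero: "\<And>x. f t1 x = 0 \<and> g t1 x = 0"
  shows "f 0 x = 0 \<and> g 0 x = 0"
proof -
  from riemann_system_speed_bounded[OF sys par less_imp_le[OF t1(1)] t1(2) init]
  obtain \<sigma> where \<sigma>: "\<sigma> \<ge> 0" "\<And>t x. 0 \<le> t \<Longrightarrow> t \<le> t1 \<Longrightarrow>
    \<bar>speed \<theta> (f t x) (g t x)\<bar> \<le> \<sigma> \<and> \<bar>speed \<theta> (- g t x) (- f t x)\<bar> \<le> \<sigma>" by metis
  note D = riemann_systemD[OF sys]
  have pos: "f t x = 0 \<and> g t x = 0" if t: "0 < t" "t \<le> t1" for t x
  proof -
    define F where "F s = f (t1 - s)" for s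
    define G where "G s = g (t1 - s)" for s
    have quad: "p * (a / (1 + s) * (p + q)) \<le> 2 * a * p\<^sup>2" if "\<bar>q\<bar> \<le> \<bar>p\<bar>" "0 \<le> s" for p q s
    proof -
      have "\<bar>p * q\<bar> \<le> \<bar>p\<bar> * \<bar>p\<bar>" unfolding abs_mult by (intro mult_left_mono that) auto
      then have *: "p * (p + q) \<le> 2 * p\<^sup>2" "0 \<le> p * (p + q)" by (auto simp: algebra_simps power2_eq_square)
      have "a / (1 + s) * (p * (p + q)) \<le> a * (2 * p\<^sup>2)"
        using * par that(2)
        by (intro mult_mono[of "a / (1 + s)" a "p * (p + q)" "2 * p\<^sup>2"])
           (simp_all add: divide_le_eq mult_le_cancel_left1)
      moreover have "p * (a / (1 + s) * (p + q)) = a / (1 + s) * (p * (p + q))" by simp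
      ultimately show ?thesis by linarith
    qed
    have rev: "continuous_on (backward_cone \<sigma> 0 (t1 - t) x) (\<lambda>(s, y). h (t1 - s) y)"
      if "continuous_on ({0..<T} \<times> UNIV) (\<lambda>(s, y). h s y)" for h :: "real \<Rightarrow> real \<Rightarrow> real"
    proof -
      have "continuous_on (backward_cone \<sigma> 0 (t1 - t) x) (\<lambda>z. (t1 - fst z, snd z))"
        by (intro continuous_intros)
      moreover have "(\<lambda>z. (t1 - fst z, snd z)) ` backward_cone \<sigma> 0 (t1 - t) x \<subseteq> {0..<T} \<times> UNIV"
        using t t1 by (auto simp: backward_cone_def)
      ultimately have "continuous_on (backward_cone \<sigma> 0 (t1 - t) x)
          (\<lambda>z. case (t1 - fst z, snd z) of (s, y) \<Rightarrow> h s y)"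
        by (rule continuous_on_compose2[OF that])
      then show ?thesis by (simp add: case_prod_unfold)
    qed
    have part: "has_partials (\<lambda>s y. h (t1 - s) y) (- p) q s y" if "has_partials h p q (t1 - s) y" for h p q s y
      using has_partials_affine[of h p q t1 "- 1" s 0 1 y 1] that by simp
    have "\<bar>F (t1 - t) x\<bar> \<le> exp (2 * a * (t1 - t - 0)) * 0 \<and> \<bar>G (t1 - t) x\<bar> \<le> exp (2 * a * (t1 - t - 0)) * 0"
    proof (rule cone_maximum_principle[where \<sigma> = \<sigma> and \<phi> = F and \<psi> = G])
      fix s y assume s: "(s, y) \<in> backward_cone \<sigma> 0 (t1 - t) x" "0 < s"
      define r where "r = t1 - s"
      have r: "0 < r" "r < T" "0 \<le> r" "r \<le> t1" using t t1 s by (auto simp: backward_cone_def r_def)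
      show "damped_transport \<sigma> (2 * a) F G s y"
      proof (rule damped_transportI[where v = "- speed \<theta> (f r y) (g r y)"])
        show "has_partials F (- (- (a / (1 + r)) * (f r y + g r y) - speed \<theta> (f r y) (g r y) * deriv (f r) y))
           (deriv (f r) y) s y"
          unfolding F_def by (rule part) (use D(5)[of r y] r in \<open>simp add: r_def\<close>)
        show "\<bar>- speed \<theta> (f r y) (g r y)\<bar> \<le> \<sigma>" using \<sigma>(2)[OF r(3,4)] by simp
        assume "\<bar>G s y\<bar> \<le> \<bar>F s y\<bar>"
        then show "F s y * (- (- (a / (1 + r)) * (f r y + g r y) - speed \<theta> (f r y) (g r y) * deriv (f r) y) +
             - speed \<theta> (f r y) (g r y) * deriv (f r) y) \<le> 2 * a * (F s y)\<^sup>2"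
          using quad[of "g r y" "f r y" r] r by (simp add: F_def G_def r_def)
      qed
      show "damped_transport \<sigma> (2 * a) G F s y"
      proof (rule damped_transportI[where v = "speed \<theta> (- g r y) (- f r y)"])
        show "has_partials G (- (- (a / (1 + r)) * (f r y + g r y) + speed \<theta> (- g r y) (- f r y) * deriv (g r) y))
           (deriv (g r) y) s y"
          unfolding G_def by (rule part) (use D(6)[of r y] r in \<open>simp add: r_def\<close>)
        show "\<bar>speed \<theta> (- g r y) (- f r y)\<bar> \<le> \<sigma>" using \<sigma>(2)[OF r(3,4)] by simp
        assume "\<bar>F s y\<bar> \<le> \<bar>G s y\<bar>"
        then show "G s y * (- (- (a / (1 + r)) * (f r y + g r y) + speed \<theta> (- g r y) (- f r y) * deriv (g r) y) +
             speed \<theta> (- g r y) (- f r y) * deriv (g r) y) \<le> 2 * a * (G s y)\<^sup>2"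
          using quad[of "f r y" "g r y" r] r by (simp add: F_def G_def r_def add.commute)
      qed
    qed (use t t1 \<sigma> zero rev[OF D(1)] rev[OF D(2)] in \<open>auto simp: F_def G_def\<close>)
    then show ?thesis by (simp add: F_def G_def)
  qed
  \<comment> \<open>The equations hold at positive times, so the reversed cone stops short of
    \<open>t = 0\<close>, which is reached by continuity.\<close>
  have "h 0 x = 0" if c: "continuous_on ({0..<T} \<times> UNIV) (\<lambda>(t, x). h t x)" and z: "\<And>t. 0 < t \<Longrightarrow> t \<le> t1 \<Longrightarrow> h t x = 0"
    for h :: "real \<Rightarrow> real \<Rightarrow> real"
  proof (rule continuous_constant_on_closure[of "{0<..t1}" "\<lambda>t. h t x"])
    have "continuous_on (closure {0<..t1}) (\<lambda>t. case (t, x) of (t, x) \<Rightarrow> h t x)"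
      using t1 by (intro continuous_on_compose2[OF c]) (auto intro!: continuous_intros)
    then show "continuous_on (closure {0<..t1}) (\<lambda>t. h t x)" by simp
  qed (use t1 z in auto)
  from this[OF D(1)] this[OF D(2)] pos show ?thesis by blast
qed

text \<open>The difference is transported with the speed of the first solution. The discrepancy of
  the two speeds multiplies a slope of the second solution, bounded by \<open>B\<close>, and is
  itself at most \<open>1 + \<theta>\<close> times the dominating difference; this gives the rate
  \<open>K = (1 + \<theta>) * B\<close>.\<close>

lemma riemann_system_unique:
  assumes sys: "riemann_system \<theta> a T f g" "riemann_system \<theta> a T f' g'"
    and par: "\<theta> > 0" "0 \<le> a" and t1: "0 \<le> t1" "t1 < T"
    and init: "\<And>x. \<bar>x\<bar> > R \<Longrightarrow> f 0 x = 0 \<and> g 0 x = 0"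
    and eq: "\<And>x. f' 0 x = f 0 x \<and> g' 0 x = g 0 x"
  shows "f' t1 x = f t1 x \<and> g' t1 x = g t1 x"
proof -
  note D = riemann_systemD[OF sys(1)]
  note D' = riemann_systemD[OF sys(2)]
  have init': "\<And>x. \<bar>x\<bar> > R \<Longrightarrow> f' 0 x = 0 \<and> g' 0 x = 0" using init eq by simp
  obtain \<sigma> where \<sigma>: "\<sigma> \<ge> 0" "\<And>t x. 0 \<le> t \<Longrightarrow> t \<le> t1 \<Longrightarrow>
    \<bar>speed \<theta> (f t x) (g t x)\<bar> \<le> \<sigma> \<and> \<bar>speed \<theta> (- g t x) (- f t x)\<bar> \<le> \<sigma>"
    using riemann_system_speed_bounded[OF sys(1) par t1 init] by metis
  obtain B where B: "B \<ge> 0" "\<And>t x. 0 \<le> t \<Longrightarrow> t \<le> t1 \<Longrightarrow> \<bar>deriv (f' t) x\<bar> \<le> B \<and> \<bar>deriv (g' t) x\<bar> \<le> B"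
    using riemann_system_bounded[OF sys(2) par t1 init'] by metis
  define F where "F t x = f t x - f' t x" for t x
  define G where "G t x = g t x - g' t x" for t x
  define K where "K = (1 + \<theta>) * B"
  have quad: "p * (- (a / (1 + s)) * (p + q) - d) \<le> K * p\<^sup>2"
    if "\<bar>q\<bar> \<le> \<bar>p\<bar>" "0 \<le> s" "d = ((p + q) / 2 + \<theta> * (p - q) / 2) * e" "\<bar>e\<bar> \<le> B" for p q s d e
  proof -
    have "\<bar>p * q\<bar> \<le> \<bar>p\<bar> * \<bar>p\<bar>" unfolding abs_mult by (intro mult_left_mono that) auto
    then have "p * (p + q) \<ge> 0" by (simp add: algebra_simps)
    then have "a / (1 + s) * (p * (p + q)) \<ge> 0" using par that(2) by simp
    moreover have "p * (- (a / (1 + s)) * (p + q)) = - (a / (1 + s) * (p * (p + q)))" by simp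
    ultimately have 1: "p * (- (a / (1 + s)) * (p + q)) \<le> 0" by linarith
    have "\<bar>(p + q) / 2 + \<theta> * (p - q) / 2\<bar> \<le> (1 + \<theta>) * \<bar>p\<bar>"
      using abs_speed_le[of \<theta> p "\<bar>p\<bar>" q] par that(1) by (simp add: speed_def)
    then have "\<bar>d\<bar> \<le> (1 + \<theta>) * \<bar>p\<bar> * B"
      unfolding that(3) abs_mult using that(4) par by (intro mult_mono) auto
    then have "\<bar>p\<bar> * \<bar>d\<bar> \<le> \<bar>p\<bar> * ((1 + \<theta>) * \<bar>p\<bar> * B)" by (intro mult_left_mono) auto
    also have "\<dots> = K * p\<^sup>2" by (simp add: K_def power2_eq_square algebra_simps)
    finally have "\<bar>p * d\<bar> \<le> K * p\<^sup>2" by (simp add: abs_mult)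
    with 1 show ?thesis by (simp add: right_diff_distrib)
  qed
  have "\<bar>F t1 x\<bar> \<le> exp (K * (t1 - 0)) * 0 \<and> \<bar>G t1 x\<bar> \<le> exp (K * (t1 - 0)) * 0"
  proof (rule cone_maximum_principle[where \<sigma> = \<sigma> and \<phi> = F and \<psi> = G])
    fix s y assume s: "(s, y) \<in> backward_cone \<sigma> 0 t1 x" "0 < s"
    have s': "0 < s" "s < T" "0 \<le> s" "s \<le> t1" using t1 s by (auto simp: backward_cone_def)
    show "damped_transport \<sigma> K F G s y"
    proof (rule damped_transportI)
      show "has_partials F (- (a / (1 + s)) * (f s y + g s y) - speed \<theta> (f s y) (g s y) * deriv (f s) y -
          (- (a / (1 + s)) * (f' s y + g' s y) - speed \<theta> (f' s y) (g' s y) * deriv (f' s) y))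
          (deriv (f s) y - deriv (f' s) y) s y"
        unfolding F_def by (rule has_partials_diff[OF D(5)[OF s'(1,2)] D'(5)[OF s'(1,2)]])
      show "\<bar>speed \<theta> (f s y) (g s y)\<bar> \<le> \<sigma>" using \<sigma>(2)[OF s'(3,4)] by simp
      assume "\<bar>G s y\<bar> \<le> \<bar>F s y\<bar>"
      from quad[OF this s'(3) refl, of "deriv (f' s) y"] B(2)[OF s'(3,4), of y]
      have "F s y * (- (a / (1 + s)) * (F s y + G s y) -
         ((F s y + G s y) / 2 + \<theta> * (F s y - G s y) / 2) * deriv (f' s) y) \<le> K * (F s y)\<^sup>2" by simp
      moreover have "- (a / (1 + s)) * (F s y + G s y) -
         ((F s y + G s y) / 2 + \<theta> * (F s y - G s y) / 2) * deriv (f' s) y =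
         - (a / (1 + s)) * (f s y + g s y) - speed \<theta> (f s y) (g s y) * deriv (f s) y -
          (- (a / (1 + s)) * (f' s y + g' s y) - speed \<theta> (f' s y) (g' s y) * deriv (f' s) y) +
            speed \<theta> (f s y) (g s y) * (deriv (f s) y - deriv (f' s) y)"
        by (simp add: F_def G_def speed_def algebra_simps add_divide_distrib diff_divide_distrib)
      ultimately show "F s y * (- (a / (1 + s)) * (f s y + g s y) - speed \<theta> (f s y) (g s y) * deriv (f s) y -
          (- (a / (1 + s)) * (f' s y + g' s y) - speed \<theta> (f' s y) (g' s y) * deriv (f' s) y) +
            speed \<theta> (f s y) (g s y) * (deriv (f s) y - deriv (f' s) y)) \<le> K * (F s y)\<^sup>2"
        by simp
    qed
    show "damped_transport \<sigma> K G F s y"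
    proof (rule damped_transportI)
      show "has_partials G (- (a / (1 + s)) * (f s y + g s y) + speed \<theta> (- g s y) (- f s y) * deriv (g s) y -
          (- (a / (1 + s)) * (f' s y + g' s y) + speed \<theta> (- g' s y) (- f' s y) * deriv (g' s) y))
          (deriv (g s) y - deriv (g' s) y) s y"
        unfolding G_def by (rule has_partials_diff[OF D(6)[OF s'(1,2)] D'(6)[OF s'(1,2)]])
      show "\<bar>- speed \<theta> (- g s y) (- f s y)\<bar> \<le> \<sigma>" using \<sigma>(2)[OF s'(3,4)] by simp
      assume "\<bar>F s y\<bar> \<le> \<bar>G s y\<bar>"
      from quad[OF this s'(3) refl, of "deriv (g' s) y"] B(2)[OF s'(3,4), of y]
      have "G s y * (- (a / (1 + s)) * (G s y + F s y) -
         ((G s y + F s y) / 2 + \<theta> * (G s y - F s y) / 2) * deriv (g' s) y) \<le> K * (G s y)\<^sup>2" by simp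
      moreover have "- (a / (1 + s)) * (G s y + F s y) -
         ((G s y + F s y) / 2 + \<theta> * (G s y - F s y) / 2) * deriv (g' s) y =
         - (a / (1 + s)) * (f s y + g s y) + speed \<theta> (- g s y) (- f s y) * deriv (g s) y -
          (- (a / (1 + s)) * (f' s y + g' s y) + speed \<theta> (- g' s y) (- f' s y) * deriv (g' s) y) +
            - speed \<theta> (- g s y) (- f s y) * (deriv (g s) y - deriv (g' s) y)"
        by (simp add: F_def G_def speed_def algebra_simps add_divide_distrib diff_divide_distrib)
      ultimately show "G s y * (- (a / (1 + s)) * (f s y + g s y) + speed \<theta> (- g s y) (- f s y) * deriv (g s) y -
          (- (a / (1 + s)) * (f' s y + g' s y) + speed \<theta> (- g' s y) (- f' s y) * deriv (g' s) y) +
            - speed \<theta> (- g s y) (- f s y) * (deriv (g s) y - deriv (g' s) y)) \<le> K * (G s y)\<^sup>2"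
        by simp
    qed
  qed (use t1 \<sigma> eq continuous_on_diff[OF D(1) D'(1)] continuous_on_diff[OF D(2) D'(2)]
       in \<open>auto simp: F_def G_def case_prod_unfold intro!: continuous_on_backward_cone\<close>)
  then show ?thesis by (simp add: F_def G_def)
qed

section \<open>Characteristics\<close>

text \<open>Integrating \<open>L * exp (2 * L * \<bar>s\<bar>)\<close> from 0 returns at most half
  of the weight; this half is the contraction constant of the Picard operator below.\<close>

lemma abs_integral_exp_le:
  fixes h :: "real \<Rightarrow> real"
  assumes "continuous_on UNIV h" and L: "L > 0" and D: "D \<ge> 0"
    and le: "\<And>s. \<bar>h s\<bar> \<le> L * exp (2 * L * \<bar>s\<bar>) * D"
  shows "t \<ge> 0 \<Longrightarrow> \<bar>integral {0..t} h\<bar> \<le> exp (2 * L * \<bar>t\<bar>) * D / 2"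
    and "t \<le> 0 \<Longrightarrow> \<bar>integral {t..0} h\<bar> \<le> exp (2 * L * \<bar>t\<bar>) * D / 2"
proof -
  have hi: "h integrable_on {c..d}" for c d
    using assms(1) by (intro integrable_continuous_real continuous_on_subset[OF assms(1)]) auto
  { assume "t \<ge> 0"
    have "((\<lambda>s. L * exp (2 * L * s) * D) has_integral (exp (2 * L * t) * D / 2 - exp (2 * L * 0) * D / 2)) {0..t}"
      using L \<open>t \<ge> 0\<close> by (intro fundamental_theorem_of_calculus)
         (auto intro!: derivative_eq_intros simp flip: has_real_derivative_iff_has_vector_derivative)
    moreover have "norm (integral {0..t} h) \<le> integral {0..t} (\<lambda>s. L * exp (2 * L * s) * D)"
      using calculation le by (intro integral_norm_bound_integral hi) (auto simp: has_integral_iff intro: order_trans[OF le])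
    ultimately show "\<bar>integral {0..t} h\<bar> \<le> exp (2 * L * \<bar>t\<bar>) * D / 2"
      using D \<open>t \<ge> 0\<close> by (simp add: has_integral_iff) }
  { assume "t \<le> 0"
    have "((\<lambda>s. L * exp (- 2 * L * s) * D) has_integral (- exp (- 2 * L * 0) * D / 2 - (- exp (- 2 * L * t) * D / 2))) {t..0}"
      using L \<open>t \<le> 0\<close> by (intro fundamental_theorem_of_calculus)
         (auto intro!: derivative_eq_intros simp flip: has_real_derivative_iff_has_vector_derivative)
    moreover have "norm (integral {t..0} h) \<le> integral {t..0} (\<lambda>s. L * exp (- 2 * L * s) * D)"
      using calculation by (intro integral_norm_bound_integral hi) (auto simp: has_integral_iff intro: order_trans[OF le])
    ultimately show "\<bar>integral {t..0} h\<bar> \<le> exp (2 * L * \<bar>t\<bar>) * D / 2"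
      using D \<open>t \<le> 0\<close> by (simp add: has_integral_iff) }
qed

definition primitive :: "(real \<Rightarrow> real) \<Rightarrow> real \<Rightarrow> real" where
  "primitive h t = (if t \<ge> 0 then integral {0..t} h else - integral {t..0} h)"

lemma primitive_deriv:
  assumes "continuous_on UNIV h"
  shows "(primitive h has_real_derivative h t) (at t)"
proof -
  define b where "b = \<bar>t\<bar> + 1"
  have c: "continuous_on A h" for A using assms continuous_on_subset by blast
  have hi: "h integrable_on {c..d}" for c d
    by (intro integrable_continuous_real c)
  have "((\<lambda>u. integral {- b..u} h) has_vector_derivative h t) (at t within {- b..b})"
    by (rule integral_has_vector_derivative[OF c]) (auto simp: b_def)
  then have "((\<lambda>u. integral {- b..u} h) has_real_derivative h t) (at t)"
    unfolding b_def has_real_derivative_iff_has_vector_derivative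
    by (subst (asm) at_within_Icc_at) auto
  then have "((\<lambda>u. integral {- b..u} h - integral {- b..0} h) has_real_derivative h t - 0) (at t)"
    by (intro DERIV_diff) auto
  then have "((\<lambda>u. integral {- b..u} h - integral {- b..0} h) has_real_derivative h t) (at t)"
    by simp
  then show ?thesis
  proof (rule has_field_derivative_transform_within_open[where S = "{- b<..<b}"])
    fix u assume "u \<in> {- b<..<b}"
    then have u: "- b < u \<and> u < b" by simp
    show "integral {- b..u} h - integral {- b..0} h = primitive h u"
    proof (cases "u \<ge> 0")
      case True
      then have "integral {- b..0} h + integral {0..u} h = integral {- b..u} h"
        using u by (intro Henstock_Kurzweil_Integration.integral_combine hi) (auto simp: b_def)
      with True show ?thesis by (simp add: primitive_def)
    next
      case False
      then have "integral {- b..u} h + integral {u..0} h = integral {- b..0} h"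
        using u by (intro Henstock_Kurzweil_Integration.integral_combine hi) (auto simp: b_def)
      with False show ?thesis by (simp add: primitive_def)
    qed
  qed (auto simp: b_def)
qed

lemma primitive_diff:
  assumes "continuous_on UNIV h" "continuous_on UNIV k"
  shows "primitive h t - primitive k t = primitive (\<lambda>s. h s - k s) t"
proof -
  have hi: "h integrable_on {c..d}" "k integrable_on {c..d}" for c d
    using assms by (auto intro!: integrable_continuous_real intro: continuous_on_subset)
  show ?thesis by (auto simp: primitive_def integral_diff hi)
qed

text \<open>The unknown of the fixed point problem is \<open>v t = exp (- 2 L |t|) (X t - x0)\<close>; the weight makes
  the Picard operator a contraction on the whole line at once.\<close>

theorem global_ode_solution:
  fixes F :: "real \<Rightarrow> real \<Rightarrow> real"
  assumes cont: "continuous_on UNIV (\<lambda>(t, x). F t x)" and B: "\<And>t x. \<bar>F t x\<bar> \<le> B"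
    and L: "L > 0" and lip: "\<And>t x y. \<bar>F t x - F t y\<bar> \<le> L * \<bar>x - y\<bar>"
  obtains X where "X t0 = x0" "\<And>t. (X has_real_derivative F t (X t)) (at t)"
proof -
  define w where "w t = exp (2 * L * \<bar>t\<bar>)" for t
  have w: "w t > 0" "w t \<ge> 1" "w t \<noteq> 0" for t using L by (auto simp: w_def)
  have wc: "continuous_on A w" for A unfolding w_def by (intro continuous_intros)
  define H where "H v s = F (t0 + s) (x0 + w s * v s)" for v s
  have Hc: "continuous_on UNIV (H v)" if "continuous_on UNIV v" for v
  proof -
    have "continuous_on UNIV (\<lambda>s. (t0 + s, x0 + w s * v s))"
      by (intro continuous_intros wc that)
    from continuous_on_compose2[OF cont this] show ?thesis by (simp add: H_def)
  qed
  have B0: "B \<ge> 0" using B[of 0 0] by linarith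
  define P where "P v t = primitive (H v) t / w t" for v t
  have est: "\<bar>primitive h t\<bar> \<le> w t * D / 2"
    if "continuous_on UNIV h" "D \<ge> 0" "\<And>s. \<bar>h s\<bar> \<le> L * w s * D" for h D t
    using abs_integral_exp_le[OF that(1) L that(2), of t] that(3)
    by (cases "t \<ge> 0") (auto simp: primitive_def w_def)
  have Pb: "P v \<in> bcontfun" if "continuous_on UNIV v" for v
  proof -
    have "continuous_on UNIV (primitive (H v))"
      using primitive_deriv[OF Hc[OF that]] DERIV_continuous_on by (metis has_field_derivative_at_within)
    then have "continuous_on UNIV (P v)"
      unfolding P_def using w(3) by (intro continuous_intros wc) auto
    moreover have "\<bar>P v t\<bar> \<le> B / L" for t
    proof -
      have "\<bar>primitive (H v) t\<bar> \<le> w t * (B / L) / 2"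
      proof (rule est[OF Hc[OF that]])
        fix s
        have "\<bar>H v s\<bar> \<le> 1 * B" using B by (simp add: H_def)
        also have "\<dots> \<le> w s * B" using w(2) B0 by (intro mult_right_mono)
        finally show "\<bar>H v s\<bar> \<le> L * w s * (B / L)" using L by simp
      qed (use B0 L in auto)
      moreover have "0 \<le> w t * (B / L)" using w(1)[of t] B0 L by simp
      moreover have "D / 2 \<le> D" if "0 \<le> D" for D :: real using that by simp
      ultimately have "\<bar>primitive (H v) t\<bar> \<le> w t * (B / L)" by (meson order_trans)
      then show ?thesis using w(1)[of t] L by (simp add: P_def field_simps)
    qed
    ultimately show ?thesis
      unfolding bcontfun_def bounded_iff by (auto intro: exI[of _ "B / L"])
  qed
  have app: "apply_bcontfun (Bcontfun (P (apply_bcontfun v))) = P (apply_bcontfun v)" for v :: "real \<Rightarrow>\<^sub>C real"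
    by (intro Bcontfun_inverse Pb) auto
  have "\<exists>!v :: real \<Rightarrow>\<^sub>C real. Bcontfun (P (apply_bcontfun v)) = v"
  proof (rule banach_fix_type[of "1/2"])
    show "\<forall>v v'. dist (Bcontfun (P (apply_bcontfun v))) (Bcontfun (P (apply_bcontfun v'))) \<le> 1/2 * dist v v'"
    proof (intro allI dist_bound)
      fix v v' :: "real \<Rightarrow>\<^sub>C real" and t
      have "\<bar>primitive (\<lambda>s. H v s - H v' s) t\<bar> \<le> w t * dist v v' / 2"
      proof (rule est)
        fix s
        have "\<bar>v s - v' s\<bar> \<le> dist v v'" using dist_bounded[of v s v'] by (simp add: dist_real_def)
        then have "w s * \<bar>v s - v' s\<bar> \<le> w s * dist v v'" using w(1)[of s] by simp
        moreover have "\<bar>H v s - H v' s\<bar> \<le> L * \<bar>w s * v s - w s * v' s\<bar>"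
          using lip[of "t0 + s" "x0 + w s * v s" "x0 + w s * v' s"] by (simp add: H_def)
        moreover have "\<bar>w s * v s - w s * v' s\<bar> = w s * \<bar>v s - v' s\<bar>"
          using w(1)[of s] by (simp add: abs_mult flip: right_diff_distrib)
        ultimately show "\<bar>H v s - H v' s\<bar> \<le> L * w s * dist v v'"
          using L by (smt (verit) mult_left_mono mult.assoc)
      qed (auto intro!: continuous_intros Hc)
      then show "dist (Bcontfun (P (apply_bcontfun v)) t) (Bcontfun (P (apply_bcontfun v')) t) \<le> 1/2 * dist v v'"
        unfolding app dist_real_def
        using primitive_diff[OF Hc Hc, of v v' t] w(1)[of t]
        by (simp add: P_def field_simps flip: diff_divide_distrib)
    qed
  qed auto
  then obtain v :: "real \<Rightarrow>\<^sub>C real" where "Bcontfun (P (apply_bcontfun v)) = v" by blast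
  with app[of v] have v: "P (apply_bcontfun v) = apply_bcontfun v" by simp
  define X where "X t = x0 + primitive (H v) (t - t0)" for t
  have Xv: "X t = x0 + w (t - t0) * v (t - t0)" for t
  proof -
    have "v (t - t0) = primitive (H v) (t - t0) / w (t - t0)" using fun_cong[OF v, of "t - t0"] by (simp add: P_def)
    then show ?thesis using w(3)[of "t - t0"] by (simp add: X_def)
  qed
  have "(X has_real_derivative F t (X t)) (at t)" for t
  proof -
    have "((\<lambda>t. primitive (H v) (t - t0)) has_real_derivative H v (t - t0) * 1) (at t)"
      by (rule DERIV_chain2[where f = "primitive (H v)" and g = "\<lambda>t. t - t0"])
         (auto intro!: primitive_deriv Hc derivative_eq_intros)
    from DERIV_add[OF DERIV_const[of x0] this]
    have "(X has_real_derivative H v (t - t0)) (at t)"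
      by (simp add: X_def[abs_def])
    then show ?thesis using Xv[of t] by (simp add: H_def)
  qed
  moreover have "X t0 = x0" by (simp add: X_def primitive_def)
  ultimately show ?thesis using that by blast
qed

text \<open>Uniform continuity on a compact neighbourhood of the curve. The point \<open>y\<close>
  is left free between \<open>X t\<close> and \<open>X t + h n\<close>, so that it can also be the
  unknown intermediate point of the mean value theorem.\<close>

lemma shift_uniform_limit:
  fixes H' :: "real \<Rightarrow> real \<Rightarrow> real" and X h
  assumes cont: "continuous_on ({s0..s1} \<times> UNIV) (\<lambda>(t, x). H' t x)" and X: "continuous_on {s0..s1} X"
    and h: "\<And>n. 0 < h n" "h \<longlonglongrightarrow> 0" "e > 0"
  shows "\<forall>\<^sub>F n in sequentially. \<forall>t\<in>{s0..s1}. \<forall>y. X t \<le> y \<and> y \<le> X t + h n \<longrightarrow>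
    \<bar>H' t y - H' t (X t)\<bar> < (e::real)"
proof -
  have "compact (X ` {s0..s1})" using X by (intro compact_continuous_image) auto
  then obtain M where "\<forall>t\<in>{s0..s1}. \<bar>X t\<bar> \<le> M"
    using compact_imp_bounded[of "X ` {s0..s1}"] unfolding bounded_iff by auto
  then have M: "\<bar>X t\<bar> \<le> M" if "t \<in> {s0..s1}" for t using that by blast
  define Q where "Q = {s0..s1} \<times> {- M - 1 .. M + 1}"
  have "uniformly_continuous_on Q (\<lambda>(t, x). H' t x)"
    by (rule compact_uniformly_continuous[OF continuous_on_subset[OF cont]])
       (auto simp: Q_def intro: compact_Times)
  then obtain d where d: "d > 0" "\<And>z z'. z \<in> Q \<Longrightarrow> z' \<in> Q \<Longrightarrow> dist z' z < d \<Longrightarrow>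
      dist (case z' of (t, x) \<Rightarrow> H' t x) (case z of (t, x) \<Rightarrow> H' t x) < e"
    using \<open>e > 0\<close> unfolding uniformly_continuous_on_def by metis
  have "\<forall>\<^sub>F n in sequentially. h n < min d 1"
    using h(2) d(1) by (intro order_tendstoD(2)) auto
  then show ?thesis
  proof (rule eventually_mono, intro ballI allI impI)
    fix n t y assume n: "h n < min d 1" and t: "t \<in> {s0..s1}" and y: "X t \<le> y \<and> y \<le> X t + h n"
    have "(t, X t) \<in> Q" "(t, y) \<in> Q" using M[OF t] t y n by (auto simp: Q_def)
    moreover have "dist (t, y) (t, X t) < d" using y n by (simp add: dist_Pair_Pair dist_real_def)
    ultimately show "\<bar>H' t y - H' t (X t)\<bar> < e" using d(2) by (fastforce simp: dist_real_def)
  qed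
qed

lemma difference_quotient_uniform_limit:
  fixes H H' :: "real \<Rightarrow> real \<Rightarrow> real" and X h
  assumes H: "\<And>t x. t \<in> {s0..s1} \<Longrightarrow> (H t has_real_derivative H' t x) (at x)"
    and cont: "continuous_on ({s0..s1} \<times> UNIV) (\<lambda>(t, x). H' t x)" and X: "continuous_on {s0..s1} X"
    and h: "\<And>n. 0 < h n" "h \<longlonglongrightarrow> 0"
  shows "uniform_limit {s0..s1} (\<lambda>n t. H' t (X t + h n)) (\<lambda>t. H' t (X t)) sequentially"
    and "uniform_limit {s0..s1} (\<lambda>n t. (H t (X t + h n) - H t (X t)) / h n) (\<lambda>t. H' t (X t)) sequentially"
proof -
  show "uniform_limit {s0..s1} (\<lambda>n t. H' t (X t + h n)) (\<lambda>t. H' t (X t)) sequentially"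
  proof (rule uniform_limitI)
    fix e :: real assume "e > 0"
    from shift_uniform_limit[OF cont X h this]
    show "\<forall>\<^sub>F n in sequentially. \<forall>t\<in>{s0..s1}. dist (H' t (X t + h n)) (H' t (X t)) < e"
      by (rule eventually_mono) (auto simp: dist_real_def less_imp_le[OF h(1)])
  qed
  show "uniform_limit {s0..s1} (\<lambda>n t. (H t (X t + h n) - H t (X t)) / h n) (\<lambda>t. H' t (X t)) sequentially"
  proof (rule uniform_limitI)
    fix e :: real assume "e > 0"
    from shift_uniform_limit[OF cont X h this]
    show "\<forall>\<^sub>F n in sequentially. \<forall>t\<in>{s0..s1}. dist ((H t (X t + h n) - H t (X t)) / h n) (H' t (X t)) < e"
    proof (rule eventually_mono, intro ballI)
      fix n t assume le: "\<forall>t\<in>{s0..s1}. \<forall>y. X t \<le> y \<and> y \<le> X t + h n \<longrightarrow> \<bar>H' t y - H' t (X t)\<bar> < e"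
        and t: "t \<in> {s0..s1}"
      have "X t < X t + h n" using h(1) by simp
      from MVT2[OF this, of "H t" "H' t"] H[OF t]
      obtain y where y: "X t < y" "y < X t + h n" "H t (X t + h n) - H t (X t) = (X t + h n - X t) * H' t y"
        by blast
      then have "(H t (X t + h n) - H t (X t)) / h n = H' t y" using h(1)[of n] by simp
      with le t y(1,2) show "dist ((H t (X t + h n) - H t (X t)) / h n) (H' t (X t)) < e"
        by (simp add: dist_real_def)
    qed
  qed
qed

section \<open>Global solutions and their characteristics\<close>

lemma continuous_slice:
  assumes "continuous_on ({0..} \<times> UNIV) (\<lambda>z. h (fst z) (snd z))" "t \<ge> 0"
  shows "continuous_on A (h t :: real \<Rightarrow> real)"
proof -
  have "continuous_on A (\<lambda>x. (t, x))" by (intro continuous_intros)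
  from continuous_on_compose2[OF assms(1) this] assms(2) show ?thesis by (simp add: image_subset_iff)
qed

locale global_solution =
  fixes \<theta> a R :: real and f g :: "real \<Rightarrow> real \<Rightarrow> real"
  assumes par: "\<theta> > 0" "0 \<le> a" "a \<le> 1" "R > 0"
    and sys: "\<And>T. riemann_system \<theta> a T f g"
    and init: "\<And>x. \<bar>x\<bar> > R \<Longrightarrow> f 0 x = 0 \<and> g 0 x = 0"
begin

lemma reflect: "global_solution \<theta> a R (\<lambda>t x. - g t (- x)) (\<lambda>t x. - f t (- x))"
  by unfold_locales (use par riemann_system_reflect[OF sys] init in auto)

lemma partials:
  assumes "t > 0"
  shows "has_partials f (- (a / (1 + t)) * (f t x + g t x) - speed \<theta> (f t x) (g t x) * deriv (f t) x)
           (deriv (f t) x) t x"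
    and "has_partials g (- (a / (1 + t)) * (f t x + g t x) + speed \<theta> (- g t x) (- f t x) * deriv (g t) x)
           (deriv (g t) x) t x"
  using riemann_systemD(5,6)[OF sys[of "t + 1"], of t] assms by auto

lemma continuous:
  shows "continuous_on ({0..} \<times> UNIV) (\<lambda>(t, x). f t x)" "continuous_on ({0..} \<times> UNIV) (\<lambda>(t, x). g t x)"
    "continuous_on ({0..} \<times> UNIV) (\<lambda>(t, x). deriv (f t) x)" "continuous_on ({0..} \<times> UNIV) (\<lambda>(t, x). deriv (g t) x)"
proof -
  have *: "continuous_on ({0..} \<times> UNIV) h" if "\<And>T. continuous_on ({0..<T} \<times> (UNIV :: real set)) h"
    for h :: "real \<times> real \<Rightarrow> real"
    unfolding continuous_on_eq_continuous_within
  proof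
    fix z :: "real \<times> real" assume z: "z \<in> {0..} \<times> UNIV"
    define T where "T = fst z + 1"
    have zT: "z \<in> {0..<T} \<times> UNIV" using z by (auto simp: T_def)
    have c: "continuous (at z within {0..<T} \<times> UNIV) h"
      by (rule bspec[OF that[of T, unfolded continuous_on_eq_continuous_within] zT])
    have "at z within {0..} \<times> UNIV = at z within {0..<T} \<times> UNIV"
      by (rule at_within_nhd[where S = "{..<T} \<times> UNIV"]) (use z in \<open>auto simp: T_def intro: open_Times\<close>)
    with c show "continuous (at z within {0..} \<times> UNIV) h" by simp
  qed
  show "continuous_on ({0..} \<times> UNIV) (\<lambda>(t, x). f t x)" "continuous_on ({0..} \<times> UNIV) (\<lambda>(t, x). g t x)"
    "continuous_on ({0..} \<times> UNIV) (\<lambda>(t, x). deriv (f t) x)" "continuous_on ({0..} \<times> UNIV) (\<lambda>(t, x). deriv (g t) x)"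
    by (intro * riemann_systemD[OF sys])+
qed

lemma support:
  assumes "0 \<le> t" "\<bar>x\<bar> > R + t"
  shows "f t x = 0" "g t x = 0" "deriv (f t) x = 0" "deriv (g t) x = 0"
  using riemann_system_support[OF sys[of "t + 1"] par(1,2) _ _ init assms(2)] assms(1)
    riemann_system_support_deriv[OF sys[of "t + 1"] par(1,2) _ _ init assms(2)] by auto

lemma continuous_on_curve:
  assumes "continuous_on A X" "A \<subseteq> {0..}"
  shows "continuous_on A (\<lambda>t. f t (X t))" "continuous_on A (\<lambda>t. g t (X t))"
    "continuous_on A (\<lambda>t. deriv (f t) (X t))" "continuous_on A (\<lambda>t. deriv (g t) (X t))"
proof -
  have *: "continuous_on A (\<lambda>t. h t (X t))" if "continuous_on ({0..} \<times> UNIV) (\<lambda>(t, x). h t x)"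
    for h :: "real \<Rightarrow> real \<Rightarrow> real"
  proof -
    have "continuous_on A (\<lambda>t. case (t, X t) of (t, x) \<Rightarrow> h t x)"
      by (rule continuous_on_compose2[OF that]) (use assms in \<open>auto intro!: continuous_intros\<close>)
    then show ?thesis by simp
  qed
  show "continuous_on A (\<lambda>t. f t (X t))" "continuous_on A (\<lambda>t. g t (X t))"
    "continuous_on A (\<lambda>t. deriv (f t) (X t))" "continuous_on A (\<lambda>t. deriv (g t) (X t))"
    by (intro * continuous)+
qed

text \<open>One family suffices: \<open>reflect\<close> turns the curves of speed
  \<open>u - c\<close> into curves of this kind. The derivative is two-sided even at
  \<open>s0\<close> and \<open>s1\<close>, which is possible because the curves are built on the
  whole line.\<close>

definition characteristic :: "real \<Rightarrow> real \<Rightarrow> (real \<Rightarrow> real) \<Rightarrow> bool" where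
  "characteristic s0 s1 X \<longleftrightarrow>
     (\<forall>t\<in>{s0..s1}. (X has_real_derivative speed \<theta> (f t (X t)) (g t (X t))) (at t))"

lemma characteristic_exists:
  assumes s: "0 < s0" "s0 \<le> s1"
  obtains X where "X t0 = x0" "characteristic s0 s1 X"
proof -
  \<comment> \<open>Freezing the time outside \<open>{s0..s1}\<close> yields a bounded, globally
    Lipschitz speed on the whole plane, as \<open>global_ode_solution\<close> requires.\<close>
  define c where "c t = max s0 (min s1 t)" for t
  have c: "s0 \<le> c t" "c t \<le> s1" "0 \<le> c t" "0 < c t" for t using s by (auto simp: c_def)
  define F where "F t x = speed \<theta> (f (c t) x) (g (c t) x)" for t x
  have "0 \<le> s1" using s by simp
  obtain B where B: "B \<ge> 0" "\<And>t x. 0 \<le> t \<Longrightarrow> t \<le> s1 \<Longrightarrow>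
    \<bar>f t x\<bar> \<le> B \<and> \<bar>g t x\<bar> \<le> B \<and> \<bar>deriv (f t) x\<bar> \<le> B \<and> \<bar>deriv (g t) x\<bar> \<le> B"
    using riemann_system_bounded[OF sys[of "s1 + 1"] par(1,2) \<open>0 \<le> s1\<close> _ init] by (metis less_add_one)
  have hc: "continuous_on UNIV (\<lambda>z. h (c (fst z)) (snd z))"
    if "continuous_on ({0..} \<times> UNIV) (\<lambda>(t, x). h t x)" for h :: "real \<Rightarrow> real \<Rightarrow> real"
  proof -
    have "continuous_on UNIV (\<lambda>z :: real \<times> real. (c (fst z), snd z))"
      unfolding c_def by (intro continuous_intros)
    from continuous_on_compose2[OF that this] c(3) show ?thesis by (simp add: image_subset_iff)
  qed
  have lip: "\<bar>f (c t) x - f (c t) y\<bar> \<le> B * \<bar>x - y\<bar>" "\<bar>g (c t) x - g (c t) y\<bar> \<le> B * \<bar>x - y\<bar>" for t x y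
  proof -
    have *: "\<bar>h x - h y\<bar> \<le> B * \<bar>x - y\<bar>"
      if "\<And>x. (h has_real_derivative h' x) (at x)" "\<And>x. \<bar>h' x\<bar> \<le> B" for h h' :: "real \<Rightarrow> real"
      using field_differentiable_bound[of UNIV h h' B x y] that by auto
    show "\<bar>f (c t) x - f (c t) y\<bar> \<le> B * \<bar>x - y\<bar>" "\<bar>g (c t) x - g (c t) y\<bar> \<le> B * \<bar>x - y\<bar>"
      by (rule *[OF has_partials_dx[OF partials(1)[OF c(4)]]] *[OF has_partials_dx[OF partials(2)[OF c(4)]]];
          use B(2)[OF c(3,2)] in auto)+
  qed
  define L where "L = (1 + \<theta>) * B + 1"
  have "continuous_on UNIV (\<lambda>(t, x). F t x)"
    unfolding F_def speed_def case_prod_unfold using hc[OF continuous(1)] hc[OF continuous(2)]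
    by (intro continuous_intros) auto
  moreover have "\<bar>F t x\<bar> \<le> 1 + (1 + \<theta>) * B" for t x
    using abs_speed_le[of \<theta> "f (c t) x" B "g (c t) x"] par B(2)[OF c(3,2), of t x] by (auto simp: F_def)
  moreover have "L > 0" using par B(1) by (simp add: L_def add_nonneg_pos)
  moreover have "\<bar>F t x - F t y\<bar> \<le> L * \<bar>x - y\<bar>" for t x y
  proof -
    have "F t x - F t y = speed \<theta> (f (c t) x - f (c t) y) (g (c t) x - g (c t) y) - 1"
      by (simp add: F_def speed_def field_simps)
    then have "\<bar>F t x - F t y\<bar> \<le> (1 + \<theta>) * (B * \<bar>x - y\<bar>)"
      using abs_speed_le[OF par(1) lip] by simp
    also have "\<dots> \<le> L * \<bar>x - y\<bar>" by (simp add: L_def algebra_simps)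
    finally show ?thesis .
  qed
  ultimately obtain X where X: "X t0 = x0" "\<And>t. (X has_real_derivative F t (X t)) (at t)"
    by (rule global_ode_solution[where ?t0.0 = t0 and ?x0.0 = x0]) blast
  have "characteristic s0 s1 X"
    unfolding characteristic_def
  proof
    fix t assume "t \<in> {s0..s1}"
    then have "c t = t" by (auto simp: c_def)
    with X(2)[of t] show "(X has_real_derivative speed \<theta> (f t (X t)) (g t (X t))) (at t)"
      by (simp add: F_def)
  qed
  with X(1) that show ?thesis by blast
qed

text \<open>Second derivatives of \<open>f\<close> need not exist, yet the slope is differentiable
  along this curve. The difference quotients \<open>Qf n\<close> have derivatives that involve only
  first-order quantities and converge uniformly, so their limit may be differentiated.\<close>

lemma deriv_along_characteristic:
  assumes X: "characteristic s0 s1 X" and s: "0 < s0" and t: "t \<in> {s0..s1}"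
  shows "((\<lambda>t. deriv (f t) (X t)) has_real_derivative
     - ((1 + \<theta>) / 2 * deriv (f t) (X t) + (1 - \<theta>) / 2 * deriv (g t) (X t)) * deriv (f t) (X t)
     - a / (1 + t) * (deriv (f t) (X t) + deriv (g t) (X t))) (at t within {s0..s1})"
proof -
  define S where "S = {s0..s1}"
  define h where "h n = inverse (real (Suc n))" for n
  have h: "0 < h n" "h \<longlonglongrightarrow> 0" for n
    using LIMSEQ_inverse_real_of_nat by (auto simp: h_def[abs_def])
  define z where "z t = deriv (f t) (X t)" for t
  define w where "w t = deriv (g t) (X t)" for t
  define Qf where "Qf n t = (f t (X t + h n) - f t (X t)) / h n" for n t
  define Qg where "Qg n t = (g t (X t + h n) - g t (X t)) / h n" for n t
  define zh where "zh n t = deriv (f t) (X t + h n)" for n t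
  \<comment> \<open>The derivative of \<open>Qf n\<close>. The shifted curve
    \<open>X t + h n\<close> is not a characteristic; the difference of the speeds at the two
    points, divided by \<open>h n\<close> and multiplied by \<open>zh n t\<close>, is the quadratic
    term.\<close>
  define D where "D n t = - ((1 + \<theta>) / 2 * Qf n t + (1 - \<theta>) / 2 * Qg n t) * zh n t
     - a / (1 + t) * (Qf n t + Qg n t)" for n t
  define D' where "D' t = - ((1 + \<theta>) / 2 * z t + (1 - \<theta>) / 2 * w t) * z t - a / (1 + t) * (z t + w t)" for t
  have pos: "t > 0" "t \<ge> 0" if "t \<in> S" for t using that s by (auto simp: S_def)
  have sub: "S \<times> UNIV \<subseteq> {0..} \<times> UNIV" using pos by auto
  have Xc: "continuous_on {s0..s1} X"
    using X unfolding characteristic_def by (meson DERIV_continuous continuous_at_imp_continuous_on)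
  have c: "continuous_on ({s0..s1} \<times> UNIV) (\<lambda>(t, x). deriv (f t) x)"
     "continuous_on ({s0..s1} \<times> UNIV) (\<lambda>(t, x). deriv (g t) x)"
    using continuous_on_subset[OF continuous(3) sub] continuous_on_subset[OF continuous(4) sub]
    unfolding S_def by auto
  have df: "(f t has_real_derivative deriv (f t) x) (at x)" "(g t has_real_derivative deriv (g t) x) (at x)"
    if "t \<in> {s0..s1}" for t x
    using has_partials_dx[OF partials(1)] has_partials_dx[OF partials(2)] that s by auto
  note lim = difference_quotient_uniform_limit[OF df(1) c(1) Xc h] difference_quotient_uniform_limit[OF df(2) c(2) Xc h]
  have lims: "uniform_limit S zh z sequentially" "uniform_limit S Qf z sequentially" "uniform_limit S Qg w sequentially"
    using lim unfolding S_def zh_def[abs_def] z_def[abs_def] Qf_def[abs_def] Qg_def[abs_def] w_def[abs_def] by auto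
  have bd: "bounded (k ` S)" if "continuous_on S k" for k :: "real \<Rightarrow> real"
    using that by (intro compact_imp_bounded compact_continuous_image) (auto simp: S_def)
  have zc: "continuous_on S z" "continuous_on S w"
    unfolding z_def[abs_def] w_def[abs_def] S_def
    using continuous_on_curve(3,4)[OF Xc] s by (auto simp: subset_iff)
  have ac: "continuous_on S (\<lambda>t. a / (1 + t))"
    by (intro continuous_intros) (use pos in force)
  have "uniform_limit S D D' sequentially"
  proof -
    have m: "uniform_limit S (\<lambda>n t. k t * Q n t) (\<lambda>t. k t * q t) sequentially"
      if "continuous_on S k" "continuous_on S q" "uniform_limit S Q q sequentially"
      for k q :: "real \<Rightarrow> real" and Q
      by (rule uniform_lim_mult[OF uniform_limit_const that(3) bd[OF that(1)] bd[OF that(2)]])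
    have c: "continuous_on S (\<lambda>_. k)" for k :: real by (rule continuous_on_const)
    have "uniform_limit S (\<lambda>n t. (1 + \<theta>) / 2 * Qf n t + (1 - \<theta>) / 2 * Qg n t)
        (\<lambda>t. (1 + \<theta>) / 2 * z t + (1 - \<theta>) / 2 * w t) sequentially" (is "uniform_limit S ?A ?A' _")
      by (intro uniform_limit_add m[OF c zc(1) lims(2)] m[OF c zc(2) lims(3)])
    then have "uniform_limit S (\<lambda>n t. ?A n t * zh n t) (\<lambda>t. ?A' t * z t) sequentially"
      by (rule uniform_lim_mult[OF _ lims(1) bd bd[OF zc(1)]]) (intro continuous_intros zc)
    moreover have "uniform_limit S (\<lambda>n t. a / (1 + t) * (Qf n t + Qg n t)) (\<lambda>t. a / (1 + t) * (z t + w t)) sequentially"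
      by (intro m ac continuous_on_add zc uniform_limit_add lims)
    ultimately show ?thesis
      unfolding D_def[abs_def] D'_def[abs_def] mult_minus_left
      by (intro uniform_limit_minus uniform_limit_uminus)
  qed
  note u = this
  have "\<exists>k. \<forall>t\<in>S. (\<lambda>n. Qf n t) \<longlonglongrightarrow> k t \<and> (k has_derivative (*) (D' t)) (at t within S)"
  proof (intro has_derivative_sequence[where f' = "\<lambda>n t. (*) (D n t)"])
    show "convex S" by (simp add: S_def)
    show "t \<in> S" using t by (simp add: S_def)
    show "(\<lambda>n. Qf n t) \<longlonglongrightarrow> z t"
      using tendsto_uniform_limitI[OF lims(2)] t by (simp add: S_def)
  next
    fix n t assume tS: "t \<in> S"
    have Xd: "(X has_real_derivative speed \<theta> (f t (X t)) (g t (X t))) (at t within S)"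
      using X tS unfolding characteristic_def S_def by (blast intro: has_field_derivative_at_within)
    then have Xh: "((\<lambda>t. X t + h n) has_real_derivative speed \<theta> (f t (X t)) (g t (X t))) (at t within S)"
      by (auto intro!: derivative_eq_intros)
    note p = has_partials_curve[OF partials(1)[OF pos(1)[OF tS]] DERIV_ident]
    have "(Qf n has_real_derivative ((1 * (- (a / (1 + t)) * (f t (X t + h n) + g t (X t + h n)) -
         speed \<theta> (f t (X t + h n)) (g t (X t + h n)) * deriv (f t) (X t + h n)) +
         speed \<theta> (f t (X t)) (g t (X t)) * deriv (f t) (X t + h n)) -
         (1 * (- (a / (1 + t)) * (f t (X t) + g t (X t)) -
         speed \<theta> (f t (X t)) (g t (X t)) * deriv (f t) (X t)) +
         speed \<theta> (f t (X t)) (g t (X t)) * deriv (f t) (X t))) / h n) (at t within S)"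
      unfolding Qf_def[abs_def]
      by (intro DERIV_cdivide DERIV_diff p[OF Xd] p[OF Xh])
    also have "((1 * (- (a / (1 + t)) * (f t (X t + h n) + g t (X t + h n)) -
         speed \<theta> (f t (X t + h n)) (g t (X t + h n)) * deriv (f t) (X t + h n)) +
         speed \<theta> (f t (X t)) (g t (X t)) * deriv (f t) (X t + h n)) -
         (1 * (- (a / (1 + t)) * (f t (X t) + g t (X t)) -
         speed \<theta> (f t (X t)) (g t (X t)) * deriv (f t) (X t)) +
         speed \<theta> (f t (X t)) (g t (X t)) * deriv (f t) (X t))) / h n = D n t"
    proof -
      define k where "k = a / (1 + t)"
      have "Qf n t * h n = f t (X t + h n) - f t (X t)" "Qg n t * h n = g t (X t + h n) - g t (X t)"
        using h(1)[of n] by (auto simp: Qf_def Qg_def)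
      then have e: "f t (X t + h n) = f t (X t) + Qf n t * h n" "g t (X t + h n) = g t (X t) + Qg n t * h n"
        by auto
      show ?thesis
        unfolding D_def zh_def[symmetric] e speed_def k_def[symmetric]
        using h(1)[of n] by (simp add: field_simps)
    qed
    finally show "(Qf n has_derivative (*) (D n t)) (at t within S)"
      by (simp add: has_field_derivative_def)
  next
    fix e :: real assume "e > 0"
    from uniform_limitD[OF u this]
    show "\<forall>\<^sub>F n in sequentially. \<forall>t\<in>S. \<forall>h. norm (D n t * h - D' t * h) \<le> e * norm h"
    proof (rule eventually_mono, intro ballI allI)
      fix n t and h :: real assume "\<forall>t\<in>S. dist (D n t) (D' t) < e" "t \<in> S"
      then have "\<bar>D n t - D' t\<bar> \<le> e" by (auto simp: dist_real_def intro: less_imp_le)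
      then show "norm (D n t * h - D' t * h) \<le> e * norm h"
        by (simp add: abs_mult mult_right_mono flip: left_diff_distrib)
    qed
  qed
  then obtain k where k: "\<And>t. t \<in> S \<Longrightarrow> (\<lambda>n. Qf n t) \<longlonglongrightarrow> k t"
     "\<And>t. t \<in> S \<Longrightarrow> (k has_derivative (*) (D' t)) (at t within S)" by blast
  have tS: "t \<in> S" using t by (simp add: S_def)
  have kz: "z t = k t" if "t \<in> S" for t
    using LIMSEQ_unique[OF tendsto_uniform_limitI[OF lims(2) that] k(1)[OF that]] .
  have "(z has_derivative (*) (D' t)) (at t within S)"
    by (rule has_derivative_transform[OF tS kz k(2)[OF tS]])
  then show ?thesis
    unfolding has_field_derivative_def S_def D'_def z_def[abs_def] w_def .
qed

end

section \<open>Riccati inequality and slope bounds\<close>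

text \<open>Along a characteristic of speed \<open>u + c\<close> the derivative of \<open>r\<close> is \<open>- c g\<^sub>x\<close>, so the derivative of
  \<open>weight_primitive r\<close> is \<open>- weight r * g\<^sub>x\<close>. Hence in the equation for \<open>weight r * f\<^sub>x\<close> the integrating factor \<open>weight\<close>
  absorbs the term \<open>f\<^sub>x g\<^sub>x\<close>, and \<open>weight_primitive\<close> the damping term that contains \<open>g\<^sub>x\<close>.\<close>

definition weight :: "real \<Rightarrow> real \<Rightarrow> real" where
  "weight \<theta> r = (1 + \<theta> * r) powr (- (1 - \<theta>) / (2 * \<theta>))"

text \<open>The primitive of \<open>weight \<theta> r / (1 + \<theta> * r)\<close> that vanishes at
  0. For \<open>\<theta> = 1\<close>, that is \<open>\<gamma> = 3\<close>, the weight is constant 1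
  and the primitive is a logarithm.\<close>

definition weight_primitive :: "real \<Rightarrow> real \<Rightarrow> real" where
  "weight_primitive \<theta> r = (if \<theta> = 1 then ln (1 + r) else (1 - weight \<theta> r) * 2 / (1 - \<theta>))"

lemma weight_pos: "1 + \<theta> * r > 0 \<Longrightarrow> weight \<theta> r > 0"
  by (simp add: weight_def)

lemma weight_deriv:
  assumes "\<theta> > 0" "1 + \<theta> * r > 0"
  shows "(weight \<theta> has_real_derivative - (1 - \<theta>) / 2 * weight \<theta> r / (1 + \<theta> * r)) (at r)"
proof -
  define p where "p = - (1 - \<theta>) / (2 * \<theta>)"
  have "((\<lambda>r. (1 + \<theta> * r) powr p) has_real_derivative p * (1 + \<theta> * r) powr (p - 1) * \<theta>) (at r)"
    using assms by (auto intro!: derivative_eq_intros)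
  moreover have "p * (1 + \<theta> * r) powr (p - 1) * \<theta> = - (1 - \<theta>) / 2 * weight \<theta> r / (1 + \<theta> * r)"
  proof -
    have "(1 + \<theta> * r) powr (p - 1) = weight \<theta> r / (1 + \<theta> * r)"
      unfolding weight_def p_def[symmetric] using assms by (simp add: powr_diff)
    moreover have "p * \<theta> = - (1 - \<theta>) / 2" using assms by (simp add: p_def)
    ultimately show ?thesis by (metis (no_types, opaque_lifting) mult.assoc mult.commute times_divide_eq_right)
  qed
  ultimately show ?thesis by (simp add: weight_def[abs_def] p_def)
qed

lemma weight_primitive_deriv:
  assumes "\<theta> > 0" "1 + \<theta> * r > 0"
  shows "(weight_primitive \<theta> has_real_derivative weight \<theta> r / (1 + \<theta> * r)) (at r)"
proof (cases "\<theta> = 1")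
  case True
  have "((\<lambda>r. ln (1 + r)) has_real_derivative 1 / (1 + r)) (at r)"
    using assms True by (auto intro!: derivative_eq_intros)
  moreover have "weight \<theta> r = 1" using True assms by (simp add: weight_def)
  ultimately show ?thesis by (simp add: weight_primitive_def[abs_def] True)
next
  case False
  have "((\<lambda>r. (1 - weight \<theta> r) * 2 / (1 - \<theta>)) has_real_derivative
     (0 - - (1 - \<theta>) / 2 * weight \<theta> r / (1 + \<theta> * r)) * 2 / (1 - \<theta>)) (at r)"
    by (intro DERIV_cdivide DERIV_cmult_right DERIV_diff DERIV_const weight_deriv assms)
  moreover have alg: "(0 - - D / 2 * W / c) * 2 / D = W / c" if "D \<noteq> 0" for D W c :: real
    using that by (cases "c = 0") (simp_all add: field_simps)
  have "(0 - - (1 - \<theta>) / 2 * weight \<theta> r / (1 + \<theta> * r)) * 2 / (1 - \<theta>) = weight \<theta> r / (1 + \<theta> * r)"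
    by (rule alg) (use False in simp)
  ultimately have "((\<lambda>r. (1 - weight \<theta> r) * 2 / (1 - \<theta>)) has_real_derivative weight \<theta> r / (1 + \<theta> * r)) (at r)"
    by (rule DERIV_cong)
  with False show ?thesis by (simp add: weight_primitive_def[abs_def])
qed

lemma weight_primitive_0 [simp]: "weight_primitive \<theta> 0 = 0"
  by (simp add: weight_primitive_def weight_def)

text \<open>At \<open>r = 0\<close> both the weight and the derivative \<open>q\<close> of its
  primitive equal 1, so near 0 each passage between weighted and plain quantities costs a factor
  \<open>1 + e\<close>. The bounds by \<open>r / 2\<close> record that the primitive has the sign of
  \<open>r\<close> and vanishes only at 0.\<close>

lemma small_weights:
  assumes \<theta>: "\<theta> > 0" and e: "e > 0" "e \<le> 1"
  obtains \<eta> where "\<eta> > 0" "(1 + \<theta>) * \<eta> \<le> 1/2"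
    "\<And>r. \<bar>r\<bar> \<le> \<eta> \<Longrightarrow> weight \<theta> r \<le> 1 + e \<and> 1 \<le> (1 + e) * weight \<theta> r"
    "\<And>r. 0 \<le> r \<Longrightarrow> r \<le> \<eta> \<Longrightarrow> r / 2 \<le> weight_primitive \<theta> r \<and> weight_primitive \<theta> r \<le> (1 + e) * r"
    "\<And>r. r \<le> 0 \<Longrightarrow> - \<eta> \<le> r \<Longrightarrow> (1 + e) * r \<le> weight_primitive \<theta> r \<and> weight_primitive \<theta> r \<le> r / 2"
proof -
  define q where "q r = weight \<theta> r / (1 + \<theta> * r)" for r
  have wt0: "isCont (weight \<theta>) 0"
    using weight_deriv[OF \<theta>, of 0] by (auto intro: DERIV_isCont)
  have at0: "isCont (weight \<theta>) 0" "isCont q 0"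
    unfolding q_def by (intro continuous_intros wt0; simp)+
  have "\<forall>\<^sub>F r in nhds 0. weight \<theta> r < 1 + e \<and> 1 / (1 + e) < weight \<theta> r \<and> q r < 1 + e \<and> 1 / 2 < q r"
  proof -
    have *: "(weight \<theta> \<longlongrightarrow> 1) (nhds 0)" "(q \<longlongrightarrow> 1) (nhds 0)"
      using at0 unfolding isCont_def tendsto_at_iff_tendsto_nhds by (simp_all add: weight_def q_def)
    show ?thesis
      using e by (intro eventually_conj order_tendstoD[OF *(1)] order_tendstoD[OF *(2)]) auto
  qed
  then obtain d where d: "d > 0" and small: "\<And>r. \<bar>r\<bar> < d \<Longrightarrow>
     weight \<theta> r < 1 + e \<and> 1 / (1 + e) < weight \<theta> r \<and> q r < 1 + e \<and> 1 / 2 < q r"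
    unfolding eventually_nhds_metric by (auto simp: dist_real_def)
  \<comment> \<open>The first entry keeps \<open>\<bar>r\<bar>\<close> below \<open>d\<close>; the
    second keeps the speeds within \<open>1 / 2\<close> of 1 and the sound speed
    \<open>1 + \<theta> * r\<close> positive.\<close>
  define \<eta> where "\<eta> = min (d / 2) (1 / (2 * (1 + \<theta>)))"
  have \<eta>: "\<eta> > 0" "\<eta> < d" "(1 + \<theta>) * \<eta> \<le> 1/2"
    using d \<theta> by (auto simp: \<eta>_def min_def field_simps)
  have cpos: "1 + \<theta> * r > 0" if "\<bar>r\<bar> \<le> \<eta>" for r
  proof -
    have "\<bar>\<theta> * r\<bar> \<le> (1 + \<theta>) * \<eta>" unfolding abs_mult using \<theta> that by (intro mult_mono) auto
    then show ?thesis using \<eta>(3) by linarith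
  qed
  have pos: "r / 2 \<le> weight_primitive \<theta> r \<and> weight_primitive \<theta> r \<le> (1 + e) * r" if "0 \<le> r" "r \<le> \<eta>" for r
  proof (cases "r = 0")
    case False
    with that have "0 < r" by simp
    from MVT2[OF this, of "weight_primitive \<theta>" q] weight_primitive_deriv[OF \<theta> cpos] that
    obtain s where "0 < s" "s < r" "weight_primitive \<theta> r - weight_primitive \<theta> 0 = (r - 0) * q s" unfolding q_def by force
    moreover have "1 / 2 < q s" "q s < 1 + e" using small[of s] calculation(1,2) that \<eta>(2) by auto
    ultimately show ?thesis using \<open>0 < r\<close> by (simp add: mult.commute[of r])
  qed auto
  have neg: "(1 + e) * r \<le> weight_primitive \<theta> r \<and> weight_primitive \<theta> r \<le> r / 2" if "r \<le> 0" "- \<eta> \<le> r" for r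
  proof (cases "r = 0")
    case False
    with that have "r < 0" by simp
    from MVT2[OF this, of "weight_primitive \<theta>" q] weight_primitive_deriv[OF \<theta> cpos] that
    obtain s where "r < s" "s < 0" "weight_primitive \<theta> 0 - weight_primitive \<theta> r = (0 - r) * q s" unfolding q_def by force
    moreover have "1 / 2 < q s" "q s < 1 + e" using small[of s] calculation(1,2) that \<eta>(2) by auto
    moreover from this have "r * q s \<le> r * (1/2)" "r * (1 + e) \<le> r * q s"
      using \<open>r < 0\<close> by (intro mult_left_mono_neg; simp)+
    ultimately show ?thesis by (simp add: algebra_simps)
  qed auto
  show ?thesis
  proof (rule that[OF \<eta>(1,3) _ pos neg])
    fix r :: real assume "\<bar>r\<bar> \<le> \<eta>"
    then show "weight \<theta> r \<le> 1 + e \<and> 1 \<le> (1 + e) * weight \<theta> r"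
      using small[of r] \<eta>(2) e by (simp add: field_simps)
  qed
qed

text \<open>\<open>Z\<close> stays negative because it decreases. Hence
  \<open>1 / Z - k * ln (1 + t)\<close> is nondecreasing while \<open>1 / Z\<close> stays below 0,
  and the logarithm can grow only by what \<open>- 1 / Z t0\<close> allows.\<close>

lemma Riccati_blowup:
  fixes Z Z' :: "real \<Rightarrow> real"
  assumes t: "0 \<le> t0" "t0 \<le> t1" and k: "k > 0" and neg: "Z t0 < 0"
    and d: "\<And>t. t \<in> {t0..t1} \<Longrightarrow> (Z has_real_derivative Z' t) (at t within {t0..t1})"
    and le: "\<And>t. t \<in> {t0..t1} \<Longrightarrow> Z' t \<le> 0"
    and ricc: "\<And>t. t \<in> {t0..t1} \<Longrightarrow> Z t < 0 \<Longrightarrow> Z' t \<le> - k * (Z t)\<^sup>2 / (1 + t)"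
  shows "k * (ln (1 + t1) - ln (1 + t0)) < - 1 / Z t0"
proof -
  have "Z t \<le> Z t0" if "t \<in> {t0..t1}" for t
  proof (rule DERIV_nonpos_imp_decreasing_open[of t0 t Z])
    show "t0 \<le> t" using that by simp
    show "continuous_on {t0..t} Z"
      by (rule continuous_on_subset[OF DERIV_continuous_on[OF d]]) (use that in auto)
    fix x assume x: "t0 < x" "x < t"
    then have "(Z has_real_derivative Z' x) (at x)"
      using d[of x] that at_within_Icc_at[of t0 x t1] by auto
    with le[of x] x that show "\<exists>y. (Z has_real_derivative y) (at x) \<and> y \<le> 0" by auto
  qed
  then have Zneg: "Z t < 0" if "t \<in> {t0..t1}" for t using that neg by fastforce
  define V where "V t = inverse (Z t) - k * ln (1 + t)" for t
  have Vd: "(V has_real_derivative - (inverse (Z t) * Z' t * inverse (Z t)) - k * (1 / (1 + t))) (at t within {t0..t1})"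
    if "t \<in> {t0..t1}" for t
    unfolding V_def[abs_def]
    by (intro DERIV_diff DERIV_inverse' d that DERIV_cmult)
       (use Zneg[OF that] that t in \<open>auto intro!: derivative_eq_intros\<close>)
  have "V t0 \<le> V t1"
  proof (rule DERIV_nonneg_imp_increasing_open[of t0 t1 V])
    show "continuous_on {t0..t1} V" by (rule DERIV_continuous_on[OF Vd])
    fix x assume x: "t0 < x" "x < t1"
    then have xs: "x \<in> {t0..t1}" by simp
    have "(V has_real_derivative - (inverse (Z x) * Z' x * inverse (Z x)) - k * (1 / (1 + x))) (at x)"
      using Vd[OF xs] at_within_Icc_at[OF x] by simp
    moreover have "Z x < 0" by (rule Zneg[OF xs])
    then have "- (inverse (Z x) * Z' x * inverse (Z x)) = - Z' x / (Z x)\<^sup>2"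
      by (simp add: field_simps power2_eq_square)
    moreover have "k * (1 / (1 + x)) \<le> - Z' x / (Z x)\<^sup>2"
    proof -
      have "k * (Z x)\<^sup>2 / (1 + x) \<le> - Z' x" using ricc[OF xs Zneg[OF xs]] by simp
      then show ?thesis using Zneg[OF xs] by (simp add: field_simps)
    qed
    ultimately show "\<exists>y. (V has_real_derivative y) (at x) \<and> 0 \<le> y" by (intro exI conjI) auto
  qed (use t in auto)
  moreover have "inverse (Z t1) < 0" using Zneg[of t1] t by simp
  ultimately show ?thesis
    unfolding V_def right_diff_distrib divide_inverse by linarith
qed

section \<open>Small global solutions and their Riccati variable\<close>

locale small_global_solution = global_solution +
  fixes e \<eta> :: real
  assumes e: "0 < e" "e \<le> 1" and \<eta>: "\<eta> > 0" "(1 + \<theta>) * \<eta> \<le> 1/2"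
    and weight_small: "\<And>r. \<bar>r\<bar> \<le> \<eta> \<Longrightarrow> weight \<theta> r \<le> 1 + e \<and> 1 \<le> (1 + e) * weight \<theta> r"
    and weight_primitive_nonneg: "\<And>r. 0 \<le> r \<Longrightarrow> r \<le> \<eta> \<Longrightarrow> r / 2 \<le> weight_primitive \<theta> r \<and> weight_primitive \<theta> r \<le> (1 + e) * r"
    and weight_primitive_nonpos: "\<And>r. r \<le> 0 \<Longrightarrow> - \<eta> \<le> r \<Longrightarrow> (1 + e) * r \<le> weight_primitive \<theta> r \<and> weight_primitive \<theta> r \<le> r / 2"
    and small0: "\<And>x. \<bar>f 0 x\<bar> \<le> \<eta> \<and> \<bar>g 0 x\<bar> \<le> \<eta>"
begin

definition r :: "real \<Rightarrow> real \<Rightarrow> real" where "r t x = (f t x - g t x) / 2"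

lemma reflect_small: "small_global_solution \<theta> a R (\<lambda>t x. - g t (- x)) (\<lambda>t x. - f t (- x)) e \<eta>"
  by (intro small_global_solution.intro reflect small_global_solution_axioms.intro)
     (use e \<eta> weight_small weight_primitive_nonneg weight_primitive_nonpos small0 in auto)

lemma sup_mono:
  assumes "0 \<le> t0" "t0 \<le> t" "\<And>x. \<bar>f t0 x\<bar> \<le> N \<and> \<bar>g t0 x\<bar> \<le> N"
  shows "\<bar>f t x\<bar> \<le> N \<and> \<bar>g t x\<bar> \<le> N"
  using riemann_system_sup_bound[OF sys[of "t + 1"] par(1,2) assms(1,2) _ init assms(3)] by simp

lemma small: "t \<ge> 0 \<Longrightarrow> \<bar>f t x\<bar> \<le> \<eta> \<and> \<bar>g t x\<bar> \<le> \<eta>"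
  using sup_mono[OF order_refl _ small0] by blast

lemma r_small: "t \<ge> 0 \<Longrightarrow> \<bar>r t x\<bar> \<le> \<eta>"
  using small[of t x] by (auto simp: r_def)

lemma c_pos:
  assumes "\<bar>s\<bar> \<le> \<eta>" shows "1 + \<theta> * s > 0"
proof -
  have "\<bar>\<theta> * s\<bar> \<le> (1 + \<theta>) * \<eta>" unfolding abs_mult using par assms by (intro mult_mono) auto
  then show ?thesis using \<eta>(2) by linarith
qed

lemma speed_bounds:
  assumes "t \<ge> 0" shows "1/2 \<le> speed \<theta> (f t x) (g t x)"
  using abs_speed_le[OF par(1), of "f t x" \<eta> "g t x"] small[OF assms, of x] \<eta> by auto

lemma r_along_characteristic:
  assumes X: "characteristic s0 s1 X" and s: "0 < s0" and t: "t \<in> {s0..s1}"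
  shows "((\<lambda>t. r t (X t)) has_real_derivative - (1 + \<theta> * r t (X t)) * deriv (g t) (X t)) (at t within {s0..s1})"
proof -
  have t0: "t > 0" using s t by auto
  have Xd: "(X has_real_derivative speed \<theta> (f t (X t)) (g t (X t))) (at t within {s0..s1})"
    using X t unfolding characteristic_def by (blast intro: has_field_derivative_at_within)
  note d = has_partials_curve[OF partials(1)[OF t0] DERIV_ident Xd]
    has_partials_curve[OF partials(2)[OF t0] DERIV_ident Xd]
  show ?thesis
    unfolding r_def
  proof (rule DERIV_cong[OF DERIV_cdivide[OF DERIV_diff[OF d]]])
    define k where "k = a / (1 + t)"
    show "(1 * (- (a / (1 + t)) * (f t (X t) + g t (X t)) - speed \<theta> (f t (X t)) (g t (X t)) * deriv (f t) (X t)) +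
        speed \<theta> (f t (X t)) (g t (X t)) * deriv (f t) (X t) -
        (1 * (- (a / (1 + t)) * (f t (X t) + g t (X t)) + speed \<theta> (- g t (X t)) (- f t (X t)) * deriv (g t) (X t)) +
        speed \<theta> (f t (X t)) (g t (X t)) * deriv (g t) (X t))) / 2 =
        - (1 + \<theta> * ((f t (X t) - g t (X t)) / 2)) * deriv (g t) (X t)"
      unfolding k_def[symmetric] by (simp add: speed_def field_simps)
  qed
qed

text \<open>The Riccati variable: its derivative along a characteristic is at most
  \<open>- C * riccati\<^sup>2 / (1 + t)\<close> as long as \<open>riccati < 0\<close> and \<open>weight_primitive r \<le> G\<close>. Since the integral of \<open>1 / (1 + t)\<close>
  diverges, a global solution has \<open>riccati \<ge> 0\<close>.\<close>

definition riccati :: "real \<Rightarrow> (real \<Rightarrow> real) \<Rightarrow> real \<Rightarrow> real" where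
  "riccati G X t = (1 + t) powr a * (weight \<theta> (r t (X t)) * deriv (f t) (X t))
     + a * (1 + t) powr (a - 1) * (G - weight_primitive \<theta> (r t (X t)))"

text \<open>The factor \<open>(1 + t) powr a\<close> absorbs the damping of the slope itself.
  Besides the square there remains the term from differentiating
  \<open>(1 + t) powr (a - 1)\<close>; it is nonpositive if \<open>a \<le> 1\<close> and
  \<open>G\<close> dominates \<open>weight_primitive\<close>, and it disappears for
  \<open>a = 1\<close>.\<close>

lemma riccati_deriv:
  assumes X: "characteristic s0 s1 X" and s: "0 < s0" and t: "t \<in> {s0..s1}"
  shows "(riccati G X has_real_derivative
     - ((1 + \<theta>) / 2 * (1 + t) powr a * weight \<theta> (r t (X t)) * (deriv (f t) (X t))\<^sup>2)
     - a * (1 - a) * (1 + t) powr (a - 2) * (G - weight_primitive \<theta> (r t (X t)))) (at t within {s0..s1})"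
proof -
  define z where "z = deriv (f t) (X t)"
  define w where "w = deriv (g t) (X t)"
  define q where "q = r t (X t)"
  define P where "P = (1 + t) powr a"
  have t0: "t > 0" using s t by auto
  have c: "1 + \<theta> * q > 0" using c_pos[OF r_small[of t]] t0 by (simp add: q_def)
  note rd = r_along_characteristic[OF X s t, folded q_def w_def]
  have alg: "- (1 - \<theta>) / 2 * W / C * (- C * w) = (1 - \<theta>) / 2 * W * w" "W / C * (- C * w) = - W * w"
    if C: "C \<noteq> 0" for W C
  proof -
    have "W / C * (- C * w) = - W * w" using C by simp
    then show "W / C * (- C * w) = - W * w" .
    have "- (1 - \<theta>) / 2 * W / C * (- C * w) = - (1 - \<theta>) / 2 * (W / C * (- C * w))" by simp
    then show "- (1 - \<theta>) / 2 * W / C * (- C * w) = (1 - \<theta>) / 2 * W * w"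
      unfolding \<open>W / C * (- C * w) = - W * w\<close> by (simp add: algebra_simps)
  qed
  have c0: "1 + \<theta> * q \<noteq> 0" using c by simp
  have "((\<lambda>t. weight \<theta> (r t (X t))) has_real_derivative
      - (1 - \<theta>) / 2 * weight \<theta> q / (1 + \<theta> * q) * (- (1 + \<theta> * q) * w)) (at t within {s0..s1})"
    by (rule DERIV_chain2[where f = "weight \<theta>", OF _ rd]) (use weight_deriv[OF par(1) c] in \<open>simp add: q_def\<close>)
  note Ed = this[unfolded alg(1)[OF c0]]
  have "((\<lambda>t. weight_primitive \<theta> (r t (X t))) has_real_derivative
      weight \<theta> q / (1 + \<theta> * q) * (- (1 + \<theta> * q) * w)) (at t within {s0..s1})"
    by (rule DERIV_chain2[where f = "weight_primitive \<theta>", OF _ rd]) (use weight_primitive_deriv[OF par(1) c] in \<open>simp add: q_def\<close>)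
  note Gd = this[unfolded alg(2)[OF c0]]
  note zd = deriv_along_characteristic[OF X s t, folded z_def w_def]
  have pd: "((\<lambda>t. (1 + t) powr b) has_real_derivative b * (1 + t) powr (b - 1)) (at t within {s0..s1})" for b
    using t0 by (auto intro!: derivative_eq_intros)
  define i where "i = inverse (1 + t)"
  have pw: "(1 + t) powr (a - 1) = P * i" "(1 + t) powr (a - 2) = P * i\<^sup>2"
    "(1 + t) powr (a - 1 - 1) = P * i\<^sup>2" "a / (1 + t) = a * i"
    using t0 by (simp_all add: P_def i_def powr_diff powr_numeral power2_eq_square divide_inverse)
  note d = DERIV_add[OF DERIV_mult[OF pd[of a] DERIV_mult[OF Ed zd]]
     DERIV_mult[OF DERIV_cmult[OF pd[of "a - 1"], of a] DERIV_diff[OF DERIV_const[of G] Gd]]]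
  show ?thesis
    unfolding riccati_def[abs_def]
    apply (rule DERIV_cong[OF d])
    unfolding q_def[symmetric] z_def[symmetric] w_def[symmetric] pw P_def[symmetric]
    by (simp add: field_simps power2_eq_square)
qed

lemma riccati_nonneg:
  assumes t0: "t0 > 0" and G: "\<And>s x. s \<ge> t0 \<Longrightarrow> weight_primitive \<theta> (r s x) \<le> G"
    and X: "\<And>t1. t1 \<ge> t0 \<Longrightarrow> \<exists>X. X t0 = x0 \<and> characteristic t0 t1 X"
  shows "riccati G (\<lambda>_. x0) t0 \<ge> 0"
proof (rule ccontr)
  assume "\<not> riccati G (\<lambda>_. x0) t0 \<ge> 0"
  then have neg: "riccati G (\<lambda>_. x0) t0 < 0" by simp
  define M where "M = - 1 / riccati G (\<lambda>_. x0) t0"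
  \<comment> \<open>Chosen so that \<open>1 / 4 * (ln (1 + t1) - ln (1 + t0))\<close> equals
    \<open>M\<close>, which \<open>Riccati_blowup\<close> excludes with the constant
    \<open>1 / 4\<close>.\<close>
  define t1 where "t1 = (1 + t0) * exp (4 * M) - 1"
  have "M > 0" using neg by (simp add: M_def divide_neg_neg)
  then have "(1 + t0) * 1 \<le> (1 + t0) * exp (4 * M)" using t0 by (intro mult_left_mono) auto
  then have t1: "t0 \<le> t1" by (simp add: t1_def)
  obtain X where X: "X t0 = x0" "characteristic t0 t1 X" using X[OF t1] by blast
  have YX: "riccati G X t0 = riccati G (\<lambda>_. x0) t0" by (simp add: riccati_def X)
  define riccati' where "riccati' t = - ((1 + \<theta>) / 2 * (1 + t) powr a * weight \<theta> (r t (X t)) * (deriv (f t) (X t))\<^sup>2)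
     - a * (1 - a) * (1 + t) powr (a - 2) * (G - weight_primitive \<theta> (r t (X t)))" for t
  have bounds: "riccati' t \<le> - ((1 + \<theta>) / 2 * (1 + t) powr a * weight \<theta> (r t (X t)) * (deriv (f t) (X t))\<^sup>2)"
    "0 < weight \<theta> (r t (X t))" "t > 0" if "t \<in> {t0..t1}" for t
  proof -
    have "0 \<le> a * (1 - a) * (1 + t) powr (a - 2) * (G - weight_primitive \<theta> (r t (X t)))"
      using par G[of t "X t"] that by (intro mult_nonneg_nonneg) auto
    then show "riccati' t \<le> - ((1 + \<theta>) / 2 * (1 + t) powr a * weight \<theta> (r t (X t)) * (deriv (f t) (X t))\<^sup>2)"
      by (simp add: riccati'_def)
    show "t > 0" using that t0 by simp
    then show "0 < weight \<theta> (r t (X t))" by (intro weight_pos c_pos r_small) simp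
  qed
  have "1 / 4 * (ln (1 + t1) - ln (1 + t0)) < - 1 / riccati G X t0"
  proof (rule Riccati_blowup[where Z' = riccati'])
    show "(riccati G X has_real_derivative riccati' t) (at t within {t0..t1})" if "t \<in> {t0..t1}" for t
      unfolding riccati'_def by (rule riccati_deriv[OF X(2) t0 that])
    show "riccati' t \<le> 0" if "t \<in> {t0..t1}" for t
    proof -
      have "0 \<le> (1 + \<theta>) / 2 * (1 + t) powr a * weight \<theta> (r t (X t)) * (deriv (f t) (X t))\<^sup>2"
        using bounds(2)[OF that] par by (intro mult_nonneg_nonneg) auto
      with bounds(1)[OF that] show ?thesis by simp
    qed
    fix t assume t: "t \<in> {t0..t1}" and Yneg: "riccati G X t < 0"
    define P where "P = (1 + t) powr a"
    define E where "E = weight \<theta> (r t (X t))"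
    define z where "z = deriv (f t) (X t)"
    note b = bounds[OF t]
    have P: "0 < P" "P \<le> 1 + t"
      using b(3) par powr_mono[of a 1 "1 + t"] by (auto simp: P_def)
    have E: "0 < E" "E \<le> 2"
      using b(2,3) weight_small[OF r_small[of t "X t"]] e by (auto simp: E_def)
    \<comment> \<open>The second summand of \<open>riccati\<close> is nonnegative, so where
      \<open>riccati\<close> is negative its square is at most that of the first summand
      \<open>P * (E * z)\<close>. The constant \<open>1 / 4\<close> is one half from
      \<open>E \<le> 2\<close> times one half from \<open>(1 + \<theta>) / 2 \<ge> 1 / 2\<close>;
      \<open>P \<le> 1 + t\<close> is where \<open>a \<le> 1\<close> is used.\<close>
    have "0 \<le> a * (1 + t) powr (a - 1) * (G - weight_primitive \<theta> (r t (X t)))"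
      using par G[of t "X t"] t by (intro mult_nonneg_nonneg) auto
    then have "P * (E * z) \<le> riccati G X t" by (simp add: riccati_def P_def E_def z_def)
    then have "(riccati G X t)\<^sup>2 \<le> (P * (E * z))\<^sup>2"
      using Yneg by (simp add: abs_le_square_iff[symmetric])
    also have "\<dots> = (P * E) * (P * E * z\<^sup>2)" by (simp add: power2_eq_square)
    also have "\<dots> \<le> ((1 + t) * 2) * (P * E * z\<^sup>2)"
      using P E b(3) by (intro mult_right_mono mult_mono) auto
    finally have "(riccati G X t)\<^sup>2 / (4 * (1 + t)) \<le> 1 / 2 * (P * E * z\<^sup>2)"
      using b(3) by (simp add: field_simps)
    also have "\<dots> \<le> (1 + \<theta>) / 2 * (P * E * z\<^sup>2)"
      using P E par by (intro mult_right_mono) auto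
    also have "\<dots> = (1 + \<theta>) / 2 * (1 + t) powr a * weight \<theta> (r t (X t)) * (deriv (f t) (X t))\<^sup>2"
      by (simp add: P_def E_def z_def)
    finally have "(riccati G X t)\<^sup>2 / (4 * (1 + t)) \<le> - riccati' t"
      using b(1) by linarith
    then show "riccati' t \<le> - (1 / 4) * (riccati G X t)\<^sup>2 / (1 + t)" by simp
  qed (use t0 t1 neg YX in auto)
  moreover have "ln (1 + t1) - ln (1 + t0) = 4 * M"
    using t0 by (simp add: t1_def ln_mult)
  ultimately show False using YX by (simp add: M_def)
qed

lemma weighted_slope_bound:
  assumes t0: "t0 > 0" and G: "\<And>s x. s \<ge> t0 \<Longrightarrow> weight_primitive \<theta> (r s x) \<le> G"
  shows "weight \<theta> (r t0 x) * deriv (f t0) x \<ge> - (a / (1 + t0)) * (G - weight_primitive \<theta> (r t0 x))"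
proof -
  have "\<exists>X. X t0 = x \<and> characteristic t0 t1 X" if "t1 \<ge> t0" for t1
    using characteristic_exists[OF t0 that, of t0 x] by metis
  from riccati_nonneg[OF t0 G this] have "0 \<le> riccati G (\<lambda>_. x) t0" .
  moreover have "riccati G (\<lambda>_. x) t0 = (1 + t0) powr a * (weight \<theta> (r t0 x) * deriv (f t0) x
      + a / (1 + t0) * (G - weight_primitive \<theta> (r t0 x)))"
    using t0 by (simp add: riccati_def powr_diff field_simps)
  ultimately have "0 \<le> weight \<theta> (r t0 x) * deriv (f t0) x + a / (1 + t0) * (G - weight_primitive \<theta> (r t0 x))"
    using t0 by (simp add: zero_le_mult_iff)
  then show ?thesis by simp
qed

text \<open>\<open>M\<close> must bound \<open>r\<close> at all later times, because the
  characteristic is followed into the future; \<open>m\<close> concerns time \<open>t0\<close>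
  alone. One factor \<open>1 + e\<close> comes from \<open>weight_primitive\<close>, the other from
  removing the weight of the slope.\<close>

lemma deriv_lower_bound:
  assumes t0: "t0 > 0" and M: "\<And>s x. s \<ge> t0 \<Longrightarrow> r s x \<le> M" "M \<ge> 0" and m: "\<And>x. - m \<le> r t0 x" "m \<ge> 0"
  shows "deriv (f t0) x \<ge> - (a / (1 + t0) * (1 + e)\<^sup>2 * (M + m))"
proof -
  define E where "E = weight \<theta> (r t0 x)"
  define K where "K = a / (1 + t0) * ((1 + e) * (M + m))"
  have K: "K \<ge> 0" using par t0 e M(2) m(2) by (simp add: K_def)
  have rs: "\<bar>r s x\<bar> \<le> \<eta>" if "s \<ge> t0" for s x using r_small[of s x] t0 that by simp
  have "weight_primitive \<theta> (r s x) \<le> (1 + e) * M" if "s \<ge> t0" for s x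
  proof (cases "r s x \<ge> 0")
    case True
    then have "weight_primitive \<theta> (r s x) \<le> (1 + e) * r s x" using weight_primitive_nonneg[OF True] rs[OF that, of x] by simp
    also have "\<dots> \<le> (1 + e) * M" using M(1)[OF that] e by simp
    finally show ?thesis .
  next
    case False
    then have "weight_primitive \<theta> (r s x) \<le> r s x / 2" using weight_primitive_nonpos[of "r s x"] rs[OF that, of x] by simp
    also have "\<dots> \<le> (1 + e) * M" using False M(2) e by (smt (verit) divide_nonpos_pos mult_nonneg_nonneg)
    finally show ?thesis .
  qed
  from weighted_slope_bound[OF t0 this]
  have Ez: "E * deriv (f t0) x \<ge> - (a / (1 + t0)) * ((1 + e) * M - weight_primitive \<theta> (r t0 x))" by (simp add: E_def)
  have "weight_primitive \<theta> (r t0 x) \<ge> - ((1 + e) * m)"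
  proof (cases "r t0 x \<ge> 0")
    case True
    then have "0 \<le> weight_primitive \<theta> (r t0 x)" using weight_primitive_nonneg[OF True] rs[of t0 x] by simp
    then show ?thesis using e m(2) by (smt (verit) mult_nonneg_nonneg)
  next
    case False
    then have "(1 + e) * r t0 x \<le> weight_primitive \<theta> (r t0 x)" using weight_primitive_nonpos[of "r t0 x"] rs[of t0 x] by simp
    moreover have "(1 + e) * (- m) \<le> (1 + e) * r t0 x" using m(1)[of x] e by (intro mult_left_mono) auto
    ultimately show ?thesis by simp
  qed
  then have "(1 + e) * M - weight_primitive \<theta> (r t0 x) \<le> (1 + e) * (M + m)" by (simp add: algebra_simps)
  then have "a / (1 + t0) * ((1 + e) * M - weight_primitive \<theta> (r t0 x)) \<le> K"
    unfolding K_def using par t0 by (intro mult_left_mono) auto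
  with Ez have Ez': "- K \<le> E * deriv (f t0) x" by simp
  have E: "E > 0" "1 \<le> (1 + e) * E"
    using weight_pos[OF c_pos[OF rs]] weight_small[OF rs, of t0 x] t0 by (auto simp: E_def)
  show ?thesis
  proof (cases "deriv (f t0) x \<ge> 0")
    case True
    moreover have "0 \<le> a / (1 + t0) * (1 + e)\<^sup>2 * (M + m)" using par t0 M(2) m(2) by simp
    ultimately show ?thesis by linarith
  next
    case False
    then have "1 * (- deriv (f t0) x) \<le> (1 + e) * E * (- deriv (f t0) x)"
      using E(2) by (intro mult_right_mono) auto
    also have "\<dots> = (1 + e) * (- (E * deriv (f t0) x))" by simp
    also have "\<dots> \<le> (1 + e) * K" using Ez' e by (intro mult_left_mono) auto
    also have "\<dots> = a / (1 + t0) * (1 + e)\<^sup>2 * (M + m)"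
      by (simp add: K_def power2_eq_square mult_ac)
    finally show ?thesis by linarith
  qed
qed

interpretation rf: small_global_solution \<theta> a R "\<lambda>t x. - g t (- x)" "\<lambda>t x. - f t (- x)" e \<eta>
  by (rule reflect_small)

lemma r_reflect: "rf.r t x = r t (- x)"
  by (simp add: rf.r_def r_def)

text \<open>The reflection exchanges the roles of \<open>f\<close> and \<open>g\<close> but changes
  \<open>r\<close> only by \<open>x \<mapsto> - x\<close>, so the same \<open>M\<close> and
  \<open>m\<close> serve for both slopes.\<close>

lemma slope_bounds:
  assumes t0: "t0 > 0" and M: "\<And>s x. s \<ge> t0 \<Longrightarrow> r s x \<le> M" "M \<ge> 0" and m: "\<And>x. - m \<le> r t0 x" "m \<ge> 0"
    and B: "B = a / (1 + t0) * (1 + e)\<^sup>2 * (M + m)" and xy: "x \<le> y"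
  shows "f t0 y - f t0 x \<ge> - (B * (y - x))" and "g t0 y - g t0 x \<ge> - (B * (y - x))"
proof -
  have *: "h y - h x \<ge> - (B * (y - x))"
    if d: "\<And>x. (h has_real_derivative h' x) (at x)" "\<And>x. h' x \<ge> - B" for h h'
  proof -
    have "h x + B * x \<le> h y + B * y"
    proof (rule DERIV_nonneg_imp_nondecreasing[OF xy])
      fix s show "\<exists>D. ((\<lambda>x. h x + B * x) has_real_derivative D) (at s) \<and> 0 \<le> D"
        by (intro exI[of _ "h' s + B * 1"] conjI DERIV_add d DERIV_cmult DERIV_ident) (use d(2)[of s] in simp)
    qed
    then show ?thesis by (simp add: algebra_simps)
  qed
  have gd: "deriv (g t0) x \<ge> - B" for x
    using rf.deriv_lower_bound[OF t0, of M m "- x"] M m unfolding B r_reflect by (simp add: deriv_reflect)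
  show "f t0 y - f t0 x \<ge> - (B * (y - x))"
    by (rule *[OF has_partials_dx[OF partials(1)[OF t0]]]) (use deriv_lower_bound[OF t0 M m] B in simp)
  show "g t0 y - g t0 x \<ge> - (B * (y - x))"
    by (rule *[OF has_partials_dx[OF partials(2)[OF t0]]]) (rule gd)
qed

section \<open>Triviality below the critical damping\<close>

lemma continuous_on_r: "t \<ge> 0 \<Longrightarrow> continuous_on A (r t)"
proof -
  assume "t \<ge> 0"
  have *: "continuous_on A (h t)" if "continuous_on ({0..} \<times> UNIV) (\<lambda>(t, x). h t x)" for h :: "real \<Rightarrow> real \<Rightarrow> real"
  proof -
    have "continuous_on A (\<lambda>x. (t, x))" by (intro continuous_intros)
    from continuous_on_compose2[OF that this] \<open>t \<ge> 0\<close> show ?thesis by (simp add: image_subset_iff)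
  qed
  show "continuous_on A (r t)"
    unfolding r_def by (intro continuous_intros *[OF continuous(1)] *[OF continuous(2)]) auto
qed

text \<open>By the slope bounds, \<open>u\<close> grows over an interval of length \<open>l\<close> by at least the oscillation of \<open>r\<close>
  minus \<open>B l\<close>. As \<open>u\<close> and \<open>r\<close> vanish at both ends of an interval of length about \<open>2 (1 + t)\<close>, the
  oscillation of \<open>r\<close> is at most about \<open>a\<close> times itself.\<close>

theorem trivial_if_below_critical:
  assumes crit: "a * (1 + e) ^ 4 < 1"
  shows "f 0 x = 0 \<and> g 0 x = 0"
proof -
  \<comment> \<open>From this time on \<open>R\<close> is at most \<open>e * (1 + t)\<close>, so the
    half-length \<open>K\<close> of the support is at most \<open>(1 + e) * (1 + t)\<close>.\<close>
  define T0 where "T0 = R / e"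
  have T0: "T0 > 0" using par e by (simp add: T0_def)
  define A where "A = {max 0 (r s x) | s x. s \<ge> T0}"
  define M where "M = Sup A"
  have bdd: "bdd_above A"
    by (rule bdd_aboveI[of _ \<eta>]) (use r_small T0 \<eta> in \<open>auto simp: A_def abs_le_iff\<close>)
  have A0: "A \<noteq> {}" unfolding A_def by blast
  have Mup: "max 0 (r s x) \<le> M" if "s \<ge> T0" for s x
    unfolding M_def by (rule cSup_upper[OF _ bdd]) (use that in \<open>auto simp: A_def\<close>)
  have M0: "M \<ge> 0" using Mup[of T0 0] by simp
  \<comment> \<open>The slope bound at a given time involves the supremum of \<open>r\<close> over
    the whole future. The time \<open>s1\<close> is one at which \<open>r\<close> itself nearly
    attains that supremum, up to the factor \<open>1 + e\<close>; only then can the bound be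
    compared with the oscillation at \<open>s1\<close>.\<close>
  obtain s1 y1 where s1: "s1 \<ge> T0" and y1: "M \<le> (1 + e) * max 0 (r s1 y1)"
  proof (cases "M = 0")
    case True
    then show ?thesis using that[of T0 0] e by simp
  next
    case False
    then have "M / (1 + e) < Sup A" using M0 e unfolding M_def[symmetric] by (simp add: field_simps)
    then obtain z where "z \<in> A" "M / (1 + e) < z" using less_cSup_iff[OF A0 bdd] by blast
    then obtain s x where sx: "s \<ge> T0" "M / (1 + e) < max 0 (r s x)" by (auto simp: A_def)
    then have "M < max 0 (r s x) * (1 + e)" using e by (simp only: pos_divide_less_eq)
    then show ?thesis using that[OF sx(1), of x] by (simp add: mult.commute)
  qed
  have s1pos: "s1 > 0" "s1 \<ge> 0" using s1 T0 by auto
  define K where "K = R + s1 + 1"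
  have K: "K > 0" using par s1pos by (simp add: K_def)
  have out: "f s1 x = 0 \<and> g s1 x = 0 \<and> r s1 x = 0" if "\<bar>x\<bar> \<ge> K" for x
    using support(1,2)[of s1 x] that s1pos by (auto simp: K_def r_def)
  obtain x1 where x1: "\<bar>x1\<bar> \<le> K" "0 \<le> r s1 x1" "M \<le> (1 + e) * r s1 x1"
  proof (cases "r s1 y1 > 0")
    case True
    then have "\<bar>y1\<bar> < K" using out[of y1] by force
    with True y1 show ?thesis using that[of y1] by simp
  next
    case False
    with y1 have "M \<le> 0" by simp
    then show ?thesis using that[of K] out[of K] K by simp
  qed
  obtain x2 where x2: "x2 \<in> {- K..K}" "\<And>x. x \<in> {- K..K} \<Longrightarrow> r s1 x2 \<le> r s1 x"
    using continuous_attains_inf[of "{- K..K}" "r s1"] continuous_on_r[OF s1pos(2)] K by (metis atLeastAtMost_iff compact_Icc empty_iff less_le neg_le_0_iff_le order_trans)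
  define m where "m = - r s1 x2"
  have m0: "m \<ge> 0" using x2(2)[of K] out[of K] K by (simp add: m_def)
  have m: "- m \<le> r s1 x" for x
  proof (cases "x \<in> {- K..K}")
    case True
    then show ?thesis using x2(2) by (simp add: m_def)
  next
    case False
    then have "\<bar>x\<bar> \<ge> K" by auto
    then show ?thesis using out m0 by simp
  qed
  define B where "B = a / (1 + s1) * (1 + e)\<^sup>2 * (M + m)"
  have rM: "r s x \<le> M" if "s \<ge> s1" for s x using Mup[of s x] that s1 by simp
  have slope: "f s1 y - f s1 x \<ge> - (B * (y - x))" "g s1 y - g s1 x \<ge> - (B * (y - x))" if "x \<le> y" for x y
    by (rule slope_bounds[OF s1pos(1) _ M0 m m0 B_def that], erule rM)+
  define u where "u x = (f s1 x + g s1 x) / 2" for x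
  have step: "u y - u x \<ge> \<bar>r s1 y - r s1 x\<bar> - B * (y - x)" if "x \<le> y" for x y
  proof -
    define p q where "p = f s1 y - f s1 x" and "q = g s1 y - g s1 x"
    define d where "d = B * (y - x)"
    have "p \<ge> - d" "q \<ge> - d" using slope[OF that] by (simp_all add: p_def q_def d_def)
    then have "\<bar>(p - q) / 2\<bar> \<le> (p + q) / 2 + d" by (intro abs_leI) (simp_all add: field_simps)
    moreover have "u y - u x = (p + q) / 2" "r s1 y - r s1 x = (p - q) / 2"
      by (simp_all add: u_def r_def p_def q_def field_simps)
    ultimately have "\<bar>r s1 y - r s1 x\<bar> \<le> u y - u x + d" by presburger
    then show ?thesis by (simp add: d_def)
  qed
  have u0: "u K = 0" "u (- K) = 0" using out[of K] out[of "- K"] K by (auto simp: u_def)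
  have r0: "r s1 K = 0" "r s1 (- K) = 0" using out[of K] out[of "- K"] K by auto
  \<comment> \<open>The points \<open>x1\<close> and \<open>x2\<close> cut \<open>{- K..K}\<close>
    into three intervals on which \<open>r\<close> changes by \<open>r s1 x1\<close>,
    \<open>m\<close> and \<open>r s1 x1 + m\<close> in some order. Summing \<open>step\<close> over
    them leaves nothing of \<open>u\<close>, which vanishes at both ends.\<close>
  have "2 * (r s1 x1 + m) \<le> B * (2 * K)"
  proof (cases "x1 \<le> x2")
    case True
    have "\<bar>r s1 x1 - r s1 (- K)\<bar> - B * (x1 - - K) \<le> u x1 - u (- K)" using x1 by (intro step) auto
    moreover have "\<bar>r s1 x2 - r s1 x1\<bar> - B * (x2 - x1) \<le> u x2 - u x1" using True by (intro step)
    moreover have "\<bar>r s1 K - r s1 x2\<bar> - B * (K - x2) \<le> u K - u x2" using x2 by (intro step) auto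
    ultimately show ?thesis using u0 r0 x1(2) m0 by (simp add: m_def algebra_simps abs_if split: if_splits)
  next
    case False
    have "\<bar>r s1 x2 - r s1 (- K)\<bar> - B * (x2 - - K) \<le> u x2 - u (- K)" using x2 by (intro step) auto
    moreover have "\<bar>r s1 x1 - r s1 x2\<bar> - B * (x1 - x2) \<le> u x1 - u x2" using False by (intro step) auto
    moreover have "\<bar>r s1 K - r s1 x1\<bar> - B * (K - x1) \<le> u K - u x1" using x1 by (intro step) auto
    ultimately show ?thesis using u0 r0 x1(2) m0 by (simp add: m_def algebra_simps abs_if split: if_splits)
  qed
  then have "r s1 x1 + m \<le> B * K" by simp
  also have "B * K = a * (1 + e)\<^sup>2 * (M + m) * (K / (1 + s1))" by (simp add: B_def)
  \<comment> \<open>Here the four factors \<open>1 + e\<close> meet: two from the slope bound, one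
    from the choice of \<open>s1\<close>, one from the length of the support.\<close>
  also have "\<dots> \<le> a * (1 + e)\<^sup>2 * ((1 + e) * (r s1 x1 + m)) * (1 + e)"
  proof (intro mult_mono mult_left_mono)
    show "M + m \<le> (1 + e) * (r s1 x1 + m)"
      using x1(3) mult_nonneg_nonneg[OF less_imp_le[OF e(1)] m0] by (simp add: algebra_simps)
    have "R \<le> e * (1 + s1)"
      using s1 e by (simp add: T0_def field_simps)
    then show "K / (1 + s1) \<le> 1 + e" using s1pos by (simp add: K_def field_simps)
  qed (use par e m0 M0 x1 K s1pos in auto)
  also have "\<dots> = (a * (1 + e) ^ 4) * (r s1 x1 + m)" by (simp add: power2_eq_square power4_eq_xxxx)
  finally have "(1 - a * (1 + e) ^ 4) * (r s1 x1 + m) \<le> 0" by (simp add: algebra_simps)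
  then have "r s1 x1 + m \<le> 0" using crit by (simp add: mult_le_0_iff)
  then have "r s1 x1 = 0" and zero: "m = 0" using x1(2) m0 by auto
  with x1(3) M0 have "M = 0" by simp
  with zero have B0: "B = 0" by (simp add: B_def)
  \<comment> \<open>With \<open>B = 0\<close> both invariants are nondecreasing, and they vanish at
    both ends.\<close>
  have "f s1 x = 0 \<and> g s1 x = 0" for x
  proof (cases "\<bar>x\<bar> \<ge> K")
    case False
    then have "- K \<le> x" "x \<le> K" by auto
    from slope[OF this(1)] slope[OF this(2)] out[of K] out[of "- K"] K B0
    show ?thesis by simp
  qed (use out in blast)
  then show ?thesis
    using riemann_system_backward_zero[OF sys[of "s1 + 1"] par(1,2) s1pos(1) _ init] by simp
qed

end

section \<open>The critical damping\<close>

definition dens :: "real \<Rightarrow> real \<Rightarrow> real" where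
  "dens \<theta> r = (1 + \<theta> * r) powr (1 / \<theta>)"

text \<open>With \<open>\<gamma> = 2 * \<theta> + 1\<close> and
  \<open>\<rho> = dens \<theta> r\<close> this is \<open>(\<rho> powr \<gamma> - 1 - \<gamma> *
  (\<rho> - 1)) / (\<gamma> * (\<gamma> - 1))\<close>, the potential energy relative to the rest
  state. Without its linear part it is quadratic near \<open>r = 0\<close>.\<close>

definition internal_energy :: "real \<Rightarrow> real \<Rightarrow> real" where
  "internal_energy \<theta> r = (dens \<theta> r * (1 + \<theta> * r)\<^sup>2 - 1 - (2 * \<theta> + 1) * (dens \<theta> r - 1)) / ((2 * \<theta> + 1) * (2 * \<theta>))"

lemma dens_deriv:
  assumes "\<theta> > 0" "1 + \<theta> * r > 0"
  shows "(dens \<theta> has_real_derivative dens \<theta> r / (1 + \<theta> * r)) (at r)"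
proof -
  have "((\<lambda>r. (1 + \<theta> * r) powr (1 / \<theta>)) has_real_derivative (1 / \<theta>) * (1 + \<theta> * r) powr (1 / \<theta> - 1) * \<theta>) (at r)"
    using assms by (auto intro!: derivative_eq_intros)
  then show ?thesis
    using assms by (simp add: dens_def[abs_def] powr_diff)
qed

text \<open>The factor \<open>r + \<theta> * r\<^sup>2 / 2\<close> is
  \<open>((1 + \<theta> * r)\<^sup>2 - 1) / (2 * \<theta>)\<close>, the enthalpy relative to the
  rest state; the other factor is the derivative of the density.\<close>

lemma internal_energy_deriv:
  assumes "\<theta> > 0" "1 + \<theta> * r > 0"
  shows "(internal_energy \<theta> has_real_derivative dens \<theta> r / (1 + \<theta> * r) * (r + \<theta> * r\<^sup>2 / 2)) (at r)"
proof -
  define c where "c = 1 + \<theta> * r"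
  define D where "D = dens \<theta> r / c"
  have Dc: "dens \<theta> r = D * c" using assms by (simp add: D_def c_def)
  note d = dens_deriv[OF assms, folded c_def D_def]
  have cd: "((\<lambda>r. (1 + \<theta> * r)\<^sup>2) has_real_derivative 2 * \<theta> * c) (at r)"
    by (auto intro!: derivative_eq_intros simp: c_def)
  have "(internal_energy \<theta> has_real_derivative
     ((D * c\<^sup>2 + 2 * \<theta> * c * dens \<theta> r - 0) - (2 * \<theta> + 1) * (D - 0)) / ((2 * \<theta> + 1) * (2 * \<theta>))) (at r)"
    unfolding internal_energy_def[abs_def]
    by (rule DERIV_cong[OF DERIV_cdivide[OF DERIV_diff[OF DERIV_diff[OF DERIV_mult[OF d cd] DERIV_const[of 1]]
       DERIV_cmult[OF DERIV_diff[OF d DERIV_const[of 1]], of "2 * \<theta> + 1"]], of "(2 * \<theta> + 1) * (2 * \<theta>)"]])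
       (simp only: D_def c_def)
  moreover have "((D * c\<^sup>2 + 2 * \<theta> * c * dens \<theta> r - 0) - (2 * \<theta> + 1) * (D - 0)) / ((2 * \<theta> + 1) * (2 * \<theta>))
      = D * (r + \<theta> * r\<^sup>2 / 2)"
  proof -
    have "D * c\<^sup>2 + 2 * \<theta> * c * dens \<theta> r - (2 * \<theta> + 1) * D = D * ((2 * \<theta> + 1) * (c\<^sup>2 - 1))"
      by (simp add: Dc power2_eq_square algebra_simps)
    also have "c\<^sup>2 - 1 = 2 * \<theta> * (r + \<theta> * r\<^sup>2 / 2)"
      by (simp add: c_def power2_eq_square algebra_simps)
    finally show ?thesis using assms by simp
  qed
  ultimately show ?thesis by (simp add: D_def c_def)
qed

lemma internal_energy_0 [simp]: "internal_energy \<theta> 0 = 0" and dens_0 [simp]: "dens \<theta> 0 = 1"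
  by (simp_all add: internal_energy_def dens_def)

text \<open>The derivative of \<open>internal_energy\<close> is \<open>r * q r\<close> with
  \<open>q\<close> tending to 1 at 0, so subtracting \<open>r\<^sup>2 / 4\<close> leaves a function
  whose derivative still has the sign of \<open>r\<close> and whose minimum near 0 is therefore the
  value 0 at \<open>r = 0\<close>.\<close>

lemma small_energy:
  assumes \<theta>: "\<theta> > 0"
  obtains \<eta> where "\<eta> > 0" "\<And>r. \<bar>r\<bar> \<le> \<eta> \<Longrightarrow> 1/2 \<le> dens \<theta> r \<and> r\<^sup>2 / 4 \<le> internal_energy \<theta> r"
proof -
  define q where "q r = dens \<theta> r / (1 + \<theta> * r) * (1 + \<theta> * r / 2)" for r
  have d0: "isCont (dens \<theta>) 0" using dens_deriv[OF \<theta>, of 0] by (auto intro: DERIV_isCont)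
  have q0: "isCont q 0" unfolding q_def by (intro continuous_intros d0) simp_all
  have "((\<lambda>r. 1 + \<theta> * r) \<longlongrightarrow> 1 + \<theta> * 0) (nhds 0)"
    by (intro tendsto_intros filterlim_ident)
  then have c0: "((\<lambda>r. 1 + \<theta> * r) \<longlongrightarrow> 1) (nhds 0)" by simp
  have *: "(dens \<theta> \<longlongrightarrow> 1) (nhds 0)" "(q \<longlongrightarrow> 1) (nhds 0)"
    using d0 q0 unfolding isCont_def tendsto_at_iff_tendsto_nhds by (simp_all add: q_def)
  have "\<forall>\<^sub>F r in nhds 0. 1/2 < dens \<theta> r \<and> 1/2 < q r \<and> 0 < 1 + \<theta> * r"
    using order_tendstoD(1)[OF *(1), of "1/2"] order_tendstoD(1)[OF *(2), of "1/2"] order_tendstoD(1)[OF c0, of 0]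
    by (simp add: eventually_conj_iff)
  then obtain d where d: "d > 0" and small: "\<And>r. \<bar>r\<bar> < d \<Longrightarrow> 1/2 < dens \<theta> r \<and> 1/2 < q r \<and> 0 < 1 + \<theta> * r"
    unfolding eventually_nhds_metric by (auto simp: dist_real_def)
  define k where "k r = internal_energy \<theta> r - r\<^sup>2 / 4" for r
  have kd: "(k has_real_derivative r * (q r - 1/2)) (at r)" if "\<bar>r\<bar> < d" for r
  proof -
    have "((\<lambda>r. r\<^sup>2 / 4) has_real_derivative r / 2) (at r)" by (auto intro!: derivative_eq_intros)
    moreover have "0 < 1 + \<theta> * r" using small[OF that] by simp
    note internal_energy_deriv[OF \<theta> this]
    ultimately have d: "(k has_real_derivative dens \<theta> r / (1 + \<theta> * r) * (r + \<theta> * r\<^sup>2 / 2) - r / 2) (at r)"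
      unfolding k_def[abs_def] by (intro DERIV_diff)
    have alg: "W * (r + \<theta> * r\<^sup>2 / 2) - r / 2 = r * (W * (1 + \<theta> * r / 2) - 1 / 2)" for W
      by (simp add: power2_eq_square algebra_simps)
    show ?thesis unfolding q_def by (rule DERIV_cong[OF d alg])
  qed
  have "k r \<ge> 0" if "\<bar>r\<bar> < d" for r
  proof (cases r "0 :: real" rule: linorder_cases)
    case equal
    then show ?thesis by (simp add: k_def)
  next
    case greater
    from MVT2[OF this, of k "\<lambda>s. s * (q s - 1/2)"] kd that
    obtain s where s: "0 < s" "s < r" "k r - k 0 = (r - 0) * (s * (q s - 1/2))" by force
    moreover have "0 \<le> (r - 0) * (s * (q s - 1/2))"
      using small[of s] s(1,2) that by (intro mult_nonneg_nonneg) auto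
    ultimately show ?thesis by (simp add: k_def)
  next
    case less
    from MVT2[OF this, of k "\<lambda>s. s * (q s - 1/2)"] kd that
    obtain s where s: "r < s" "s < 0" "k 0 - k r = (0 - r) * (s * (q s - 1/2))" by force
    moreover have "(0 - r) * (s * (q s - 1/2)) \<le> 0"
      using small[of s] s(1,2) that by (intro mult_nonneg_nonpos mult_nonpos_nonneg) auto
    ultimately show ?thesis by (simp add: k_def)
  qed
  note k = this
  show ?thesis
  proof (rule that[of "d / 2"])
    fix r :: real assume "\<bar>r\<bar> \<le> d / 2"
    then have "\<bar>r\<bar> < d" using d by simp
    from k[OF this] small[OF this] show "1/2 \<le> dens \<theta> r \<and> r\<^sup>2 / 4 \<le> internal_energy \<theta> r"
      by (simp add: k_def)
  qed (use d in simp)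
qed

section \<open>Energy balance and decay at the critical damping\<close>

locale critical_solution = small_global_solution +
  assumes a1: "a = 1"
    and energy_small: "\<And>r. \<bar>r\<bar> \<le> \<eta> \<Longrightarrow> 1/2 \<le> dens \<theta> r \<and> r\<^sup>2 / 4 \<le> internal_energy \<theta> r"
begin

definition energy :: "real \<Rightarrow> real \<Rightarrow> real" where
  "energy t x = dens \<theta> (r t x) * ((f t x + g t x) / 2)\<^sup>2 / 2 + internal_energy \<theta> (r t x)"

definition flux :: "real \<Rightarrow> real \<Rightarrow> real" where
  "flux t x = dens \<theta> (r t x) * ((f t x + g t x) / 2) *
     (((f t x + g t x) / 2)\<^sup>2 / 2 + (r t x + \<theta> * (r t x)\<^sup>2 / 2))"

text \<open>The derivative of the flux in closed form, so that its joint continuity in time and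
  space can be read off. \<open>D\<close> is the derivative of the density with respect to
  \<open>r\<close>.\<close>

definition flux_dx :: "real \<Rightarrow> real \<Rightarrow> real" where
  "flux_dx t x = (let D = dens \<theta> (r t x) / (1 + \<theta> * r t x); u = (f t x + g t x) / 2; s = r t x;
      ux = (deriv (f t) x + deriv (g t) x) / 2; rx = (deriv (f t) x - deriv (g t) x) / 2 in
    D * rx * u * (u\<^sup>2 / 2 + (s + \<theta> * s\<^sup>2 / 2)) + D * (1 + \<theta> * s) * ux * (u\<^sup>2 / 2 + (s + \<theta> * s\<^sup>2 / 2))
     + D * (1 + \<theta> * s) * u * (u * ux + (1 + \<theta> * s) * rx))"

definition dissipation :: "real \<Rightarrow> real \<Rightarrow> real" where
  "dissipation t x = 2 * a / (1 + t) * dens \<theta> (r t x) * ((f t x + g t x) / 2)\<^sup>2"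

lemma flux_deriv:
  assumes "t > 0"
  shows "(flux t has_real_derivative flux_dx t x) (at x)"
proof -
  define D where "D = dens \<theta> (r t x) / (1 + \<theta> * r t x)"
  have c: "1 + \<theta> * r t x > 0" using c_pos[OF r_small[of t x]] assms by simp
  then have Dc: "dens \<theta> (r t x) = D * (1 + \<theta> * r t x)" by (simp add: D_def)
  note fx = has_partials_dx[OF partials(1)[OF assms, of x]] and gx = has_partials_dx[OF partials(2)[OF assms, of x]]
  define ux rx where "ux = (deriv (f t) x + deriv (g t) x) / 2" and "rx = (deriv (f t) x - deriv (g t) x) / 2"
  define U where "U x = (f t x + g t x) / 2" for x
  have ud: "(U has_real_derivative ux) (at x)"
    unfolding U_def[abs_def] ux_def by (intro DERIV_cdivide DERIV_add fx gx)
  have rd: "(r t has_real_derivative rx) (at x)"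
    unfolding r_def[abs_def] rx_def by (intro DERIV_cdivide DERIV_diff fx gx)
  have dd: "((\<lambda>x. dens \<theta> (r t x)) has_real_derivative D * rx) (at x)"
    unfolding D_def by (rule DERIV_chain2[OF dens_deriv[OF par(1) c] rd])
  have fd: "flux_dx t x = D * rx * U x * ((U x)\<^sup>2 / 2 + (r t x + \<theta> * (r t x)\<^sup>2 / 2))
     + D * (1 + \<theta> * r t x) * ux * ((U x)\<^sup>2 / 2 + (r t x + \<theta> * (r t x)\<^sup>2 / 2))
     + D * (1 + \<theta> * r t x) * U x * (U x * ux + (1 + \<theta> * r t x) * rx)"
    unfolding flux_dx_def Let_def D_def U_def rx_def ux_def by (rule refl)
  note d = DERIV_mult[OF DERIV_mult[OF dd ud]
     DERIV_add[OF DERIV_cdivide[OF DERIV_power[OF ud, of 2], of 2]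
       DERIV_add[OF rd DERIV_cdivide[OF DERIV_cmult[OF DERIV_power[OF rd, of 2], of \<theta>], of 2]]]]
  show ?thesis
    unfolding flux_def[abs_def] U_def[symmetric]
    by (rule DERIV_cong[OF d]) (simp add: fd Dc power2_eq_square field_simps)
qed

text \<open>The damping cancels in \<open>r\<close> and acts on \<open>u\<close> at rate
  \<open>2 * a / (1 + t)\<close>, so what the energy balance loses besides the flux is that rate
  times \<open>\<rho> * u\<^sup>2\<close>.\<close>

lemma energy_deriv:
  assumes "t > 0"
  shows "((\<lambda>t. energy t x) has_real_derivative - flux_dx t x - dissipation t x) (at t)"
proof -
  define D where "D = dens \<theta> (r t x) / (1 + \<theta> * r t x)"
  define k where "k = a / (1 + t)"
  have c: "1 + \<theta> * r t x > 0" using c_pos[OF r_small[of t x]] assms by simp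
  then have Dc: "dens \<theta> (r t x) = D * (1 + \<theta> * r t x)" by (simp add: D_def)
  define z w where "z = deriv (f t) x" and "w = deriv (g t) x"
  define U where "U t = (f t x + g t x) / 2" for t
  have fg: "f t x = U t + r t x" "g t x = U t - r t x" by (simp_all add: U_def r_def field_simps)
  note ft = has_partials_dt[OF partials(1)[OF assms, of x]] and gt = has_partials_dt[OF partials(2)[OF assms, of x]]
  have ud: "(U has_real_derivative - 2 * k * U t - U t * ((z + w) / 2) - (1 + \<theta> * r t x) * ((z - w) / 2)) (at t)"
    unfolding U_def[abs_def]
    by (rule DERIV_cong[OF DERIV_cdivide[OF DERIV_add[OF ft gt]]])
       (simp add: fg z_def[symmetric] w_def[symmetric] k_def[symmetric] speed_def field_simps)
  have rd: "((\<lambda>t. r t x) has_real_derivative - U t * ((z - w) / 2) - (1 + \<theta> * r t x) * ((z + w) / 2)) (at t)"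
    unfolding r_def[of _ x, abs_def]
    by (rule DERIV_cong[OF DERIV_cdivide[OF DERIV_diff[OF ft gt]]])
       (simp add: fg z_def[symmetric] w_def[symmetric] k_def[symmetric] speed_def field_simps)
  have dd: "((\<lambda>t. dens \<theta> (r t x)) has_real_derivative D * (- U t * ((z - w) / 2) - (1 + \<theta> * r t x) * ((z + w) / 2))) (at t)"
    unfolding D_def by (rule DERIV_chain2[where f = "dens \<theta>" and g = "\<lambda>t. r t x", OF dens_deriv[OF par(1) c] rd])
  have id: "((\<lambda>t. internal_energy \<theta> (r t x)) has_real_derivative D * (r t x + \<theta> * (r t x)\<^sup>2 / 2) *
      (- U t * ((z - w) / 2) - (1 + \<theta> * r t x) * ((z + w) / 2))) (at t)"
    unfolding D_def
    by (rule DERIV_chain2[where f = "internal_energy \<theta>" and g = "\<lambda>t. r t x", OF internal_energy_deriv[OF par(1) c] rd])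
  define ux rx where "ux = (z + w) / 2" and "rx = (z - w) / 2"
  have fd: "flux_dx t x = D * rx * U t * ((U t)\<^sup>2 / 2 + (r t x + \<theta> * (r t x)\<^sup>2 / 2))
     + D * (1 + \<theta> * r t x) * ux * ((U t)\<^sup>2 / 2 + (r t x + \<theta> * (r t x)\<^sup>2 / 2))
     + D * (1 + \<theta> * r t x) * U t * (U t * ux + (1 + \<theta> * r t x) * rx)"
    unfolding flux_dx_def Let_def D_def U_def rx_def ux_def z_def w_def by (rule refl)
  have dis: "dissipation t x = 2 * k * (D * (1 + \<theta> * r t x)) * (U t)\<^sup>2"
    unfolding dissipation_def Dc U_def k_def by simp
  note ud = ud[folded ux_def rx_def] and dd = dd[folded ux_def rx_def] and id = id[folded ux_def rx_def]
  note d = DERIV_add[OF DERIV_cdivide[OF DERIV_mult[OF dd DERIV_power[OF ud, of 2]], of 2] id]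
  show ?thesis
    unfolding energy_def U_def[symmetric]
    by (rule DERIV_cong[OF d])
       (simp add: fd dis Dc power2_eq_square field_simps)
qed

lemma energy_lower: 
  assumes "t \<ge> 0" shows "(f t x)\<^sup>2 / 8 \<le> energy t x" "(g t x)\<^sup>2 / 8 \<le> energy t x" "0 \<le> energy t x"
proof -
  define U where "U = (f t x + g t x) / 2"
  have "1/2 * U\<^sup>2 \<le> dens \<theta> (r t x) * U\<^sup>2"
    using energy_small[OF r_small[OF assms]] by (intro mult_right_mono) auto
  then have *: "U\<^sup>2 / 4 + (r t x)\<^sup>2 / 4 \<le> energy t x"
    using energy_small[OF r_small[OF assms, of x]] by (simp add: energy_def U_def[symmetric])
  have fg: "f t x = U + r t x" "g t x = U - r t x" by (simp_all add: U_def r_def field_simps)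
  have "(U + r t x)\<^sup>2 \<le> 2 * U\<^sup>2 + 2 * (r t x)\<^sup>2" "(U - r t x)\<^sup>2 \<le> 2 * U\<^sup>2 + 2 * (r t x)\<^sup>2"
    using zero_le_power2[of "U - r t x"] zero_le_power2[of "U + r t x"]
    by (auto simp: power2_eq_square algebra_simps)
  with * show "(f t x)\<^sup>2 / 8 \<le> energy t x" "(g t x)\<^sup>2 / 8 \<le> energy t x" by (simp_all add: fg)
  then show "0 \<le> energy t x" using zero_le_power2[of "f t x"] by linarith
qed

lemma continuous_pair:
  shows "continuous_on ({0..} \<times> UNIV) (\<lambda>z. energy (fst z) (snd z))"
    and "continuous_on ({0..} \<times> UNIV) (\<lambda>z. flux_dx (fst z) (snd z))"
    and "continuous_on ({0..} \<times> UNIV) (\<lambda>z. dissipation (fst z) (snd z))"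
proof -
  note c = continuous[unfolded case_prod_unfold]
  have rc: "continuous_on ({0..} \<times> UNIV) (\<lambda>z. r (fst z) (snd z))"
    unfolding r_def by (intro continuous_intros c) auto
  have pos: "1 + \<theta> * r (fst z) (snd z) \<noteq> 0" "1 + \<theta> * r (fst z) (snd z) > 0" if "z \<in> {0..} \<times> UNIV" for z
    using c_pos[OF r_small[of "fst z" "snd z"]] that by (auto simp: mem_Times_iff)
  have dc: "continuous_on ({0..} \<times> UNIV) (\<lambda>z. dens \<theta> (r (fst z) (snd z)))"
    unfolding dens_def by (intro continuous_intros rc) (use pos in auto)
  show "continuous_on ({0..} \<times> UNIV) (\<lambda>z. energy (fst z) (snd z))"
    unfolding energy_def internal_energy_def by (intro continuous_intros rc c dc) (use par in auto)
  show "continuous_on ({0..} \<times> UNIV) (\<lambda>z. flux_dx (fst z) (snd z))"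
    unfolding flux_dx_def Let_def by (intro continuous_intros rc c dc) (use pos in auto)
  show "continuous_on ({0..} \<times> UNIV) (\<lambda>z. dissipation (fst z) (snd z))"
    unfolding dissipation_def by (intro continuous_intros rc c dc) (auto simp: mem_Times_iff)
qed

text \<open>The window reaches beyond the support up to time \<open>t1\<close>, so the flux through
  its ends is zero. The comparison starts at time 1 because the balance is stated for positive
  times.\<close>

lemma energy_decreasing:
  assumes t1: "1 \<le> t1" and K: "K \<ge> R + t1 + 1"
  shows "integral {- K..K} (energy t1) \<le> integral {- K..K} (energy 1)"
proof -
  have KK: "- K \<le> K" using K t1 par by simp
  define E' where "E' t x = - flux_dx t x - dissipation t x" for t x
  have d: "((\<lambda>t. integral (cbox (- K) K) (energy t)) has_real_derivative integral (cbox (- K) K) (E' t)) (at t within {1..t1})"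
    if "t \<in> {1..t1}" for t
  proof (rule leibniz_rule_field_derivative)
    show "((\<lambda>t. energy t x) has_real_derivative E' t x) (at t within {1..t1})" if "t \<in> {1..t1}" for t x
      unfolding E'_def by (rule has_field_derivative_at_within[OF energy_deriv]) (use that in auto)
    show "energy t integrable_on cbox (- K) K" if "t \<in> {1..t1}" for t
      by (intro integrable_continuous continuous_slice[OF continuous_pair(1)]) (use that in auto)
    have "continuous_on ({0..} \<times> UNIV) (\<lambda>z. E' (fst z) (snd z))"
      unfolding E'_def by (intro continuous_intros continuous_pair)
    then show "continuous_on ({1..t1} \<times> cbox (- K) K) (\<lambda>(t, x). E' t x)"
      by (simp add: case_prod_unfold) (rule continuous_on_subset, auto)
  qed (use that in auto)
  have nonpos: "integral (cbox (- K) K) (E' t) \<le> 0" if t: "t \<in> {1..t1}" for t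
  proof -
    have t0: "t > 0" "t \<ge> 0" using t by auto
    have "(flux_dx t has_integral flux t K - flux t (- K)) {- K..K}"
      using KK by (intro fundamental_theorem_of_calculus)
        (simp_all add: has_field_derivative_at_within[OF flux_deriv[OF t0(1)]]
           flip: has_real_derivative_iff_has_vector_derivative)
    moreover have "flux t K = 0" "flux t (- K) = 0"
      using support(1,2)[of t K] support(1,2)[of t "- K"] t K par by (auto simp: flux_def)
    ultimately have F: "(flux_dx t has_integral 0) {- K..K}" by simp
    have "dissipation t integrable_on {- K..K}"
      by (intro integrable_continuous_real continuous_slice[OF continuous_pair(3)] t0)
    moreover from this have "0 \<le> integral {- K..K} (dissipation t)"
    proof (rule integral_nonneg)
      fix x
      have "0 \<le> dens \<theta> (r t x)" using energy_small[OF r_small[OF t0(2), of x]] by linarith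
      then show "0 \<le> dissipation t x" using par t0 by (simp add: dissipation_def)
    qed
    ultimately have "integral {- K..K} (\<lambda>x. - flux_dx t x - dissipation t x) \<le> 0"
      using F by (subst integral_diff) (auto simp: has_integral_iff intro: integrable_neg)
    then show ?thesis by (simp add: E'_def[abs_def])
  qed
  have "integral (cbox (- K) K) (energy t1) \<le> integral (cbox (- K) K) (energy 1)"
  proof (rule DERIV_nonpos_imp_decreasing_open[OF t1])
    fix x assume x: "1 < x" "x < t1"
    then show "\<exists>y. ((\<lambda>t. integral (cbox (- K) K) (energy t)) has_real_derivative y) (at x) \<and> y \<le> 0"
      using d[of x] nonpos[of x] at_within_Icc_at[OF x] by (intro exI[of _ "integral (cbox (- K) K) (E' x)"]) auto
  qed (rule DERIV_continuous_on[OF d])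
  then show ?thesis by simp
qed

text \<open>The slope bounds are of order \<open>1 / (1 + t)\<close>, so a large value of \<open>f\<close> or \<open>g\<close> persists on an
  interval of length proportional to \<open>1 + t\<close>. Bounded energy therefore forces decay.\<close>

lemma wide_bump:
  assumes t: "t > 0" and \<delta>: "\<delta> > 0" and big: "\<bar>f t x0\<bar> > \<delta> \<or> \<bar>g t x0\<bar> > \<delta>"
  obtains p where "\<And>x. p \<le> x \<Longrightarrow> x \<le> p + \<delta> * (1 + t) / (16 * \<eta>) \<Longrightarrow> \<delta>\<^sup>2 / 32 \<le> energy t x"
proof -
  \<comment> \<open>For \<open>a = 1\<close>, \<open>(1 + e)\<^sup>2 \<le> 4\<close> and oscillation
    at most \<open>2 * \<eta>\<close>, the slope bound \<open>B\<close> is at most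
    \<open>8 * \<eta> / (1 + t)\<close>; over this length it costs at most half of
    \<open>\<delta>\<close>.\<close>
  define len where "len = \<delta> * (1 + t) / (16 * \<eta>)"
  define B where "B = a / (1 + t) * (1 + e)\<^sup>2 * (\<eta> + \<eta>)"
  have len: "len \<ge> 0" using \<delta> t \<eta> by (simp add: len_def)
  have rM: "r s x \<le> \<eta>" if "s \<ge> t" for s x using r_small[of s x] that t by auto
  have rm: "- \<eta> \<le> r t x" for x using r_small[of t x] t by auto
  have slope: "f t y - f t x \<ge> - (B * (y - x))" "g t y - g t x \<ge> - (B * (y - x))" if "x \<le> y" for x y
    by (rule slope_bounds[OF t _ less_imp_le[OF \<eta>(1)] rm less_imp_le[OF \<eta>(1)] B_def that], erule rM)+
  have "(1 + e)\<^sup>2 \<le> 2\<^sup>2" using e by (intro power_mono) auto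
  then have "B * len \<le> 1 / (1 + t) * 4 * (\<eta> + \<eta>) * len"
    unfolding B_def a1 using t \<eta> len by (intro mult_right_mono mult_left_mono) auto
  also have "\<dots> = \<delta> / 2"
  proof -
    have "1 / T * 4 * (\<eta> + \<eta>) * (\<delta> * T / (16 * \<eta>)) = \<delta> / 2" if "T > 0" for T
      using that \<eta> by (simp add: field_simps)
    then show ?thesis using t by (simp add: len_def)
  qed
  finally have Bl: "B * len \<le> \<delta> / 2" .
  have B0: "B \<ge> 0" using par t \<eta> by (simp add: B_def)
  have Bs: "B * s \<le> \<delta> / 2" if "s \<le> len" for s
    using mult_left_mono[OF that B0] Bl by linarith
  have sq: "\<delta>\<^sup>2 / 32 \<le> v\<^sup>2 / 8" if "\<delta> / 2 \<le> \<bar>v\<bar>" for v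
  proof -
    have "(\<delta> / 2)\<^sup>2 \<le> \<bar>v\<bar>\<^sup>2" using that \<delta> by (intro power_mono) auto
    then show ?thesis by (simp add: power_divide)
  qed
  note en = energy_lower[OF less_imp_le[OF t]]
  \<comment> \<open>The slopes are bounded from below only, so a large positive value persists to
    the right of \<open>x0\<close> and a large negative one to the left.\<close>
  have up: "\<exists>p. \<forall>x. p \<le> x \<and> x \<le> p + len \<longrightarrow> \<delta> / 2 \<le> \<bar>h x\<bar>"
    if s: "\<And>x y. x \<le> y \<Longrightarrow> h y - h x \<ge> - (B * (y - x))" and b: "\<bar>h x0\<bar> > \<delta>" for h :: "real \<Rightarrow> real"
  proof (cases "h x0 > 0")
    case True
    show ?thesis
    proof (intro exI[of _ x0] allI impI)
      fix x assume x: "x0 \<le> x \<and> x \<le> x0 + len"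
      then show "\<delta> / 2 \<le> \<bar>h x\<bar>" using s[of x0 x] Bs[of "x - x0"] b True by linarith
    qed
  next
    case False
    show ?thesis
    proof (intro exI[of _ "x0 - len"] allI impI)
      fix x assume x: "x0 - len \<le> x \<and> x \<le> x0 - len + len"
      then show "\<delta> / 2 \<le> \<bar>h x\<bar>" using s[of x x0] Bs[of "x0 - x"] b False by linarith
    qed
  qed
  show ?thesis
  proof (cases "\<bar>f t x0\<bar> > \<delta>")
    case True
    from up[OF slope(1) this] obtain p where "\<forall>x. p \<le> x \<and> x \<le> p + len \<longrightarrow> \<delta> / 2 \<le> \<bar>f t x\<bar>" by blast
    then show ?thesis using that[of p] sq en(1) unfolding len_def by (meson order_trans)
  next
    case False
    with big have "\<bar>g t x0\<bar> > \<delta>" by blast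
    from up[OF slope(2) this] obtain p where "\<forall>x. p \<le> x \<and> x \<le> p + len \<longrightarrow> \<delta> / 2 \<le> \<bar>g t x\<bar>" by blast
    then show ?thesis using that[of p] sq en(2) unfolding len_def by (meson order_trans)
  qed
qed

text \<open>A single time is enough, since \<open>sup_mono\<close> carries the bound to all later
  times.\<close>

lemma decay:
  assumes \<delta>: "\<delta> > 0"
  obtains t where "t > 0" "\<And>x. \<bar>f t x\<bar> \<le> \<delta> \<and> \<bar>g t x\<bar> \<le> \<delta>"
proof (rule ccontr)
  assume "\<not> thesis"
  with that have big: "\<exists>x. \<bar>f t x\<bar> > \<delta> \<or> \<bar>g t x\<bar> > \<delta>" if "t > 0" for t
    using \<open>t > 0\<close> by (meson not_le)
  define C where "C = integral {- (R + 2)..R + 2} (energy 1)"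
  \<comment> \<open>Makes the energy of the bump,
    \<open>(1 + t1) * \<delta> ^ 3 / (512 * \<eta>)\<close>, exceed \<open>C\<close>; here 512 is 16
    from the length times 32 from the height.\<close>
  define t1 where "t1 = max 1 (\<bar>C\<bar> * 512 * \<eta> / \<delta> ^ 3)"
  have t1: "t1 \<ge> 1" "t1 > 0" "t1 \<ge> 0" by (auto simp: t1_def)
  define len where "len = \<delta> * (1 + t1) / (16 * \<eta>)"
  have len: "len > 0" using \<delta> t1 \<eta> by (simp add: len_def)
  obtain x0 where "\<bar>f t1 x0\<bar> > \<delta> \<or> \<bar>g t1 x0\<bar> > \<delta>" using big[OF t1(2)] by blast
  from wide_bump[OF t1(2) \<delta> this] obtain p where
    p: "\<And>x. p \<le> x \<Longrightarrow> x \<le> p + len \<Longrightarrow> \<delta>\<^sup>2 / 32 \<le> energy t1 x" unfolding len_def by blast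
  define K where "K = R + t1 + 1 + \<bar>p\<bar> + len"
  have K: "K \<ge> R + t1 + 1" using len by (simp add: K_def)
  have int: "energy t integrable_on {b..c}" if "t \<ge> 0" for t b c
    by (intro integrable_continuous_real continuous_slice[OF continuous_pair(1)] that)
  have "len * (\<delta>\<^sup>2 / 32) = integral {p..p + len} (\<lambda>_. \<delta>\<^sup>2 / 32)" using len by simp
  also have "\<dots> \<le> integral {p..p + len} (energy t1)"
    by (intro integral_le int t1 integrable_const_ivl) (use p in auto)
  also have "\<dots> \<le> integral {- K..K} (energy t1)"
    using len t1 par by (intro integral_subset_le int) (auto simp: K_def intro: energy_lower)
  also have "\<dots> \<le> integral {- K..K} (energy 1)" by (rule energy_decreasing[OF t1(1) K])
  also have "\<dots> = C"
  proof -
    have "(energy 1 has_integral C) {- (R + 2)..R + 2}"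
      unfolding C_def by (intro integrable_integral int) simp
    then have "(energy 1 has_integral C) {- K..K}"
    proof (rule has_integral_on_superset)
      fix x assume "x \<notin> {- (R + 2)..R + 2}"
      then show "energy 1 x = 0" using support(1,2)[of 1 x] by (auto simp: energy_def r_def)
    qed (use K t1 in auto)
    then show ?thesis by (rule integral_unique)
  qed
  finally have "len * (\<delta>\<^sup>2 / 32) \<le> C" .
  moreover have "len * (\<delta>\<^sup>2 / 32) = (1 + t1) * \<delta> ^ 3 / (512 * \<eta>)"
    using \<eta> by (simp add: len_def field_simps power2_eq_square power3_eq_cube)
  moreover have "\<bar>C\<bar> < (1 + t1) * \<delta> ^ 3 / (512 * \<eta>)"
  proof -
    have "\<bar>C\<bar> * 512 * \<eta> / \<delta> ^ 3 < 1 + t1" unfolding t1_def by linarith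
    then show ?thesis using \<delta> \<eta> by (simp add: field_simps)
  qed
  ultimately show False by linarith
qed

section \<open>The Riccati variable at the critical damping\<close>

lemma riccati0_eq: "t > 0 \<Longrightarrow> riccati 0 X t = (1 + t) * (weight \<theta> (r t (X t)) * deriv (f t) (X t)) - weight_primitive \<theta> (r t (X t))"
  unfolding riccati_def by (simp add: a1)

text \<open>For \<open>a = 1\<close> the derivative is minus a weighted square whatever
  \<open>G\<close> is, so \<open>G = 0\<close> is allowed here even where
  \<open>weight_primitive\<close> is positive.\<close>

lemma riccati0_decreasing:
  assumes X: "characteristic s0 s1 X" and s: "0 < s0" "s0 \<le> t" "t \<le> t'" "t' \<le> s1"
  shows "riccati 0 X t' \<le> riccati 0 X t"
proof -
  have d: "(riccati 0 X has_real_derivative - ((1 + \<theta>) / 2 * (1 + t) * weight \<theta> (r t (X t)) * (deriv (f t) (X t))\<^sup>2)) (at t within {s0..s1})"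
    if "t \<in> {s0..s1}" for t
    using riccati_deriv[OF X s(1) that, of 0] that s by (simp add: a1)
  show ?thesis
  proof (rule DERIV_nonpos_imp_decreasing_open[OF s(3)])
    show "continuous_on {t..t'} (riccati 0 X)"
      by (rule continuous_on_subset[OF DERIV_continuous_on[OF d]]) (use s in auto)
    fix x assume x: "t < x" "x < t'"
    then have "x \<in> {s0..s1}" "at x within {s0..s1} = at x" "x \<ge> 0"
      using s at_within_Icc_at[of s0 x s1] by auto
    moreover from this have "0 < weight \<theta> (r x (X x))" by (intro weight_pos c_pos r_small)
    ultimately show "\<exists>y. (riccati 0 X has_real_derivative y) (at x) \<and> y \<le> 0"
      using d[of x] par
      by (intro exI[of _ "- ((1 + \<theta>) / 2 * (1 + x) * weight \<theta> (r x (X x)) * (deriv (f x) (X x))\<^sup>2)"])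
         (auto intro!: mult_nonneg_nonneg less_imp_le[of 0 "weight _ _"])
  qed
qed

text \<open>\<open>riccati_nonneg\<close> asks for a \<open>G\<close> above all later values of
  \<open>weight_primitive\<close>, which 0 need not be. By \<open>decay\<close> an arbitrarily small
  \<open>G\<close> works from some time on, and monotonicity carries the resulting lower bound back:
  a start at \<open>- 4 * \<delta>\<close> could never reach the required
  \<open>- 2 * \<delta>\<close>.\<close>

lemma riccati0_nonneg:
  assumes t0: "t0 > 0"
  shows "riccati 0 (\<lambda>_. x0) t0 \<ge> 0"
proof (rule ccontr)
  define \<delta> where "\<delta> = - riccati 0 (\<lambda>_. x0) t0 / 4"
  assume "\<not> riccati 0 (\<lambda>_. x0) t0 \<ge> 0"
  then have \<delta>: "\<delta> > 0" by (simp add: \<delta>_def)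
  obtain t where t: "t > 0" "\<And>x. \<bar>f t x\<bar> \<le> \<delta> \<and> \<bar>g t x\<bar> \<le> \<delta>" using decay[OF \<delta>] by blast
  define t1 where "t1 = max t0 t"
  have t1: "t1 \<ge> t0" "t1 \<ge> t" "t1 > 0" using t0 by (auto simp: t1_def)
  have Gle: "weight_primitive \<theta> (r s x) \<le> 2 * \<delta>" if "s \<ge> t1" for s x
  proof -
    have rb: "\<bar>r s x\<bar> \<le> \<delta>" using sup_mono[OF _ _ t(2), of s x] t(1) t1 that by (auto simp: r_def)
    have rs: "\<bar>r s x\<bar> \<le> \<eta>" using r_small that t1 by simp
    show ?thesis
    proof (cases "r s x \<ge> 0")
      case True
      then have "weight_primitive \<theta> (r s x) \<le> (1 + e) * r s x" using weight_primitive_nonneg[OF True] rs by simp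
      also have "\<dots> \<le> 2 * \<delta>" using True rb e by (intro mult_mono) auto
      finally show ?thesis .
    next
      case False
      then show ?thesis using weight_primitive_nonpos[of "r s x"] rs \<delta> by (smt (verit) divide_nonpos_pos)
    qed
  qed
  obtain X where X: "X t0 = x0" "characteristic t0 t1 X" using characteristic_exists[OF t0 t1(1), of t0 x0] by blast
  have "weight \<theta> (r t1 (X t1)) * deriv (f t1) (X t1) \<ge> - (a / (1 + t1)) * (2 * \<delta> - weight_primitive \<theta> (r t1 (X t1)))"
    by (rule weighted_slope_bound[OF t1(3)]) (erule Gle)
  then have "(1 + t1) * (weight \<theta> (r t1 (X t1)) * deriv (f t1) (X t1)) \<ge> - (2 * \<delta> - weight_primitive \<theta> (r t1 (X t1)))"
    using t1 by (simp add: a1 field_simps)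
  then have "riccati 0 X t1 \<ge> - 2 * \<delta>" using riccati0_eq[OF t1(3)] by simp
  moreover have "riccati 0 X t1 \<le> riccati 0 X t0" by (rule riccati0_decreasing[OF X(2) t0]) (use t1 in auto)
  moreover have "riccati 0 X t0 = - 4 * \<delta>" by (simp add: riccati_def X \<delta>_def)
  ultimately show False using \<delta> by simp
qed

text \<open>For \<open>a = 1\<close> the variable \<open>riccati 0\<close> decreases along characteristics. It vanishes to the left of the
  support of the data and is nonnegative later, hence it stays zero on every characteristic that
  starts there, and its Riccati equation gives \<open>f\<^sub>x = 0\<close>. At time \<open>2 R + 4\<close> these characteristics
  cover the left half line.\<close>

lemma vanishing_left:
  assumes x: "x \<le> 0"
  shows "r (2 * R + 4) x = 0" "deriv (f (2 * R + 4)) x = 0"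
proof -
  define t1 where "t1 = 2 * R + 4"
  have t1: "1 < t1" "t1 > 0" using par by (auto simp: t1_def)
  \<comment> \<open>The curve runs on to \<open>t1 + 1\<close>, so that \<open>t1\<close> is an
    interior time and the derivative of the vanishing variable there is unique.\<close>
  obtain X where X: "X t1 = x" "characteristic 1 (t1 + 1) X"
    using characteristic_exists[of 1 "t1 + 1" t1 x] t1 by auto
  have Xd: "(X has_real_derivative speed \<theta> (f t (X t)) (g t (X t))) (at t)" if "t \<in> {1..t1 + 1}" for t
    using X(2) that by (simp add: characteristic_def)
  \<comment> \<open>With speed at least \<open>1 / 2\<close> during the time
    \<open>2 * R + 3\<close> the curve advances by at least \<open>R + 3/2\<close>, so at time 1 it
    was to the left of the support.\<close>
  have "X 1 - 1 * (1/2) \<le> X t1 - t1 * (1/2)"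
  proof (rule DERIV_nonneg_imp_nondecreasing[where f = "\<lambda>t. X t - t * (1/2)"])
    fix t assume t: "1 \<le> t" "t \<le> t1"
    have "((\<lambda>t. X t - t * (1/2)) has_real_derivative speed \<theta> (f t (X t)) (g t (X t)) - 1 * (1/2)) (at t)"
      by (intro DERIV_diff Xd DERIV_cmult_right DERIV_ident) (use t in auto)
    with speed_bounds[of t "X t"] t show "\<exists>y. ((\<lambda>t. X t - t * (1/2)) has_real_derivative y) (at t) \<and> 0 \<le> y"
      by (intro exI conjI) auto
  qed (use t1 in auto)
  then have "X 1 \<le> x - (R + 3/2)" using X(1) by (simp add: t1_def add_divide_distrib)
  then have "\<bar>X 1\<bar> > R + 1" using x par by linarith
  from support[OF _ this] have "riccati 0 X 1 = 0" using riccati0_eq[of 1 X] by (simp add: r_def)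
  then have Y0: "riccati 0 X t = 0" if "t \<in> {1..t1 + 1}" for t
    using riccati0_decreasing[OF X(2), of 1 t] riccati0_nonneg[of t "X t"] that by (simp add: riccati_def)
  have mem: "t1 \<in> {1..t1 + 1}" using t1 by simp
  have at: "at t1 within {1..t1 + 1} = at t1" using t1 by (intro at_within_Icc_at) auto
  have "((\<lambda>_. 0) has_real_derivative - ((1 + \<theta>) / 2 * (1 + t1) powr a * weight \<theta> (r t1 (X t1)) * (deriv (f t1) (X t1))\<^sup>2)
     - a * (1 - a) * (1 + t1) powr (a - 2) * (0 - weight_primitive \<theta> (r t1 (X t1)))) (at t1)"
    using riccati_deriv[OF X(2) _ mem, of 0] unfolding at
    by (rule has_field_derivative_transform_within_open[where S = "{1<..<t1 + 1}"]) (use t1 Y0 in auto)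
  from DERIV_unique[OF this DERIV_const]
  have "(1 + \<theta>) / 2 * (1 + t1) * weight \<theta> (r t1 (X t1)) * (deriv (f t1) (X t1))\<^sup>2 = 0"
    using t1 by (simp add: a1)
  moreover have "weight \<theta> (r t1 x) > 0" using t1 by (intro weight_pos c_pos r_small) simp
  ultimately have z: "deriv (f t1) x = 0" using par t1 X(1) by simp
  then have "weight_primitive \<theta> (r t1 x) = 0" using Y0[OF mem] riccati0_eq[OF t1(2), of X] X(1) by simp
  then have "r t1 x = 0"
    using weight_primitive_nonneg[of "r t1 x"] weight_primitive_nonpos[of "r t1 x"] r_small[of t1 x] t1 by (cases "r t1 x \<ge> 0") auto
  with z show "r (2 * R + 4) x = 0" "deriv (f (2 * R + 4)) x = 0" by (simp_all add: t1_def)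
qed

lemma reflect_critical: "critical_solution \<theta> a R (\<lambda>t x. - g t (- x)) (\<lambda>t x. - f t (- x)) e \<eta>"
  by (intro critical_solution.intro reflect_small critical_solution_axioms.intro) (use a1 energy_small in auto)

interpretation rc: critical_solution \<theta> a R "\<lambda>t x. - g t (- x)" "\<lambda>t x. - f t (- x)" e \<eta>
  by (rule reflect_critical)

text \<open>At time \<open>2 * R + 4\<close>, \<open>vanishing_left\<close> and its reflection give
  \<open>r = 0\<close> on the whole line, so \<open>f = g\<close> there. The slope of
  \<open>f\<close> vanishes on the left and that of \<open>g\<close> on the right; their common
  value is constant, hence zero by the compact support.\<close>

theorem trivial_if_critical: "f 0 x = 0 \<and> g 0 x = 0"
proof -
  define t1 where "t1 = 2 * R + 4"
  have t1: "t1 > 0" using par by (simp add: t1_def)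
  have right: "r t1 x = 0" "deriv (g t1) x = 0" if "x \<ge> 0" for x
    using rc.vanishing_left[of "- x"] that by (simp_all add: t1_def r_def rc.r_def deriv_reflect)
  have left: "r t1 x = 0" "deriv (f t1) x = 0" if "x \<le> 0" for x
    using vanishing_left[OF that] by (simp_all add: t1_def)
  have "r t1 x = 0" for x using left(1)[of x] right(1)[of x] by (cases "x \<le> 0") auto
  then have fg: "f t1 = g t1" by (auto simp: r_def fun_eq_iff)
  have "deriv (f t1) x = 0" for x using left(2)[of x] right(2)[of x] fg by (cases "x \<le> 0") auto
  then have "(f t1 has_real_derivative 0) (at x)" for x
    using has_partials_dx[OF partials(1)[OF t1, of x]] by simp
  then have const: "f t1 x = f t1 y" for x y by (metis DERIV_isconst_all)
  have "f t1 (R + t1 + 1) = 0" by (rule support) (use par t1 in auto)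
  with const fg have "f t1 x = 0 \<and> g t1 x = 0" for x by metis
  then show ?thesis
    using riemann_system_backward_zero[OF sys[of "t1 + 1"] par(1,2) t1 _ init] by simp
qed

end

section \<open>Reduction to the Riemann invariants\<close>

lemma C1_strip_dx:
  assumes "C1_strip T \<phi>" "0 \<le> t" "t < T"
  shows "((\<lambda>y. \<phi> t y) has_real_derivative dx \<phi> t x) (at x)"
  using assms unfolding C1_strip_def dx_def by (auto simp: DERIV_deriv_iff_real_differentiable)

lemma C1_strip_dt:
  assumes "C1_strip T \<phi>" "0 < t" "t < T"
  shows "((\<lambda>s. \<phi> s x) has_real_derivative dt T \<phi> t x) (at t)"
proof -
  have "(\<lambda>s. \<phi> s x) differentiable (at t within {0..<T})"
    using assms unfolding C1_strip_def by auto
  then have "((\<lambda>s. \<phi> s x) has_real_derivative dt T \<phi> t x) (at t within {0..<T})"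
    unfolding dt_def vector_derivative_works has_real_derivative_iff_has_vector_derivative .
  moreover have "at t within {0..<T} = at t"
    using assms(2,3) by (intro at_within_interior) (auto simp: interior_atLeastLessThan)
  ultimately show ?thesis by simp
qed

lemma dt_eq:
  assumes "0 < t" "t < T" "((\<lambda>s. \<phi> s x) has_real_derivative D) (at t)"
  shows "dt T \<phi> t x = D"
proof -
  have "at t within {0..<T} = at t"
    using assms(1,2) by (intro at_within_interior) (auto simp: interior_atLeastLessThan)
  then show ?thesis
    using assms(3) unfolding dt_def has_real_derivative_iff_has_vector_derivative
    by (simp add: vector_derivative_at)
qed

lemma C1_strip_partials:
  assumes "C1_strip T \<phi>" "0 < t" "t < T"
  shows "has_partials \<phi> (dt T \<phi> t x) (dx \<phi> t x) t x"
proof (rule has_partialsI[where T = T])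
  show "continuous_on ({0<..<T} \<times> UNIV) (\<lambda>(s, y). dx \<phi> s y)"
    using assms(1) unfolding C1_strip_def by (auto elim!: continuous_on_subset)
qed (use assms in \<open>auto intro: C1_strip_dx C1_strip_dt\<close>)

text \<open>The integral of sound speed over density, \<open>s powr \<theta> / s\<close>, starting
  from density 1.\<close>

definition rel_sound :: "real \<Rightarrow> real \<Rightarrow> real" where
  "rel_sound \<theta> s = (s powr \<theta> - 1) / \<theta>"

lemma rel_sound_deriv:
  assumes "\<theta> > 0" "s > 0"
  shows "(rel_sound \<theta> has_real_derivative s powr (\<theta> - 1)) (at s)"
  unfolding rel_sound_def[abs_def] using assms by (auto intro!: derivative_eq_intros)

text \<open>The momentum equation minus \<open>u\<close> times the mass equation, divided by the
  positive density, is an equation for \<open>u\<close>; adding or subtracting \<open>P\<close>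
  times the mass equation diagonalises the system.\<close>

lemma C1_solution_riemann_system:
  assumes \<gamma>: "\<gamma> > 1" and sol: "C1_solution \<gamma> \<mu> \<epsilon> \<rho>\<^sub>0 u\<^sub>0 T \<rho> u"
  defines "\<theta> \<equiv> (\<gamma> - 1) / 2"
  shows "riemann_system \<theta> (\<mu> / 2) T (\<lambda>t x. u t x + rel_sound \<theta> (\<rho> t x)) (\<lambda>t x. u t x - rel_sound \<theta> (\<rho> t x))"
proof -
  have \<theta>: "\<theta> > 0" using \<gamma> by (simp add: \<theta>_def)
  have \<rho>C: "C1_strip T \<rho>" and uC: "C1_strip T u" using sol by (auto simp: C1_solution_def)
  have pos: "\<rho> t x > 0" if "0 \<le> t" "t < T" for t x using sol that by (auto simp: C1_solution_def)
  \<comment> \<open>\<open>P\<close> is sound speed over density. In terms of it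
    \<open>\<rho> powr \<theta>\<close> is \<open>\<rho> * P\<close> and
    \<open>\<rho> powr (\<gamma> - 1)\<close> is \<open>(\<rho> * P)\<^sup>2\<close>, so the
    remaining identities are polynomial.\<close>
  define P where "P t x = \<rho> t x powr (\<theta> - 1)" for t x
  have fx: "((\<lambda>y. u t y + rel_sound \<theta> (\<rho> t y)) has_real_derivative dx u t x + P t x * dx \<rho> t x) (at x)"
    "((\<lambda>y. u t y - rel_sound \<theta> (\<rho> t y)) has_real_derivative dx u t x - P t x * dx \<rho> t x) (at x)"
    if "0 \<le> t" "t < T" for t x
  proof -
    have rs: "((\<lambda>y. rel_sound \<theta> (\<rho> t y)) has_real_derivative P t x * dx \<rho> t x) (at x)"
      unfolding P_def by (rule DERIV_chain2[OF rel_sound_deriv[OF \<theta> pos[OF that]] C1_strip_dx[OF \<rho>C that]])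
    show "((\<lambda>y. u t y + rel_sound \<theta> (\<rho> t y)) has_real_derivative dx u t x + P t x * dx \<rho> t x) (at x)"
      by (rule DERIV_add[OF C1_strip_dx[OF uC that] rs])
    show "((\<lambda>y. u t y - rel_sound \<theta> (\<rho> t y)) has_real_derivative dx u t x - P t x * dx \<rho> t x) (at x)"
      by (rule DERIV_diff[OF C1_strip_dx[OF uC that] rs])
  qed
  note fx' = DERIV_imp_deriv[OF fx(1)] DERIV_imp_deriv[OF fx(2)]
  have cont: "continuous_on ({0..<T} \<times> UNIV) (\<lambda>z. \<rho> (fst z) (snd z))"
    "continuous_on ({0..<T} \<times> UNIV) (\<lambda>z. u (fst z) (snd z))"
    "continuous_on ({0..<T} \<times> UNIV) (\<lambda>z. dx \<rho> (fst z) (snd z))"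
    "continuous_on ({0..<T} \<times> UNIV) (\<lambda>z. dx u (fst z) (snd z))"
    using \<rho>C uC unfolding C1_strip_def case_prod_unfold by auto
  have nz: "\<forall>z\<in>{0..<T} \<times> UNIV. \<rho> (fst z) (snd z) \<noteq> 0"
    using pos by (auto simp: less_imp_neq[symmetric])
  have Pc: "continuous_on ({0..<T} \<times> UNIV) (\<lambda>z. P (fst z) (snd z))"
    unfolding P_def by (intro continuous_intros cont) (use nz in auto)
  have part: "has_partials (\<lambda>t x. u t x + \<sigma> * rel_sound \<theta> (\<rho> t x)) (dt T \<rho> t x * (\<sigma> * P t x) + dt T u t x * 1)
      (dx \<rho> t x * (\<sigma> * P t x) + dx u t x * 1) t x" if t: "0 < t" "t < T" for \<sigma> t x
  proof -
    have "((\<lambda>z. rel_sound \<theta> (fst z)) has_derivative (\<lambda>z. P t x * fst z)) (at (\<rho> t x, u t x))"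
    proof (rule has_derivative_compose[OF has_derivative_fst[OF has_derivative_ident]])
      show "(rel_sound \<theta> has_derivative (*) (P t x)) (at (fst (\<rho> t x, u t x)))"
        using rel_sound_deriv[OF \<theta> pos[of t x]] t by (simp add: has_field_derivative_def P_def)
    qed
    then have "((\<lambda>z. snd z + \<sigma> * rel_sound \<theta> (fst z)) has_derivative (\<lambda>z. snd z + \<sigma> * (P t x * fst z)))
        (at (\<rho> t x, u t x))"
      by (intro has_derivative_add has_derivative_snd has_derivative_ident has_derivative_mult_right)
    then have "((\<lambda>z. snd z + \<sigma> * rel_sound \<theta> (fst z)) has_derivative (\<lambda>(h, k). h * (\<sigma> * P t x) + k * 1))
        (at (\<rho> t x, u t x))"
      by (simp add: case_prod_unfold algebra_simps)
    from has_partials_chain2[OF C1_strip_partials[OF \<rho>C t] C1_strip_partials[OF uC t] this]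
    show ?thesis by simp
  qed
  have eqs: "dt T \<rho> t x = - (dx \<rho> t x * u t x + \<rho> t x * dx u t x)"
    "dt T u t x = - u t x * dx u t x - \<rho> t x * (P t x)\<^sup>2 * dx \<rho> t x - \<mu> / (1 + t) * u t x"
    "\<rho> t x powr \<theta> = \<rho> t x * P t x"
    if t: "0 < t" "t < T" for t x
  proof -
    have t': "0 \<le> t" using t by simp
    note rt = C1_strip_dt[OF \<rho>C t, of x] and ut = C1_strip_dt[OF uC t, of x]
    note rx = C1_strip_dx[OF \<rho>C t' t(2), of x] and ux = C1_strip_dx[OF uC t' t(2), of x]
    have p: "\<rho> t x > 0" by (rule pos[OF t' t(2)])
    show c: "\<rho> t x powr \<theta> = \<rho> t x * P t x" using p by (simp add: P_def powr_diff)
    have "dx (\<lambda>t x. \<rho> t x * u t x) t x = dx \<rho> t x * u t x + dx u t x * \<rho> t x"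
      unfolding dx_def[of "\<lambda>t x. \<rho> t x * u t x"] by (rule DERIV_imp_deriv[OF DERIV_mult[OF rx ux]])
    moreover have "dt T \<rho> t x + dx (\<lambda>t x. \<rho> t x * u t x) t x = 0"
      using sol t by (auto simp: C1_solution_def)
    ultimately show 1: "dt T \<rho> t x = - (dx \<rho> t x * u t x + \<rho> t x * dx u t x)"
      by (simp add: eq_neg_iff_add_eq_0 mult.commute[of "dx u t x"])
    have 2: "dt T (\<lambda>t x. \<rho> t x * u t x) t x = dt T \<rho> t x * u t x + dt T u t x * \<rho> t x"
      by (rule dt_eq[where \<phi> = "\<lambda>t x. \<rho> t x * u t x", OF t DERIV_mult[OF rt ut]])
    have "((\<lambda>y. \<rho> t y * (u t y)\<^sup>2) has_real_derivative dx \<rho> t x * (u t x)\<^sup>2 + (2 * u t x * dx u t x) * \<rho> t x) (at x)"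
      by (rule DERIV_mult[OF rx]) (use DERIV_power[OF ux, of 2] in \<open>simp add: mult_ac\<close>)
    then have 3: "dx (\<lambda>t x. \<rho> t x * (u t x)\<^sup>2) t x = dx \<rho> t x * (u t x)\<^sup>2 + 2 * u t x * dx u t x * \<rho> t x"
      unfolding dx_def[of "\<lambda>t x. \<rho> t x * (u t x)\<^sup>2"] by (rule DERIV_imp_deriv)
    have "(pressure \<gamma> has_real_derivative \<rho> t x powr (\<gamma> - 1)) (at (\<rho> t x))"
      unfolding pressure_def[abs_def] using p \<gamma> by (auto intro!: derivative_eq_intros)
    moreover have "\<rho> t x powr (\<gamma> - 1) = (\<rho> t x * P t x)\<^sup>2"
      unfolding c[symmetric] using p by (simp add: \<theta>_def power2_eq_square powr_add[symmetric])
    ultimately have "((\<lambda>y. pressure \<gamma> (\<rho> t y)) has_real_derivative (\<rho> t x * P t x)\<^sup>2 * dx \<rho> t x) (at x)"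
      using DERIV_chain2[OF _ rx, of "pressure \<gamma>"] by simp
    then have 4: "dx (\<lambda>t x. pressure \<gamma> (\<rho> t x)) t x = (\<rho> t x * P t x)\<^sup>2 * dx \<rho> t x"
      unfolding dx_def[of "\<lambda>t x. pressure \<gamma> (\<rho> t x)"] by (rule DERIV_imp_deriv)
    define k where "k = \<mu> / (1 + t)"
    have "dt T (\<lambda>t x. \<rho> t x * u t x) t x + dx (\<lambda>t x. \<rho> t x * (u t x)\<^sup>2) t x
          + dx (\<lambda>t x. pressure \<gamma> (\<rho> t x)) t x = - k * (\<rho> t x * u t x)"
      using sol t unfolding k_def by (auto simp: C1_solution_def)
    then have "\<rho> t x * (dt T u t x) = \<rho> t x * (- u t x * dx u t x - \<rho> t x * (P t x)\<^sup>2 * dx \<rho> t x - k * u t x)"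
      unfolding 2 3 4 1 by (simp add: power2_eq_square algebra_simps)
    with p show "dt T u t x = - u t x * dx u t x - \<rho> t x * (P t x)\<^sup>2 * dx \<rho> t x - \<mu> / (1 + t) * u t x"
      by (simp add: k_def)
  qed
  show ?thesis
    unfolding riemann_system_def
  proof (intro conjI allI impI)
    have d: "continuous_on ({0..<T} \<times> UNIV) (\<lambda>z. dx u (fst z) (snd z) + P (fst z) (snd z) * dx \<rho> (fst z) (snd z))"
      "continuous_on ({0..<T} \<times> UNIV) (\<lambda>z. dx u (fst z) (snd z) - P (fst z) (snd z) * dx \<rho> (fst z) (snd z))"
      by (intro continuous_intros cont Pc)+
    show "continuous_on ({0..<T} \<times> UNIV) (\<lambda>(t, x). deriv (\<lambda>x. u t x + rel_sound \<theta> (\<rho> t x)) x)"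
      by (rule continuous_on_eq[OF d(1)]) (auto simp: fx')
    show "continuous_on ({0..<T} \<times> UNIV) (\<lambda>(t, x). deriv (\<lambda>x. u t x - rel_sound \<theta> (\<rho> t x)) x)"
      by (rule continuous_on_eq[OF d(2)]) (auto simp: fx')
    show "continuous_on ({0..<T} \<times> UNIV) (\<lambda>(t, x). u t x + rel_sound \<theta> (\<rho> t x))"
      "continuous_on ({0..<T} \<times> UNIV) (\<lambda>(t, x). u t x - rel_sound \<theta> (\<rho> t x))"
      unfolding case_prod_unfold rel_sound_def by (intro continuous_intros cont; use nz \<theta> in auto)+
  next
    fix t x assume t: "0 < t \<and> t < T"
    define k where "k = \<mu> / 2 / (1 + t)"
    have k: "\<mu> / (1 + t) = 2 * k" using t by (simp add: k_def field_simps)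
    note e = eqs[OF conjunct1[OF t] conjunct2[OF t], of x, unfolded k]
    have s: "speed \<theta> (u t x + rel_sound \<theta> (\<rho> t x)) (u t x - rel_sound \<theta> (\<rho> t x)) = u t x + \<rho> t x * P t x"
      "speed \<theta> (- (u t x - rel_sound \<theta> (\<rho> t x))) (- (u t x + rel_sound \<theta> (\<rho> t x))) = - u t x + \<rho> t x * P t x"
      using \<theta> by (simp_all add: speed_def rel_sound_def e(3) field_simps)
    have d: "deriv (\<lambda>x. u t x + rel_sound \<theta> (\<rho> t x)) x = dx u t x + P t x * dx \<rho> t x"
      "deriv (\<lambda>x. u t x - rel_sound \<theta> (\<rho> t x)) x = dx u t x - P t x * dx \<rho> t x"
      using t by (intro fx'; simp)+
    have "- k * (u t x + rel_sound \<theta> (\<rho> t x) + (u t x - rel_sound \<theta> (\<rho> t x))) -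
        (u t x + \<rho> t x * P t x) * (dx u t x + P t x * dx \<rho> t x) =
        dt T \<rho> t x * (1 * P t x) + dt T u t x * 1"
      unfolding e by (simp add: power2_eq_square algebra_simps)
    with part[OF conjunct1[OF t] conjunct2[OF t], of 1 x]
    show "has_partials (\<lambda>t x. u t x + rel_sound \<theta> (\<rho> t x))
        (- (\<mu> / 2 / (1 + t)) * (u t x + rel_sound \<theta> (\<rho> t x) + (u t x - rel_sound \<theta> (\<rho> t x))) -
         speed \<theta> (u t x + rel_sound \<theta> (\<rho> t x)) (u t x - rel_sound \<theta> (\<rho> t x)) *
         deriv (\<lambda>x. u t x + rel_sound \<theta> (\<rho> t x)) x)
        (deriv (\<lambda>x. u t x + rel_sound \<theta> (\<rho> t x)) x) t x"
      unfolding s d k_def[symmetric] by (simp add: mult.commute add.commute)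
    have "- k * (u t x + rel_sound \<theta> (\<rho> t x) + (u t x - rel_sound \<theta> (\<rho> t x))) +
        (- u t x + \<rho> t x * P t x) * (dx u t x - P t x * dx \<rho> t x) =
        dt T \<rho> t x * (- 1 * P t x) + dt T u t x * 1"
      unfolding e by (simp add: power2_eq_square algebra_simps)
    with part[OF conjunct1[OF t] conjunct2[OF t], of "- 1" x]
    show "has_partials (\<lambda>t x. u t x - rel_sound \<theta> (\<rho> t x))
        (- (\<mu> / 2 / (1 + t)) * (u t x + rel_sound \<theta> (\<rho> t x) + (u t x - rel_sound \<theta> (\<rho> t x))) +
         speed \<theta> (- (u t x - rel_sound \<theta> (\<rho> t x))) (- (u t x + rel_sound \<theta> (\<rho> t x))) *
         deriv (\<lambda>x. u t x - rel_sound \<theta> (\<rho> t x)) x)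
        (deriv (\<lambda>x. u t x - rel_sound \<theta> (\<rho> t x)) x) t x"
      unfolding s d k_def[symmetric] by (simp add: mult.commute add.commute)
  qed
qed

section \<open>From long-lived solutions to one global solution\<close>

lemma riemann_system_cong:
  assumes sys: "riemann_system \<theta> a T f g"
    and eq: "\<And>t. 0 \<le> t \<Longrightarrow> t < T \<Longrightarrow> f' t = f t" "\<And>t. 0 \<le> t \<Longrightarrow> t < T \<Longrightarrow> g' t = g t"
  shows "riemann_system \<theta> a T f' g'"
proof -
  note D = riemann_systemD[OF sys]
  have c: "continuous_on ({0..<T} \<times> UNIV) (\<lambda>(t, x). h' t x)"
    if "continuous_on ({0..<T} \<times> UNIV) (\<lambda>(t, x). h t x)" "\<And>t. 0 \<le> t \<Longrightarrow> t < T \<Longrightarrow> h' t = h t"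
    for h h' :: "real \<Rightarrow> real \<Rightarrow> real"
    using that(1) by (rule continuous_on_eq) (use that(2) in auto)
  have p: "has_partials h' p q t x"
    if "has_partials h p q t x" "0 < t" "t < T" "\<And>t. 0 \<le> t \<Longrightarrow> t < T \<Longrightarrow> h' t = h t" for h h' p q t x
    by (rule has_partials_transform[OF that(1), of "{0<..<T} \<times> UNIV"]) (use that in \<open>auto intro: open_Times\<close>)
  show ?thesis
    unfolding riemann_system_def
  proof (intro conjI allI impI)
    fix t x assume t: "0 < t \<and> t < T"
    then have e: "f' t = f t" "g' t = g t" using eq by auto
    show "has_partials f' (- (a / (1 + t)) * (f' t x + g' t x) - speed \<theta> (f' t x) (g' t x) * deriv (f' t) x)
        (deriv (f' t) x) t x"
      unfolding e using p[OF D(5) _ _ eq(1)] t by blast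
    show "has_partials g' (- (a / (1 + t)) * (f' t x + g' t x) + speed \<theta> (- g' t x) (- f' t x) * deriv (g' t) x)
        (deriv (g' t) x) t x"
      unfolding e using p[OF D(6) _ _ eq(2)] t by blast
  qed (use c[OF D(1) eq(1)] c[OF D(2) eq(2)] c[OF D(3), of "\<lambda>t. deriv (f' t)"] c[OF D(4), of "\<lambda>t. deriv (g' t)"] eq
       in auto)
qed

text \<open>At time \<open>t\<close> the solution numbered \<open>N t\<close> is used, which still
  exists because \<open>t < N t + 1\<close>. By uniqueness every solution that exists at time
  \<open>t\<close> has the same value there, so the choice leaves no seams.\<close>

lemma riemann_system_glue:
  assumes par: "\<theta> > 0" "0 \<le> a"
    and ex: "\<And>n :: nat. \<exists>f g. riemann_system \<theta> a (real n + 1) f g \<and> f 0 = f0 \<and> g 0 = g0"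
    and init: "\<And>x. \<bar>x\<bar> > R \<Longrightarrow> f0 x = 0 \<and> g0 x = 0"
  obtains f g where "\<And>T. riemann_system \<theta> a T f g" "f 0 = f0" "g 0 = g0"
proof -
  obtain F G where FG: "\<And>n. riemann_system \<theta> a (real n + 1) (F n) (G n)" "\<And>n. F n 0 = f0" "\<And>n. G n 0 = g0"
    using ex by metis
  define N where "N t = nat \<lceil>t\<rceil>" for t :: real
  define f where "f t = F (N t) t" for t
  define g where "g t = G (N t) t" for t
  have eq: "f t = F n t" "g t = G n t" if t: "0 \<le> t" "t < real n + 1" for t n
  proof -
    have "t < real (N t) + 1" unfolding N_def by linarith
    define T where "T = min (real n + 1) (real (N t) + 1)"
    have T: "t < T" "T \<le> real n + 1" "T \<le> real (N t) + 1"
      using t \<open>t < real (N t) + 1\<close> by (auto simp: T_def)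
    note sys = riemann_system_mono[OF FG(1) T(2)] riemann_system_mono[OF FG(1) T(3)]
    have "F (N t) t x = F n t x \<and> G (N t) t x = G n t x" for x
      by (rule riemann_system_unique[OF sys par t(1) T(1)]) (use init FG in auto)
    then show "f t = F n t" "g t = G n t" by (auto simp: f_def g_def)
  qed
  show ?thesis
  proof (rule that[of f g])
    fix T :: real
    obtain n :: nat where n: "T \<le> real n" using real_arch_simple by blast
    have "riemann_system \<theta> a (real n + 1) f g"
      by (rule riemann_system_cong[OF FG(1)]) (use eq in auto)
    then show "riemann_system \<theta> a T f g" by (rule riemann_system_mono) (use n in simp)
  qed (use eq[of 0 0] FG in auto)
qed

text \<open>The threshold is fixed before the solution is given, as a bound on
  \<open>\<epsilon>\<close> requires; it is found from \<open>\<theta>\<close> and from an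
  \<open>e\<close> that depends on \<open>a\<close>.\<close>

theorem small_global_solution_trivial:
  assumes par: "\<theta> > 0" "0 \<le> a" "a \<le> 1" "R > 0"
  obtains \<eta> where "\<eta> > 0" "\<And>f g x. (\<And>T. riemann_system \<theta> a T f g) \<Longrightarrow>
     (\<And>x. \<bar>x\<bar> > R \<Longrightarrow> f 0 x = 0 \<and> g 0 x = 0) \<Longrightarrow> (\<And>x. \<bar>f 0 x\<bar> \<le> \<eta> \<and> \<bar>g 0 x\<bar> \<le> \<eta>) \<Longrightarrow>
     f 0 x = 0 \<and> g 0 x = 0"
proof (cases "a < 1")
  case True
  have "((\<lambda>e. a * (1 + e) ^ 4) \<longlongrightarrow> a * (1 + 0) ^ 4) (at_right 0)" by (intro tendsto_intros)
  then have "\<forall>\<^sub>F e in at_right 0. a * (1 + e) ^ 4 < 1" by (rule order_tendstoD) (use True in simp)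
  moreover have "\<forall>\<^sub>F e in at_right 0. e \<in> {0<..<1::real}" by (rule eventually_at_right_real) simp
  ultimately have "\<forall>\<^sub>F e in at_right 0. a * (1 + e) ^ 4 < 1 \<and> e \<in> {0<..<1::real}" by (rule eventually_conj)
  from eventually_happens[OF this] obtain e where crit: "a * (1 + e) ^ 4 < 1" and e: "0 < e" "e \<le> 1" by auto
  obtain \<eta> where \<eta>: "\<eta> > 0" "(1 + \<theta>) * \<eta> \<le> 1/2"
    "\<And>r. \<bar>r\<bar> \<le> \<eta> \<Longrightarrow> weight \<theta> r \<le> 1 + e \<and> 1 \<le> (1 + e) * weight \<theta> r"
    "\<And>r. 0 \<le> r \<Longrightarrow> r \<le> \<eta> \<Longrightarrow> r / 2 \<le> weight_primitive \<theta> r \<and> weight_primitive \<theta> r \<le> (1 + e) * r"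
    "\<And>r. r \<le> 0 \<Longrightarrow> - \<eta> \<le> r \<Longrightarrow> (1 + e) * r \<le> weight_primitive \<theta> r \<and> weight_primitive \<theta> r \<le> r / 2"
    using small_weights[OF par(1) e] by blast
  show ?thesis
  proof (rule that[OF \<eta>(1)])
    fix f g x assume "\<And>T. riemann_system \<theta> a T f g"
      "\<And>x. \<bar>x\<bar> > R \<Longrightarrow> f 0 x = 0 \<and> g 0 x = 0" "\<And>x. \<bar>f 0 x\<bar> \<le> \<eta> \<and> \<bar>g 0 x\<bar> \<le> \<eta>"
    then interpret small_global_solution \<theta> a R f g e \<eta>
      by unfold_locales (use par e \<eta> in auto)
    show "f 0 x = 0 \<and> g 0 x = 0" by (rule trivial_if_below_critical[OF crit])
  qed
next
  case False
  then have a1: "a = 1" using par by simp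
  \<comment> \<open>Constant factors do no harm in the critical argument, so \<open>e = 1\<close> is
    small enough.\<close>
  obtain \<eta>1 where \<eta>1: "\<eta>1 > 0" "(1 + \<theta>) * \<eta>1 \<le> 1/2"
    "\<And>r. \<bar>r\<bar> \<le> \<eta>1 \<Longrightarrow> weight \<theta> r \<le> 1 + 1 \<and> 1 \<le> (1 + 1) * weight \<theta> r"
    "\<And>r. 0 \<le> r \<Longrightarrow> r \<le> \<eta>1 \<Longrightarrow> r / 2 \<le> weight_primitive \<theta> r \<and> weight_primitive \<theta> r \<le> (1 + 1) * r"
    "\<And>r. r \<le> 0 \<Longrightarrow> - \<eta>1 \<le> r \<Longrightarrow> (1 + 1) * r \<le> weight_primitive \<theta> r \<and> weight_primitive \<theta> r \<le> r / 2"
    using small_weights[OF par(1), of 1] by auto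
  obtain \<eta>2 where \<eta>2: "\<eta>2 > 0" "\<And>r. \<bar>r\<bar> \<le> \<eta>2 \<Longrightarrow> 1/2 \<le> dens \<theta> r \<and> r\<^sup>2 / 4 \<le> internal_energy \<theta> r"
    using small_energy[OF par(1)] by blast
  define \<eta> where "\<eta> = min \<eta>1 \<eta>2"
  have \<eta>: "\<eta> > 0" "\<eta> \<le> \<eta>1" "\<eta> \<le> \<eta>2" using \<eta>1(1) \<eta>2(1) by (auto simp: \<eta>_def)
  have "(1 + \<theta>) * \<eta> \<le> (1 + \<theta>) * \<eta>1" using \<eta> par by (intro mult_left_mono) auto
  with \<eta>1(2) have \<eta>': "(1 + \<theta>) * \<eta> \<le> 1/2" by simp
  show ?thesis
  proof (rule that[OF \<eta>(1)])
    fix f g x assume *: "\<And>T. riemann_system \<theta> a T f g"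
      "\<And>x. \<bar>x\<bar> > R \<Longrightarrow> f 0 x = 0 \<and> g 0 x = 0" "\<And>x. \<bar>f 0 x\<bar> \<le> \<eta> \<and> \<bar>g 0 x\<bar> \<le> \<eta>"
    interpret critical_solution \<theta> a R f g 1 \<eta>
    proof unfold_locales
      show "weight \<theta> r \<le> 1 + 1 \<and> 1 \<le> (1 + 1) * weight \<theta> r" if "\<bar>r\<bar> \<le> \<eta>" for r using \<eta>1(3) \<eta> that by force
      show "r / 2 \<le> weight_primitive \<theta> r \<and> weight_primitive \<theta> r \<le> (1 + 1) * r" if "0 \<le> r" "r \<le> \<eta>" for r using \<eta>1(4)[of r] \<eta> that by force
      show "(1 + 1) * r \<le> weight_primitive \<theta> r \<and> weight_primitive \<theta> r \<le> r / 2" if "r \<le> 0" "- \<eta> \<le> r" for r using \<eta>1(5)[of r] \<eta> that by force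
      show "1/2 \<le> dens \<theta> r \<and> r\<^sup>2 / 4 \<le> internal_energy \<theta> r" if "\<bar>r\<bar> \<le> \<eta>" for r using \<eta>2(2)[of r] \<eta> that by force
    qed (use par \<eta> \<eta>' a1 * in auto)
    show "f 0 x = 0 \<and> g 0 x = 0" by (rule trivial_if_critical)
  qed
qed

section \<open>Small data and the lifespan\<close>

lemma supp_superset: "h x \<noteq> 0 \<Longrightarrow> x \<in> supp h"
  unfolding supp_def support_on_def by (rule subsetD[OF closure_subset]) simp

lemma test_function_bounded:
  assumes "test_function h"
  obtains M where "\<And>x. \<bar>h x\<bar> \<le> M"
proof -
  have "h differentiable (at x)" for x
    using assms unfolding test_function_def smooth_def by (metis funpow_0)
  then have "continuous_on (supp h) h"
    by (meson continuous_at_imp_continuous_on differentiable_imp_continuous_within)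
  moreover have "compact (supp h)" using assms by (simp add: test_function_def)
  ultimately have "bounded (h ` supp h)" by (intro compact_imp_bounded compact_continuous_image)
  then obtain M where M: "\<forall>x\<in>supp h. \<bar>h x\<bar> \<le> M" unfolding bounded_iff by auto
  have "\<bar>h x\<bar> \<le> max M 0" for x
  proof (cases "h x = 0")
    case False
    then have "x \<in> supp h" by (rule supp_superset)
    with M show ?thesis by fastforce
  qed simp
  then show ?thesis by (rule that)
qed

lemma lifespan_infinite_imp_long_solutions:
  assumes "\<not> lifespan \<gamma> \<mu> \<epsilon> \<rho>\<^sub>0 u\<^sub>0 < \<infinity>" "N \<ge> 0"
  obtains T \<rho> u where "T > N" "C1_solution \<gamma> \<mu> \<epsilon> \<rho>\<^sub>0 u\<^sub>0 T \<rho> u"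
proof -
  have "ennreal N < lifespan \<gamma> \<mu> \<epsilon> \<rho>\<^sub>0 u\<^sub>0"
    using assms(1) by (simp add: less_top not_less top_unique)
  then obtain T where "0 < T" "\<exists>\<rho> u. C1_solution \<gamma> \<mu> \<epsilon> \<rho>\<^sub>0 u\<^sub>0 T \<rho> u" "ennreal N < ennreal T"
    unfolding lifespan_def less_SUP_iff by blast
  moreover from this have "N < T" using assms(2) by (simp add: ennreal_less_iff)
  ultimately show ?thesis using that by blast
qed

theorem theorem1p2:
  fixes \<gamma> \<mu> R :: real and \<rho>\<^sub>0 u\<^sub>0 :: "real \<Rightarrow> real"
  assumes "\<gamma> > 1" and "0 \<le> \<mu>" and "\<mu> \<le> 2" and "R > 0"
    and "test_function \<rho>\<^sub>0" and "supp \<rho>\<^sub>0 \<subseteq> {x. \<bar>x\<bar> \<le> R}"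
    and "test_function u\<^sub>0" and "supp u\<^sub>0 \<subseteq> {x. \<bar>x\<bar> \<le> R}"
    and "\<exists>R\<^sub>0. 0 < R\<^sub>0 \<and> R\<^sub>0 < R \<and>
           (\<forall>r. R\<^sub>0 < r \<and> r < R \<longrightarrow> q0 \<rho>\<^sub>0 r > 0 \<and> q1 \<rho>\<^sub>0 u\<^sub>0 r \<ge> 0)"
  shows "\<exists>\<epsilon>\<^sub>0>0. \<forall>\<epsilon>. 0 < \<epsilon> \<and> \<epsilon> < \<epsilon>\<^sub>0 \<longrightarrow> lifespan \<gamma> \<mu> \<epsilon> \<rho>\<^sub>0 u\<^sub>0 < \<infinity>"
proof -
  define \<theta> where "\<theta> = (\<gamma> - 1) / 2"
  define a where "a = \<mu> / 2"
  have par: "\<theta> > 0" "0 \<le> a" "a \<le> 1" using assms(1-3) by (auto simp: \<theta>_def a_def)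
  obtain \<eta> where \<eta>: "\<eta> > 0" and trivial: "\<And>f g x. (\<And>T. riemann_system \<theta> a T f g) \<Longrightarrow>
     (\<And>x. \<bar>x\<bar> > R \<Longrightarrow> f 0 x = 0 \<and> g 0 x = 0) \<Longrightarrow> (\<And>x. \<bar>f 0 x\<bar> \<le> \<eta> \<and> \<bar>g 0 x\<bar> \<le> \<eta>) \<Longrightarrow>
     f 0 x = 0 \<and> g 0 x = 0"
    using small_global_solution_trivial[OF par assms(4)] by blast
  have out: "h x = 0" if "supp h \<subseteq> {x. \<bar>x\<bar> \<le> R}" "\<bar>x\<bar> > R" for h x
  proof (rule ccontr)
    assume "h x \<noteq> 0"
    then have "x \<in> supp h" by (rule supp_superset)
    with that(1) have "\<bar>x\<bar> \<le> R" by blast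
    with that(2) show False by simp
  qed
  obtain M1 where M1: "\<And>x. \<bar>\<rho>\<^sub>0 x\<bar> \<le> M1" using test_function_bounded[OF assms(5)] by blast
  obtain M2 where M2: "\<And>x. \<bar>u\<^sub>0 x\<bar> \<le> M2" using test_function_bounded[OF assms(7)] by blast
  have M0: "0 \<le> M1" "0 \<le> M2" using M1[of 0] M2[of 0] by auto
  have "isCont (rel_sound \<theta>) 1" using rel_sound_deriv[OF par(1), of 1] by (auto intro: DERIV_isCont)
  then have "(rel_sound \<theta> \<longlongrightarrow> 0) (nhds 1)"
    unfolding isCont_def tendsto_at_iff_tendsto_nhds by (simp add: rel_sound_def)
  from tendstoD[OF this half_gt_zero[OF \<eta>]]
  obtain d where d: "d > 0" "\<And>s. \<bar>s - 1\<bar> < d \<Longrightarrow> \<bar>rel_sound \<theta> s\<bar> < \<eta> / 2"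
    unfolding eventually_nhds_metric by (auto simp: dist_real_def)
  \<comment> \<open>The first entry makes \<open>rel_sound\<close> of the initial density smaller
    than \<open>\<eta> / 2\<close>, the second does the same for the initial velocity; adding 1 to
    the bounds avoids a division by zero.\<close>
  define \<epsilon>0 where "\<epsilon>0 = min (d / (M1 + 1)) (\<eta> / (2 * (M2 + 1)))"
  have \<epsilon>0: "\<epsilon>0 > 0" using d \<eta> M0 by (simp add: \<epsilon>0_def)
  have "lifespan \<gamma> \<mu> \<epsilon> \<rho>\<^sub>0 u\<^sub>0 < \<infinity>" if \<epsilon>: "0 < \<epsilon>" "\<epsilon> < \<epsilon>0" for \<epsilon>
  proof (rule ccontr)
    assume inf: "\<not> lifespan \<gamma> \<mu> \<epsilon> \<rho>\<^sub>0 u\<^sub>0 < \<infinity>"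
    define f0 where "f0 x = \<epsilon> * u\<^sub>0 x + rel_sound \<theta> (1 + \<epsilon> * \<rho>\<^sub>0 x)" for x
    define g0 where "g0 x = \<epsilon> * u\<^sub>0 x - rel_sound \<theta> (1 + \<epsilon> * \<rho>\<^sub>0 x)" for x
    have init: "f0 x = 0 \<and> g0 x = 0" if "\<bar>x\<bar> > R" for x
      using out[OF assms(6) that] out[OF assms(8) that] by (simp add: f0_def g0_def rel_sound_def)
    have "\<exists>f g. riemann_system \<theta> a (real n + 1) f g \<and> f 0 = f0 \<and> g 0 = g0" for n :: nat
    proof -
      obtain T \<rho> u where T: "T > real n + 1" and sol: "C1_solution \<gamma> \<mu> \<epsilon> \<rho>\<^sub>0 u\<^sub>0 T \<rho> u"
        by (rule lifespan_infinite_imp_long_solutions[OF inf, of "real n + 1"]) auto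
      have "u 0 x = \<epsilon> * u\<^sub>0 x" "\<rho> 0 x = 1 + \<epsilon> * \<rho>\<^sub>0 x" for x using sol by (auto simp: C1_solution_def)
      with riemann_system_mono[OF C1_solution_riemann_system[OF assms(1) sol]] T show ?thesis
        unfolding \<theta>_def[symmetric] a_def[symmetric]
        by (intro exI[of _ "\<lambda>t x. u t x + rel_sound \<theta> (\<rho> t x)"] exI[of _ "\<lambda>t x. u t x - rel_sound \<theta> (\<rho> t x)"])
           (auto simp: f0_def g0_def)
    qed
    from riemann_system_glue[OF par(1,2) this init]
    obtain f g where fg: "\<And>T. riemann_system \<theta> a T f g" "f 0 = f0" "g 0 = g0" by metis
    have small: "\<bar>f0 x\<bar> \<le> \<eta> \<and> \<bar>g0 x\<bar> \<le> \<eta>" for x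
    proof -
      have "\<bar>\<epsilon> * \<rho>\<^sub>0 x\<bar> \<le> \<epsilon> * M1" using \<epsilon> M1[of x] by (simp add: abs_mult)
      also have "\<dots> < d"
      proof -
        have "\<epsilon> * (M1 + 1) < d" using \<epsilon> M0 by (simp add: \<epsilon>0_def pos_less_divide_eq)
        then show ?thesis using \<epsilon> by (simp add: algebra_simps)
      qed
      finally have "\<bar>rel_sound \<theta> (1 + \<epsilon> * \<rho>\<^sub>0 x)\<bar> < \<eta> / 2" by (intro d(2)) simp
      moreover have "\<bar>\<epsilon> * u\<^sub>0 x\<bar> \<le> \<epsilon> * M2" using \<epsilon> M2[of x] by (simp add: abs_mult)
      moreover have "\<epsilon> * M2 \<le> \<eta> / 2"
      proof -
        have "\<epsilon> * (2 * (M2 + 1)) < \<eta>" using \<epsilon> M0 by (simp add: \<epsilon>0_def pos_less_divide_eq)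
        then show ?thesis using \<epsilon> by (simp add: algebra_simps)
      qed
      ultimately show ?thesis unfolding f0_def g0_def by linarith
    qed
    have zero: "f0 x = 0 \<and> g0 x = 0" for x
      using trivial[OF fg(1), of x] init small unfolding fg(2,3) by blast
    obtain T \<rho> u where T: "T > 0" and sol: "C1_solution \<gamma> \<mu> \<epsilon> \<rho>\<^sub>0 u\<^sub>0 T \<rho> u"
      by (rule lifespan_infinite_imp_long_solutions[OF inf order_refl])
    have "\<rho>\<^sub>0 x = 0" for x
    proof -
      \<comment> \<open>Positivity of the initial density, read off a solution, is what lets
        \<open>ln\<close> turn \<open>powr \<theta> = 1\<close> into
        \<open>1 + \<epsilon> * \<rho>\<^sub>0 x = 1\<close>.\<close>
      have "0 \<in> {0..<T}" using T by simp
      then have "\<rho> 0 x > 0" "\<rho> 0 x = 1 + \<epsilon> * \<rho>\<^sub>0 x"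
        using sol unfolding C1_solution_def by blast+
      then have pos: "1 + \<epsilon> * \<rho>\<^sub>0 x > 0" by simp
      have "rel_sound \<theta> (1 + \<epsilon> * \<rho>\<^sub>0 x) = 0" using zero[of x] by (simp add: f0_def g0_def)
      then have "(1 + \<epsilon> * \<rho>\<^sub>0 x) powr \<theta> = 1" using par by (simp add: rel_sound_def)
      then have "ln ((1 + \<epsilon> * \<rho>\<^sub>0 x) powr \<theta>) = 0" by simp
      then have "ln (1 + \<epsilon> * \<rho>\<^sub>0 x) = 0" using pos par by (simp add: ln_powr)
      then have "1 + \<epsilon> * \<rho>\<^sub>0 x = 1" using pos by (simp add: ln_eq_zero_iff)
      then show ?thesis using \<epsilon> by simp
    qed
    then have "q0 \<rho>\<^sub>0 r = 0" for r by (simp add: q0_def set_lebesgue_integral_def)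
    moreover obtain R0 where "R0 < R" "\<forall>r. R0 < r \<and> r < R \<longrightarrow> q0 \<rho>\<^sub>0 r > 0" using assms(9) by blast
    ultimately show False by (metis dense order_less_irrefl)
  qed
  with \<epsilon>0 show ?thesis by blast
qed

end
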